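(* Consider Smoluchowski's discrete model (defined in the context) and assume there exists $\gamma>1/3$ such that $\alpha(N)/(N^{2/3}\log^{\gamma}N)\to\infty$ and $\alpha(N)/N\to 0$. Fix $t\ge 0$. Pick a particle $i$ uniformly at random in $S(t)$ and let $\mathcal{C}_{\mathrm{typ}}(t)$ be the connected component of $i$ in the configuration in solution $C(t)$, rooted at $i$. Then for every finite rooted tree $\mathcal{T}$ (trees and graphs considered up to rooted isomorphism), \[ \lim_{N\to\infty}\mathbb{P}(\mathcal{C}_{\mathrm{typ}}(t)=\mathcal{T})=\mathbb{P}(\mathrm{GW}(\mathcal{P}(t n_t))=\mathcal{T}), \] where $n_t=1$ for $t\le 1$ and $n_t=1/t$ for $t\ge 1$, and $\mathrm{GW}(\mathcal{P}(\lambda))$ denotes a Galton–Watson tree with Poisson$(\lambda)$ offspring distribution. In particular, for every $t\ge 1$ the limit is the law of a critical Galton–Watson tree with Poisson$(1)$ offspring distribution.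
   Context: Smoluchowski's discrete model: fix $N\ge 2$ and a sequence $(\alpha(N))$ with $\alpha(N)\to\infty$, $\alpha(N)/N\to0$. Particles are $[N]$. Each unordered pair $\{i,j\}$ gets an independent exponential clock $e_{ij}$ with parameter $1/N$. Initially no links exist. When $e_{ij}$ rings, the link $\{i,j\}$ is created unless $i$ or $j$ belongs at that moment to a cluster (connected component of the graph of created links) of size $\ge\alpha(N)$, in which case it is never created. Particles in clusters of size $<\alpha(N)$ are in solution; $S(t)$ is the set of particles in solution at time $t$, and $C(t)$ is the graph with vertex set $S(t)$ and edges $\{i,j\}\subset S(t)$ with $e_{ij}\le t$. *)

theory Defs
  imports "HOL-Probability.Probability"
begin

datatype ptree = PNode "ptree list"

inductive tree_vertex :: "ptree \<Rightarrow> nat list \<Rightarrow> bool" where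
  root: "tree_vertex t []"
| child: "i < length ts \<Longrightarrow> tree_vertex (ts ! i) p \<Longrightarrow> tree_vertex (PNode ts) (i # p)"

definition tree_verts :: "ptree \<Rightarrow> nat list set" where
  "tree_verts t = {p. tree_vertex t p}"

definition tree_adj :: "ptree \<Rightarrow> nat list \<Rightarrow> nat list \<Rightarrow> bool" where
  "tree_adj t u v \<longleftrightarrow> u \<in> tree_verts t \<and> v \<in> tree_verts t \<and>
     (\<exists>i. v = u @ [i] \<or> u = v @ [i])"

definition rooted_iso ::
  "'a set \<Rightarrow> ('a \<Rightarrow> 'a \<Rightarrow> bool) \<Rightarrow> 'a \<Rightarrow> 'b set \<Rightarrow> ('b \<Rightarrow> 'b \<Rightarrow> bool) \<Rightarrow> 'b \<Rightarrow> bool" where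
  "rooted_iso V1 A1 r1 V2 A2 r2 \<longleftrightarrow>
     (\<exists>f. bij_betw f V1 V2 \<and> r1 \<in> V1 \<and> f r1 = r2 \<and>
          (\<forall>x\<in>V1. \<forall>y\<in>V1. A1 x y \<longleftrightarrow> A2 (f x) (f y)))"

definition poisson_p :: "real \<Rightarrow> nat \<Rightarrow> real" where
  "poisson_p lam k = lam ^ k / fact k * exp (- lam)"

fun gw_plane_prob :: "(nat \<Rightarrow> real) \<Rightarrow> ptree \<Rightarrow> real" where
  "gw_plane_prob p (PNode ts) = p (length ts) * prod_list (map (gw_plane_prob p) ts)"

definition gw_poisson_law :: "real \<Rightarrow> ptree \<Rightarrow> real" where
  "gw_poisson_law lam T =
     (\<Sum>s\<in>{s. rooted_iso (tree_verts s) (tree_adj s) [] (tree_verts T) (tree_adj T) []}.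
        gw_plane_prob (poisson_p lam) s)"

definition n_t :: "real \<Rightarrow> real" where
  "n_t t = (if t \<le> 1 then 1 else 1 / t)"

text \<open>Unordered pairs of particles in [N] = {0..<N}, encoded as (i,j) with i < j.\<close>
definition pairs :: "nat \<Rightarrow> (nat \<times> nat) set" where
  "pairs N = {(i, j). i < j \<and> j < N}"

definition pairs_list :: "nat \<Rightarrow> (nat \<times> nat) list" where
  "pairs_list N = concat (map (\<lambda>j. map (\<lambda>i. (i, j)) [0..<j]) [0..<N])"

definition link_adj :: "(nat \<times> nat) set \<Rightarrow> nat \<Rightarrow> nat \<Rightarrow> bool" where
  "link_adj E x y \<longleftrightarrow> (x, y) \<in> E \<or> (y, x) \<in> E"

definition cluster :: "(nat \<times> nat) set \<Rightarrow> nat \<Rightarrow> nat set" where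
  "cluster E x = {y. (x, y) \<in> {(a, b). link_adj E a b}\<^sup>*}"

definition add_link :: "real \<Rightarrow> (nat \<times> nat) set \<Rightarrow> nat \<times> nat \<Rightarrow> (nat \<times> nat) set" where
  "add_link \<alpha> E p =
     (if real (card (cluster E (fst p))) < \<alpha> \<and> real (card (cluster E (snd p))) < \<alpha>
      then insert p E else E)"

text \<open>Links created up to time t: clocks processed in increasing order of ringing time.\<close>
definition created :: "nat \<Rightarrow> real \<Rightarrow> (nat \<times> nat \<Rightarrow> real) \<Rightarrow> real \<Rightarrow> (nat \<times> nat) set" where
  "created N \<alpha> e t =
     foldl (add_link \<alpha>) {} (filter (\<lambda>p. e p \<le> t) (sort_key e (pairs_list N)))"

definition in_solution :: "nat \<Rightarrow> real \<Rightarrow> (nat \<times> nat \<Rightarrow> real) \<Rightarrow> real \<Rightarrow> nat set" where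
  "in_solution N \<alpha> e t = {i. i < N \<and> real (card (cluster (created N \<alpha> e t) i)) < \<alpha>}"

definition sol_adj :: "nat \<Rightarrow> real \<Rightarrow> (nat \<times> nat \<Rightarrow> real) \<Rightarrow> real \<Rightarrow> nat \<Rightarrow> nat \<Rightarrow> bool" where
  "sol_adj N \<alpha> e t x y \<longleftrightarrow>
     x \<in> in_solution N \<alpha> e t \<and> y \<in> in_solution N \<alpha> e t \<and>
     (((x, y) \<in> pairs N \<and> e (x, y) \<le> t) \<or> ((y, x) \<in> pairs N \<and> e (y, x) \<le> t))"

definition sol_comp :: "nat \<Rightarrow> real \<Rightarrow> (nat \<times> nat \<Rightarrow> real) \<Rightarrow> real \<Rightarrow> nat \<Rightarrow> nat set" where
  "sol_comp N \<alpha> e t i = {y. (i, y) \<in> {(a, b). sol_adj N \<alpha> e t a b}\<^sup>*}"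

text \<open>Conditional probability, given the clocks, that the component of a uniform particle of
  S(t), rooted at it, is rooted-isomorphic to T (0 if S(t) is empty).\<close>
definition typ_frac :: "nat \<Rightarrow> real \<Rightarrow> real \<Rightarrow> ptree \<Rightarrow> (nat \<times> nat \<Rightarrow> real) \<Rightarrow> real" where
  "typ_frac N \<alpha> t T e =
     (let S = in_solution N \<alpha> e t in
      if S = {} then 0 else
      real (card {i \<in> S. rooted_iso (sol_comp N \<alpha> e t i) (sol_adj N \<alpha> e t) i
                                     (tree_verts T) (tree_adj T) []}) / real (card S))"

definition clock_space :: "nat \<Rightarrow> (nat \<times> nat \<Rightarrow> real) measure" where
  "clock_space N = (\<Pi>\<^sub>M p \<in> pairs N. density lborel (exponential_density (1 / real N)))"

definition typ_prob :: "nat \<Rightarrow> real \<Rightarrow> real \<Rightarrow> ptree \<Rightarrow> real" where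
  "typ_prob N \<alpha> t T = (\<integral>e. typ_frac N \<alpha> t T e \<partial>clock_space N)"

end

theory Submission
  imports Defs "HOL-Real_Asymp.Real_Asymp" "HOL-Combinatorics.Permutations"
begin

text \<open>
  Let \<open>n(s)\<close> be the fraction of particles in solution at time \<open>s\<close> and \<open>X(t)\<close> its integral over
  \<open>[0, t]\<close>. The proof rests on an exact identity: for a set \<open>A\<close> of \<open>m\<close> particles, fewer than the
  threshold, the event that \<open>A\<close> carries prescribed links and is linked to nothing else says that the
  clock from each \<open>a \<in> A\<close> to each other particle \<open>v\<close> does not ring while \<open>v\<close> is in solution in the
  dynamics without \<open>A\<close>. Integrating out these clocks leaves the factor \<open>exp (- m X(t))\<close>, where
  \<open>X(t)\<close> refers to \<open>N - m\<close> particles. Applied to the number of isolated particles, the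
  identity makes \<open>K \<mapsto> E (\<psi> (X))\<close>, for \<open>K\<close> particles, almost convex; being bounded, it is almost
  constant near \<open>N\<close>, and \<open>N - m\<close> may be replaced by \<open>N\<close>.

  Tree components then have density proportional to \<open>t ^ (m - 1) * E (exp (- m X(t)))\<close>. Since their
  total mass is at most one and the exponential generating function of plane trees diverges beyond
  \<open>1/e\<close>, \<open>X(t) \<ge> 1 + ln t - o(1)\<close> with high probability. Conversely this bounds the mass of clusters
  of bounded size by \<open>1/s + o(1)\<close> at time \<open>s\<close>. The mass \<open>r\<close> of intermediate clusters, of size between
  \<open>M\<close> and the threshold, is negligible in time average: two of them merge at rate about \<open>N r\<^sup>2 / 2\<close>,
  but at most \<open>N / M\<close> such mergers can occur. Hence \<open>X(t)\<close> converges to \<open>t\<close> for \<open>t \<le> 1\<close> and to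
  \<open>1 + ln t\<close> for \<open>t \<ge> 1\<close>, and by monotonicity \<open>n(t)\<close> converges to the derivative of this limit.
\<close>

subsection \<open>Clusters\<close>

text \<open>The identity for isolated sets admits an arbitrary test function of
  \<open>t - X(t)\<close>: particles of an isolated set never gel, so removing them leaves the total
  gelled time unchanged. Trees can thus be counted on events expressed through \<open>X\<close>,
  while \<open>X\<close> is still random. The obstacle is the passage from \<open>N\<close> to
  \<open>N - m\<close> particles: one particle more may alter which clusters merge or gel, so the
  two dynamics are not compared path by path. Instead, a second moment built on the number of
  isolated particles is nonnegative; expanded by the identity, it bounds second differences in
  \<open>K\<close> below by a multiple of \<open>- 1/N\<close>, and a sequence in
  \<open>[0, 1]\<close> with this property near \<open>N\<close> has increments of order
  \<open>1 / sqrt N\<close>. The constant \<open>1/e\<close>: with \<open>x = t * exp (- X)\<close>,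
  plane trees of size \<open>m\<close> carry weights proportional to
  \<open>x ^ m / orderings\<close>, whose sum solves \<open>w = x * exp w\<close>; this has a real
  solution only for \<open>x \<le> 1/e\<close>, that is for \<open>X \<ge> 1 + ln t\<close>. Upper
  bounds on \<open>X\<close> are proved in mean only; with the lower bound in probability they give
  convergence in L1.\<close>

lemma cluster_self [simp]: "x \<in> cluster E x"
  by (simp add: cluster_def)

lemma cluster_sym: "y \<in> cluster E x \<Longrightarrow> x \<in> cluster E y"
proof -
  assume "y \<in> cluster E x"
  moreover have "sym {(a, b). link_adj E a b}"
    by (auto simp: sym_def link_adj_def)
  ultimately show ?thesis
    unfolding cluster_def by (auto dest: sym_rtrancl[THEN symD])
qed

lemma cluster_trans: "y \<in> cluster E x \<Longrightarrow> z \<in> cluster E y \<Longrightarrow> z \<in> cluster E x"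
  unfolding cluster_def by auto

lemma cluster_eqI: "y \<in> cluster E x \<Longrightarrow> cluster E y = cluster E x"
  using cluster_sym cluster_trans by blast

lemma cluster_step: "y \<in> cluster E x \<Longrightarrow> link_adj E y z \<Longrightarrow> z \<in> cluster E x"
  unfolding cluster_def by (auto intro: rtrancl_into_rtrancl)

lemma cluster_mono: "E \<subseteq> F \<Longrightarrow> cluster E x \<subseteq> cluster F x"
proof -
  assume "E \<subseteq> F"
  then have "{(a, b). link_adj E a b} \<subseteq> {(a, b). link_adj F a b}"
    by (auto simp: link_adj_def)
  then show ?thesis unfolding cluster_def using rtrancl_mono by blast
qed

lemma cluster_closed:
  assumes "x \<in> U" "\<And>y z. y \<in> U \<Longrightarrow> link_adj E y z \<Longrightarrow> z \<in> U"
  shows "cluster E x \<subseteq> U"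
proof
  fix y assume "y \<in> cluster E x"
  then have "(x, y) \<in> {(a, b). link_adj E a b}\<^sup>*" by (simp add: cluster_def)
  then show "y \<in> U" by (induction rule: rtrancl_induct) (use assms in auto)
qed

lemma cluster_subset:
  assumes "E \<subseteq> V \<times> V" "x \<in> V" shows "cluster E x \<subseteq> V"
  by (rule cluster_closed) (use assms in \<open>auto simp: link_adj_def\<close>)

lemma finite_cluster [simp]: assumes "finite E" shows "finite (cluster E x)"
proof (rule finite_subset)
  show "cluster E x \<subseteq> insert x (fst ` E \<union> snd ` E)"
    by (rule cluster_closed) (force simp: link_adj_def)+
qed (use assms in auto)

text \<open>Exploring the cluster of \<open>x\<close> only reads links with an end in it. Links
  elsewhere, in particular those of an isolated set, can therefore be dropped.\<close>

lemma cluster_restrict: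
  assumes "\<And>p. p \<in> E \<Longrightarrow> fst p \<in> cluster E x \<or> snd p \<in> cluster E x \<Longrightarrow> p \<in> F" "F \<subseteq> E"
  shows "cluster F x = cluster E x"
proof
  show "cluster E x \<subseteq> cluster F x"
  proof
    fix y assume "y \<in> cluster E x"
    then have "(x, y) \<in> {(a, b). link_adj E a b}\<^sup>*" by (simp add: cluster_def)
    then show "y \<in> cluster F x"
    proof (induction rule: rtrancl_induct)
      case (step y z)
      then have "y \<in> cluster E x" by (simp add: cluster_def)
      then have "link_adj F y z" using step(2) assms(1)[of "(y,z)"] assms(1)[of "(z,y)"]
        by (auto simp: link_adj_def)
      then show ?case using step(3) cluster_step by blast
    qed simp
  qed
qed (use assms in \<open>simp add: cluster_mono\<close>)

lemma cluster_image:
  assumes "inj_on f V" "E \<subseteq> V \<times> V" "x \<in> V"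
  shows "cluster (map_prod f f ` E) (f x) = f ` cluster E x"
proof
  have sub: "cluster E x \<subseteq> V" using cluster_subset assms by blast
  show "cluster (map_prod f f ` E) (f x) \<subseteq> f ` cluster E x"
  proof (rule cluster_closed)
    fix y z assume y: "y \<in> f ` cluster E x" and l: "link_adj (map_prod f f ` E) y z"
    then obtain u where u: "u \<in> cluster E x" "y = f u" by blast
    from l obtain a b where ab: "(y, z) = (f a, f b)" "link_adj E a b"
      unfolding link_adj_def by auto
    then have "a \<in> V" using assms(2) by (auto simp: link_adj_def)
    then have "a = u" using u ab sub assms(1) by (auto dest: inj_onD)
    then show "z \<in> f ` cluster E x" using ab u cluster_step by blast
  qed simp
  show "f ` cluster E x \<subseteq> cluster (map_prod f f ` E) (f x)"
  proof -
    have "cluster E x \<subseteq> {y. f y \<in> cluster (map_prod f f ` E) (f x)}"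
    proof (rule cluster_closed)
      fix y z assume "y \<in> {y. f y \<in> cluster (map_prod f f ` E) (f x)}" "link_adj E y z"
      then show "z \<in> {y. f y \<in> cluster (map_prod f f ` E) (f x)}"
        by (auto intro!: cluster_step[of "f y"]) (auto simp: link_adj_def intro: rev_image_eqI)
    qed simp
    then show ?thesis by blast
  qed
qed

lemma cluster_insert:
  assumes "b \<notin> cluster E a"
  shows "cluster (insert (a, b) E) x =
    (if x \<in> cluster E a \<union> cluster E b then cluster E a \<union> cluster E b else cluster E x)"
proof -
  have la: "link_adj (insert (a, b) E) y z \<longleftrightarrow> link_adj E y z \<or> (y, z) = (a, b) \<or> (z, y) = (a, b)" for y z
    by (auto simp: link_adj_def)
  have m: "cluster E y \<subseteq> cluster (insert (a, b) E) y" for y by (rule cluster_mono) auto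
  have ab: "b \<in> cluster (insert (a, b) E) a"
    using cluster_step[OF cluster_self] la by blast
  then have eqab: "cluster (insert (a, b) E) b = cluster (insert (a, b) E) a" by (rule cluster_eqI)
  show ?thesis
  proof (cases "x \<in> cluster E a \<union> cluster E b")
    case True
    then have "x \<in> cluster (insert (a, b) E) a" using m[of a] m[of b] eqab by blast
    then have "cluster (insert (a, b) E) x = cluster (insert (a, b) E) a" by (rule cluster_eqI)
    moreover have "cluster (insert (a, b) E) a \<subseteq> cluster E a \<union> cluster E b"
      by (rule cluster_closed) (auto simp: la intro: cluster_step)
    ultimately show ?thesis using True m[of a] m[of b] eqab by auto
  next
    case False
    have "cluster (insert (a, b) E) x \<subseteq> cluster E x"
    proof (rule cluster_closed)
      fix y z assume y: "y \<in> cluster E x" and l: "link_adj (insert (a, b) E) y z"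
      have "y \<noteq> a" "y \<noteq> b" using y False by (auto dest: cluster_sym)
      then show "z \<in> cluster E x" using l y by (auto simp: la intro: cluster_step)
    qed simp
    then show ?thesis using False m[of x] by auto
  qed
qed

lemma cluster_disjoint: "y \<notin> cluster E x \<Longrightarrow> cluster E x \<inter> cluster E y = {}"
  by (metis cluster_sym cluster_trans disjoint_iff)

subsection \<open>The links created from a set of clocks\<close>

definition in_sol :: "real \<Rightarrow> (nat \<times> nat) set \<Rightarrow> nat \<Rightarrow> bool" where
  "in_sol \<alpha> E v \<longleftrightarrow> real (card (cluster E v)) < \<alpha>"

text \<open>A declarative form of the dynamics, free of sorting. Tied clocks ignore each other,
  because only strictly earlier links enter a decision; agreement with the sequential
  \<open>created\<close> is therefore proved for distinct clocks, which is the almost sure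
  case.\<close>

definition created_by ::
  "real \<Rightarrow> (nat \<times> nat \<Rightarrow> real) \<Rightarrow> (nat \<times> nat) set \<Rightarrow> (nat \<times> nat) set \<Rightarrow> bool" where
  "created_by \<alpha> e Q C \<longleftrightarrow> C \<subseteq> Q \<and>
     (\<forall>p\<in>Q. p \<in> C \<longleftrightarrow> in_sol \<alpha> {q\<in>C. e q < e p} (fst p) \<and> in_sol \<alpha> {q\<in>C. e q < e p} (snd p))"

definition links :: "real \<Rightarrow> (nat \<times> nat \<Rightarrow> real) \<Rightarrow> (nat \<times> nat) set \<Rightarrow> (nat \<times> nat) set" where
  "links \<alpha> e Q = (THE C. created_by \<alpha> e Q C)"

lemma in_sol_antimono: "in_sol \<alpha> F v \<Longrightarrow> E \<subseteq> F \<Longrightarrow> finite F \<Longrightarrow> in_sol \<alpha> E v"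
  unfolding in_sol_def
  using card_mono[OF finite_cluster cluster_mono, of F E v] by simp

lemma in_sol_cluster: "y \<in> cluster E x \<Longrightarrow> in_sol \<alpha> E y \<longleftrightarrow> in_sol \<alpha> E x"
  by (simp add: in_sol_def cluster_eqI)

text \<open>Whether \<open>p\<close> belongs to a solution is decided by the strictly earlier
  clocks; induction on their number settles one pair after the other.\<close>

lemma created_by_unique:
  assumes "finite Q" "created_by \<alpha> e Q C" "created_by \<alpha> e Q D"
  shows "C = D"
proof -
  have *: "p \<in> C \<longleftrightarrow> p \<in> D" if "p \<in> Q" for p
    using that
  proof (induction "card {q\<in>Q. e q < e p}" arbitrary: p rule: less_induct)
    case less
    have "q \<in> C \<longleftrightarrow> q \<in> D" if "q \<in> Q" "e q < e p" for q
    proof (rule less.hyps[OF _ that(1)])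
      show "card {r \<in> Q. e r < e q} < card {r \<in> Q. e r < e p}"
        by (rule psubset_card_mono) (use assms(1) that in auto)
    qed
    then have "{q\<in>C. e q < e p} = {q\<in>D. e q < e p}"
      using assms by (auto simp: created_by_def)
    then show ?case using assms less.prems by (simp add: created_by_def)
  qed
  show ?thesis using * assms by (auto simp: created_by_def)
qed

text \<open>The last clock cannot influence earlier decisions. A tie with \<open>x\<close> is
  allowed, since tied links do not enter the decision about \<open>x\<close>.\<close>

lemma created_by_insert:
  assumes "created_by \<alpha> e Q C" "\<And>q. q \<in> Q \<Longrightarrow> e q \<le> e x" "x \<notin> Q"
  shows "created_by \<alpha> e (insert x Q)
    (if in_sol \<alpha> {q\<in>C. e q < e x} (fst x) \<and> in_sol \<alpha> {q\<in>C. e q < e x} (snd x)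
     then insert x C else C)"
proof -
  have 1: "{q \<in> insert x C. e q < e p} = {q \<in> C. e q < e p}" if "p \<in> insert x Q" for p
    using assms(2) that by fastforce
  show ?thesis using assms(1,3) 1 unfolding created_by_def by auto
qed

lemma created_by_exists:
  assumes "finite Q" shows "\<exists>C. created_by \<alpha> e Q C"
  using assms
proof (induction Q rule: finite_ranking_induct[where f = e])
  case empty
  show ?case by (auto simp: created_by_def)
next
  case (insert x S)
  then obtain C where C: "created_by \<alpha> e S C" by blast
  show ?case
  proof (cases "x \<in> S")
    case True
    then show ?thesis using C by (auto simp: insert_absorb)
  next
    case False
    then show ?thesis using created_by_insert[OF C insert.hyps(2) False] by blast
  qed
qed

lemma created_by_links: "finite Q \<Longrightarrow> created_by \<alpha> e Q (links \<alpha> e Q)"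
  unfolding links_def by (rule theI') (use created_by_exists created_by_unique in blast)

lemma links_eqI: "finite Q \<Longrightarrow> created_by \<alpha> e Q C \<Longrightarrow> links \<alpha> e Q = C"
  using created_by_links created_by_unique by blast

lemma links_subset: "finite Q \<Longrightarrow> links \<alpha> e Q \<subseteq> Q"
  using created_by_links by (auto simp: created_by_def)

lemma finite_links [simp]: "finite Q \<Longrightarrow> finite (links \<alpha> e Q)"
  by (rule finite_subset[OF links_subset])

text \<open>The dynamics is causal: on a set of clocks closed under taking earlier ones, it never
  consults the others.\<close>

lemma links_restrict:
  assumes "finite Q" "Q' \<subseteq> Q" "\<And>p q. p \<in> Q' \<Longrightarrow> q \<in> Q \<Longrightarrow> e q < e p \<Longrightarrow> q \<in> Q'"
  shows "links \<alpha> e Q' = links \<alpha> e Q \<inter> Q'"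
proof (rule links_eqI)
  have c: "created_by \<alpha> e Q (links \<alpha> e Q)" using assms created_by_links by blast
  then have "{q \<in> links \<alpha> e Q \<inter> Q'. e q < e p} = {q \<in> links \<alpha> e Q. e q < e p}" if "p \<in> Q'" for p
    using assms(3)[OF that] by (auto simp: created_by_def)
  then show "created_by \<alpha> e Q' (links \<alpha> e Q \<inter> Q')"
    using c assms(2) by (auto simp: created_by_def)
qed (use assms finite_subset in blast)

lemma links_before:
  assumes "finite P" "s \<le> t"
  shows "links \<alpha> e {p\<in>P. e p < s} = {p \<in> links \<alpha> e {p\<in>P. e p < t}. e p < s}"
proof -
  have "links \<alpha> e {p\<in>P. e p < s} = links \<alpha> e {p\<in>P. e p < t} \<inter> {p\<in>P. e p < s}"
    by (rule links_restrict) (use assms in auto)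
  then show ?thesis using links_subset[of "{p\<in>P. e p < t}" \<alpha> e] assms by auto
qed

lemma links_iff:
  assumes "finite P" "p \<in> P" "e p < t"
  shows "p \<in> links \<alpha> e {p\<in>P. e p < t} \<longleftrightarrow>
    in_sol \<alpha> (links \<alpha> e {q\<in>P. e q < e p}) (fst p) \<and> in_sol \<alpha> (links \<alpha> e {q\<in>P. e q < e p}) (snd p)"
proof -
  have "created_by \<alpha> e {p\<in>P. e p < t} (links \<alpha> e {p\<in>P. e p < t})"
    using assms created_by_links by simp
  moreover have "links \<alpha> e {q\<in>P. e q < e p} = {q \<in> links \<alpha> e {p\<in>P. e p < t}. e q < e p}"
    by (rule links_before) (use assms in auto)
  ultimately show ?thesis using assms unfolding created_by_def by (metis (mono_tags, lifting) mem_Collect_eq)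
qed

text \<open>Only the order of the ringing times enters the rule. This later reduces measurability to
  finitely many comparisons of clocks.\<close>

lemma links_cong:
  assumes "\<And>p q. p \<in> Q \<Longrightarrow> q \<in> Q \<Longrightarrow> e p < e q \<longleftrightarrow> e' p < e' q"
  shows "links \<alpha> e Q = links \<alpha> e' Q"
proof -
  have "{q \<in> C. e q < e p} = {q \<in> C. e' q < e' p}" if "C \<subseteq> Q" "p \<in> Q" for C p
    using assms that by blast
  then have "created_by \<alpha> e Q = created_by \<alpha> e' Q"
    by (auto simp: created_by_def fun_eq_iff)
  then show ?thesis by (simp add: links_def)
qed

text \<open>The rule reads only cardinalities of clusters, and an injective relabelling preserves
  these.\<close>

lemma links_image:
  assumes "inj_on f V" "Q \<subseteq> V \<times> V" "finite Q"
  shows "links \<alpha> e (map_prod f f ` Q) = map_prod f f ` links \<alpha> (e \<circ> map_prod f f) Q"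
proof (rule links_eqI)
  let ?g = "map_prod f f" and ?C = "links \<alpha> (e \<circ> map_prod f f) Q"
  have C: "created_by \<alpha> (e \<circ> ?g) Q ?C" using created_by_links assms by blast
  then have CQ: "?C \<subseteq> Q" by (simp add: created_by_def)
  have inj: "inj_on ?g Q"
    using assms by (auto simp: inj_on_def subset_iff)
  have sol: "in_sol \<alpha> {q \<in> ?g ` ?C. e q < e (?g p)} (f v) \<longleftrightarrow> in_sol \<alpha> {q \<in> ?C. (e \<circ> ?g) q < (e \<circ> ?g) p} v"
    if "p \<in> Q" "v \<in> V" for p v
  proof -
    let ?E = "{q \<in> ?C. (e \<circ> ?g) q < (e \<circ> ?g) p}"
    have "{q \<in> ?g ` ?C. e q < e (?g p)} = ?g ` ?E" by auto
    moreover have "cluster (?g ` ?E) (f v) = f ` cluster ?E v"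
      by (rule cluster_image[OF assms(1)]) (use CQ assms that in auto)
    moreover have "cluster ?E v \<subseteq> V" by (rule cluster_subset) (use CQ assms that in auto)
    ultimately show ?thesis unfolding in_sol_def
      using card_image[OF inj_on_subset[OF assms(1)]] by simp
  qed
  have "?g p \<in> ?g ` ?C \<longleftrightarrow> p \<in> ?C" if "p \<in> Q" for p
    using inj CQ that by (metis inj_on_image_mem_iff)
  moreover have "in_sol \<alpha> {q \<in> ?g ` ?C. e q < e (?g p)} (fst (?g p)) \<longleftrightarrow>
      in_sol \<alpha> {q \<in> ?C. (e \<circ> ?g) q < (e \<circ> ?g) p} (fst p)"
    "in_sol \<alpha> {q \<in> ?g ` ?C. e q < e (?g p)} (snd (?g p)) \<longleftrightarrow>
      in_sol \<alpha> {q \<in> ?C. (e \<circ> ?g) q < (e \<circ> ?g) p} (snd p)" if "p \<in> Q" for p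
    using sol[OF that, of "fst p"] sol[OF that, of "snd p"] subsetD[OF assms(2) that]
    by (simp_all add: mem_Times_iff)
  ultimately show "created_by \<alpha> e (?g ` Q) (?g ` ?C)"
    unfolding created_by_def
    using C[unfolded created_by_def] image_mono[OF CQ, of ?g] by (simp del: map_prod_simp)
qed (use assms in auto)

lemma created_by_iff:
  "created_by \<alpha> e Q C \<Longrightarrow> p \<in> Q \<Longrightarrow>
   p \<in> C \<longleftrightarrow> in_sol \<alpha> {q\<in>C. e q < e p} (fst p) \<and> in_sol \<alpha> {q\<in>C. e q < e p} (snd p)"
  by (simp add: created_by_def)

text \<open>When the clocks are processed in strictly increasing order, the accumulated set is
  exactly the strictly earlier part of the configuration, so each \<open>add_link\<close> applies
  the rule of \<open>created_by\<close>.\<close>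

lemma foldl_add_link:
  assumes "sorted_wrt (\<lambda>p q. e p < e q) l"
  shows "foldl (add_link \<alpha>) {} l = links \<alpha> e (set l)"
  using assms
proof (induction l rule: rev_induct)
  case Nil
  show ?case by (simp add: links_eqI created_by_def)
next
  case (snoc x l)
  let ?C = "links \<alpha> e (set l)"
  have lt: "e p < e x" if "p \<in> set l" for p using snoc.prems that by (simp add: sorted_wrt_append)
  have C: "created_by \<alpha> e (set l) ?C" by (rule created_by_links) simp
  then have eq: "{q \<in> ?C. e q < e x} = ?C" using lt by (auto simp: created_by_def)
  have "created_by \<alpha> e (insert x (set l)) (add_link \<alpha> ?C x)"
    using created_by_insert[OF C, of x] lt less_imp_le
    unfolding eq add_link_def in_sol_def by blast
  then have "links \<alpha> e (insert x (set l)) = add_link \<alpha> ?C x" by (intro links_eqI) auto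
  then show ?case using snoc by (simp add: sorted_wrt_append)
qed

lemma set_pairs_list [simp]: "set (pairs_list N) = pairs N"
  by (auto simp: pairs_list_def pairs_def)

lemma distinct_pairs_list: "distinct (pairs_list N)"
  unfolding pairs_list_def
  by (induction N) (auto simp: distinct_map inj_on_def)

lemma created_eq_links:
  assumes "inj_on e (pairs N)"
  shows "created N \<alpha> e t = links \<alpha> e {p \<in> pairs N. e p \<le> t}"
proof -
  let ?l = "sort_key e (pairs_list N)"
  have d: "distinct ?l" using distinct_pairs_list by simp
  have "sorted_wrt (\<lambda>p q. e p < e q) ?l"
  proof -
    have "distinct (map e ?l)" using d assms by (simp add: distinct_map)
    then have "sorted_wrt (<) (map e ?l)" by (simp add: strict_sorted_iff)
    then show ?thesis by (simp add: sorted_wrt_map)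
  qed
  then have "sorted_wrt (\<lambda>p q. e p < e q) (filter (\<lambda>p. e p \<le> t) ?l)" by (rule sorted_wrt_filter)
  then show ?thesis unfolding created_def by (subst foldl_add_link) (auto intro!: arg_cong[where f = "links \<alpha> e"])
qed

subsection \<open>Sets of particles isolated from the rest\<close>

definition prs :: "nat set \<Rightarrow> (nat \<times> nat) set" where
  "prs V = {(i, j). i \<in> V \<and> j \<in> V \<and> i < j}"

text \<open>For \<open>H \<subseteq> prs A\<close>, the equation \<open>touching A E = H\<close>
  expresses at once that \<open>A\<close> carries exactly the links \<open>H\<close> and that no
  link leaves \<open>A\<close>. This is the event whose probability is computed below.\<close>

definition touching :: "nat set \<Rightarrow> (nat \<times> nat) set \<Rightarrow> (nat \<times> nat) set" where
  "touching A E = {p \<in> E. fst p \<in> A \<or> snd p \<in> A}"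

text \<open>The links present just before time \<open>t\<close>: the inequality is strict, so that the clock of a
  pair is compared with the configuration in which it rings.\<close>
definition lk :: "real \<Rightarrow> (nat \<times> nat) set \<Rightarrow> (nat \<times> nat \<Rightarrow> real) \<Rightarrow> real \<Rightarrow> (nat \<times> nat) set" where
  "lk \<alpha> P e t = links \<alpha> e {p \<in> P. e p < t}"

text \<open>Meant for pairs with exactly one end in \<open>A\<close>.\<close>

definition outer :: "nat set \<Rightarrow> nat \<times> nat \<Rightarrow> nat" where
  "outer A p = (if fst p \<in> A then snd p else fst p)"

lemma prs_subset: "prs V \<subseteq> V \<times> V" by (auto simp: prs_def)

lemma finite_prs [simp]: "finite V \<Longrightarrow> finite (prs V)"
  by (rule finite_subset[OF prs_subset]) simp

lemma pairs_eq_prs: "pairs N = prs {..<N}" by (auto simp: pairs_def prs_def)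

lemma prs_mono: "A \<subseteq> V \<Longrightarrow> prs A \<subseteq> prs V" by (auto simp: prs_def)

lemma lk_subset: "finite P \<Longrightarrow> lk \<alpha> P e t \<subseteq> {p \<in> P. e p < t}"
  unfolding lk_def by (rule links_subset) simp

lemma finite_lk [simp]: "finite P \<Longrightarrow> finite (lk \<alpha> P e t)" by (simp add: lk_def)

lemma lk_before: "finite P \<Longrightarrow> s \<le> t \<Longrightarrow> lk \<alpha> P e s = {p \<in> lk \<alpha> P e t. e p < s}"
  unfolding lk_def by (rule links_before)

lemma lk_iff:
  "finite P \<Longrightarrow> p \<in> P \<Longrightarrow> e p < t \<Longrightarrow>
   p \<in> lk \<alpha> P e t \<longleftrightarrow> in_sol \<alpha> (lk \<alpha> P e (e p)) (fst p) \<and> in_sol \<alpha> (lk \<alpha> P e (e p)) (snd p)"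
  unfolding lk_def by (rule links_iff)

lemma in_sol_lk_antimono: "finite P \<Longrightarrow> s \<le> t \<Longrightarrow> in_sol \<alpha> (lk \<alpha> P e t) v \<Longrightarrow> in_sol \<alpha> (lk \<alpha> P e s) v"
  by (rule in_sol_antimono[of \<alpha> "lk \<alpha> P e t"]) (auto simp: lk_before[of P s t])

text \<open>Graphs on disjoint vertex sets do not see each other's clusters. The bound on
  \<open>card A\<close> settles the ends in \<open>A\<close>: whatever links are present there, no
  cluster reaches the threshold.\<close>

lemma in_sol_union:
  assumes "finite V" "A \<subseteq> V" "real (card A) < \<alpha>" "H \<subseteq> prs A" "E \<subseteq> prs (V - A)"
  shows "x \<in> A \<Longrightarrow> in_sol \<alpha> (E \<union> H) x"
    and "x \<in> V - A \<Longrightarrow> in_sol \<alpha> (E \<union> H) x \<longleftrightarrow> in_sol \<alpha> E x"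
proof -
  assume x: "x \<in> A"
  have "cluster (E \<union> H) x \<subseteq> A"
    by (rule cluster_closed) (use assms x in \<open>auto simp: link_adj_def prs_def\<close>)
  then have "card (cluster (E \<union> H) x) \<le> card A"
    using assms finite_subset by (intro card_mono) auto
  then show "in_sol \<alpha> (E \<union> H) x" using assms by (simp add: in_sol_def)
next
  assume x: "x \<in> V - A"
  have c: "cluster (E \<union> H) x \<subseteq> V - A"
    by (rule cluster_closed) (use assms x in \<open>auto simp: link_adj_def prs_def\<close>)
  have "cluster E x = cluster (E \<union> H) x"
    by (rule cluster_restrict) (use assms c in \<open>auto simp: prs_def\<close>)
  then show "in_sol \<alpha> (E \<union> H) x \<longleftrightarrow> in_sol \<alpha> E x" by (simp add: in_sol_def)
qed

text \<open>An isolated set never changes the size of a cluster outside it, so the trace of the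
  configuration on \<open>V - A\<close> obeys the rule of the dynamics without \<open>A\<close>, and
  by uniqueness it is that dynamics.\<close>

lemma isolated_lk:
  assumes "finite V" "A \<subseteq> V" "real (card A) < \<alpha>" "H \<subseteq> prs A"
    and "touching A (lk \<alpha> (prs V) e t) = H"
  shows "lk \<alpha> (prs V) e t = lk \<alpha> (prs (V - A)) e t \<union> H"
proof -
  let ?B = "V - A" and ?E = "lk \<alpha> (prs V) e t"
  let ?F = "?E \<inter> prs ?B"
  have EV: "?E \<subseteq> {p \<in> prs V. e p < t}" using assms(1) by (intro lk_subset) simp
  have EF: "?E = ?F \<union> H" using assms(4,5) EV by (fastforce simp: touching_def prs_def)
  have cr: "created_by \<alpha> e {p\<in>prs V. e p < t} ?E"
    unfolding lk_def by (rule created_by_links) (use assms in simp)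
  have "links \<alpha> e {p \<in> prs ?B. e p < t} = ?F"
  proof (rule links_eqI)
    show "created_by \<alpha> e {p \<in> prs ?B. e p < t} ?F"
      unfolding created_by_def
    proof (intro conjI ballI)
      fix p assume p: "p \<in> {p \<in> prs ?B. e p < t}"
      let ?G = "{q \<in> ?F. e q < e p}" and ?K = "{q \<in> H. e q < e p}"
      have "{q \<in> ?E. e q < e p} = ?G \<union> ?K" using EF by blast
      moreover have "in_sol \<alpha> (?G \<union> ?K) x \<longleftrightarrow> in_sol \<alpha> ?G x" if "x \<in> ?B" for x
        by (rule in_sol_union(2)[OF assms(1-3) _ _ that]) (use assms in auto)
      moreover have "p \<in> prs V" "fst p \<in> ?B" "snd p \<in> ?B" using p by (auto simp: prs_def)
      ultimately show "p \<in> ?F \<longleftrightarrow> in_sol \<alpha> ?G (fst p) \<and> in_sol \<alpha> ?G (snd p)"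
        using created_by_iff[OF cr, of p] p by simp
    qed (use EV in auto)
  qed (use assms in simp)
  then show ?thesis using EF by (simp add: lk_def)
qed

text \<open>The combinatorial core. Clusters inside \<open>A\<close> stay below the threshold, so a
  clock inside \<open>A\<close> creates its link whenever it rings. A crossing clock finds its end
  in \<open>A\<close> in solution, hence its link is refused only if the outer end has already
  gelled; and as long as \<open>A\<close> is isolated, the outside evolves as if \<open>A\<close>
  were absent. Once the clocks outside are fixed, the right-hand side constrains every other clock
  separately.\<close>

lemma touching_lk_iff:
  assumes "finite V" "A \<subseteq> V" "real (card A) < \<alpha>" "H \<subseteq> prs A"
  shows "touching A (lk \<alpha> (prs V) e t) = H \<longleftrightarrow>
    {p \<in> prs A. e p < t} = H \<and>
    (\<forall>p\<in>prs V - prs A - prs (V - A). e p < t \<longrightarrow> \<not> in_sol \<alpha> (lk \<alpha> (prs (V - A)) e (e p)) (outer A p))"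
    (is "?L \<longleftrightarrow> ?R")
proof -
  let ?B = "V - A" and ?E = "lk \<alpha> (prs V) e t" and ?EB = "lk \<alpha> (prs (V - A)) e t"
  have finB: "finite (prs ?B)" using assms by simp
  have EB: "?EB \<subseteq> {p \<in> prs ?B. e p < t}" using assms(1) by (intro lk_subset) simp
  have split: "{q \<in> ?EB \<union> H. e q < s} = lk \<alpha> (prs ?B) e s \<union> {q \<in> H. e q < s}" if "s \<le> t" for s
    using lk_before[OF finB that, of \<alpha> e] by auto
  have solA: "in_sol \<alpha> {q \<in> ?EB \<union> H. e q < s} x" if "s \<le> t" "x \<in> A" for s x
    unfolding split[OF that(1)]
    by (rule in_sol_union(1)[OF assms(1-3) _ _ that(2)]) (use assms lk_subset[OF finB, of \<alpha> e s] in auto)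
  have solB: "in_sol \<alpha> {q \<in> ?EB \<union> H. e q < s} x \<longleftrightarrow> in_sol \<alpha> (lk \<alpha> (prs ?B) e s) x"
    if "s \<le> t" "x \<in> ?B" for s x
    unfolding split[OF that(1)]
    by (rule in_sol_union(2)[OF assms(1-3) _ _ that(2)]) (use assms lk_subset[OF finB, of \<alpha> e s] in auto)
  have ends: "(fst p \<in> A \<and> snd p = outer A p \<and> outer A p \<in> ?B) \<or> (snd p \<in> A \<and> fst p = outer A p \<and> outer A p \<in> ?B)"
    if "p \<in> prs V - prs A - prs ?B" for p using that by (auto simp: prs_def outer_def)
  have disj: "prs A \<inter> prs ?B = {}" by (auto simp: prs_def)
  show ?thesis
  proof
    assume L: ?L
    have E: "?E = ?EB \<union> H" by (rule isolated_lk[OF assms L])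
    have iff: "p \<in> ?EB \<union> H \<longleftrightarrow> in_sol \<alpha> {q \<in> ?EB \<union> H. e q < e p} (fst p) \<and> in_sol \<alpha> {q \<in> ?EB \<union> H. e q < e p} (snd p)"
      if "p \<in> prs V" "e p < t" for p
      using created_by_iff[OF created_by_links[of "{p\<in>prs V. e p < t}" \<alpha> e], of p] assms(1) that
      unfolding E[symmetric] by (simp add: lk_def)
    show ?R
    proof (intro conjI ballI impI)
      show "{p \<in> prs A. e p < t} = H"
      proof
        show "H \<subseteq> {p \<in> prs A. e p < t}"
          using E lk_subset[of "prs V" \<alpha> e t] assms by auto
        show "{p \<in> prs A. e p < t} \<subseteq> H"
        proof
          fix p assume p: "p \<in> {p \<in> prs A. e p < t}"
          then have "p \<in> prs V" "fst p \<in> A" "snd p \<in> A" using assms by (auto simp: prs_def)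
          then have "p \<in> ?EB \<union> H" using iff[of p] solA[of "e p"] p by auto
          then show "p \<in> H" using p EB disj by auto
        qed
      qed
      fix p assume p: "p \<in> prs V - prs A - prs ?B" "e p < t"
      have "p \<notin> ?EB \<union> H" using p EB assms by auto
      then show "\<not> in_sol \<alpha> (lk \<alpha> (prs ?B) e (e p)) (outer A p)"
        using iff[of p] p ends[OF p(1)] solA[of "e p"] solB[of "e p"] by auto
    qed
  next
    \<comment> \<open>Conversely, the outside configuration together with \<open>H\<close> is
      checked against the rule for the three kinds of pairs: inside \<open>A\<close>, outside
      \<open>A\<close>, crossing.\<close>
    assume R: ?R
    have "links \<alpha> e {p \<in> prs V. e p < t} = ?EB \<union> H"
    proof (rule links_eqI)
      show "created_by \<alpha> e {p \<in> prs V. e p < t} (?EB \<union> H)"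
        unfolding created_by_def
      proof (intro conjI ballI)
        show "?EB \<union> H \<subseteq> {p \<in> prs V. e p < t}" using EB R assms by (auto simp: prs_def)
        fix p assume p: "p \<in> {p \<in> prs V. e p < t}"
        let ?S = "\<lambda>x. in_sol \<alpha> {q \<in> ?EB \<union> H. e q < e p} x"
        consider "p \<in> prs A" | "p \<in> prs ?B" | "p \<in> prs V - prs A - prs ?B" using p by blast
        then show "p \<in> ?EB \<union> H \<longleftrightarrow> ?S (fst p) \<and> ?S (snd p)"
        proof cases
          case 1
          then have "fst p \<in> A" "snd p \<in> A" by (auto simp: prs_def)
          then show ?thesis using 1 p R solA[of "e p"] by auto
        next
          case 2
          then have "fst p \<in> ?B" "snd p \<in> ?B" by (auto simp: prs_def)
          moreover have "p \<notin> H" using 2 assms disj by auto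
          ultimately show ?thesis using 2 p solB[of "e p"] lk_iff[OF finB 2, of e t \<alpha>] by auto
        next
          case 3
          then have "\<not> ?S (outer A p)" using R p solB[of "e p"] ends[OF 3] by auto
          moreover have "p \<notin> ?EB \<union> H" using 3 EB assms by auto
          ultimately show ?thesis using ends[OF 3] by auto
        qed
      qed
    qed (use assms in simp)
    then have "?E = ?EB \<union> H" by (simp add: lk_def)
    then show ?L using EB assms by (fastforce simp: touching_def prs_def)
  qed
qed

lemma isolated_in_sol:
  assumes "finite V" "A \<subseteq> V" "real (card A) < \<alpha>" "H \<subseteq> prs A"
    and "touching A (lk \<alpha> (prs V) e t) = H" "s \<le> t"
  shows "x \<in> A \<Longrightarrow> in_sol \<alpha> (lk \<alpha> (prs V) e s) x"
    and "x \<in> V - A \<Longrightarrow> in_sol \<alpha> (lk \<alpha> (prs V) e s) x \<longleftrightarrow> in_sol \<alpha> (lk \<alpha> (prs (V - A)) e s) x"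
proof -
  have *: "lk \<alpha> (prs V) e s = lk \<alpha> (prs (V - A)) e s \<union> {p \<in> H. e p < s}"
    using isolated_lk[OF assms(1-5)] lk_before[of "prs V" s t \<alpha> e] lk_before[of "prs (V - A)" s t \<alpha> e] assms(1,6)
    by auto
  show "x \<in> A \<Longrightarrow> in_sol \<alpha> (lk \<alpha> (prs V) e s) x" unfolding *
    by (rule in_sol_union(1)[OF assms(1-3)]) (use assms lk_subset[of "prs (V - A)" \<alpha> e s] in auto)
  show "x \<in> V - A \<Longrightarrow> in_sol \<alpha> (lk \<alpha> (prs V) e s) x \<longleftrightarrow> in_sol \<alpha> (lk \<alpha> (prs (V - A)) e s) x" unfolding *
    by (rule in_sol_union(2)[OF assms(1-3)]) (use assms lk_subset[of "prs (V - A)" \<alpha> e s] in auto)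
qed

lemma lk_image:
  assumes "inj_on f V" "P \<subseteq> V \<times> V" "finite P"
  shows "lk \<alpha> (map_prod f f ` P) e t = map_prod f f ` lk \<alpha> P (e \<circ> map_prod f f) t"
proof -
  have "{p \<in> map_prod f f ` P. e p < t} = map_prod f f ` {p \<in> P. (e \<circ> map_prod f f) p < t}" by auto
  moreover have "{p \<in> P. (e \<circ> map_prod f f) p < t} \<subseteq> V \<times> V" using assms by blast
  ultimately show ?thesis unfolding lk_def
    using links_image[OF assms(1), of "{p \<in> P. (e \<circ> map_prod f f) p < t}"] assms(3) by simp
qed

lemma in_sol_image:
  assumes "inj_on f V" "E \<subseteq> V \<times> V" "x \<in> V"
  shows "in_sol \<alpha> (map_prod f f ` E) (f x) \<longleftrightarrow> in_sol \<alpha> E x"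
  unfolding in_sol_def using cluster_image[OF assms] cluster_subset[OF assms(2,3)] card_image[OF inj_on_subset[OF assms(1)]]
  by simp

subsection \<open>Independent exponential clocks\<close>

abbreviation expo :: "real \<Rightarrow> real measure" where
  "expo \<rho> \<equiv> density lborel (exponential_density \<rho>)"

definition clocks :: "real \<Rightarrow> (nat \<times> nat) set \<Rightarrow> (nat \<times> nat \<Rightarrow> real) measure" where
  "clocks \<rho> P = (\<Pi>\<^sub>M p\<in>P. expo \<rho>)"

lemma clock_space_eq: "clock_space N = clocks (1 / real N) (prs {..<N})"
  by (simp add: clock_space_def clocks_def pairs_eq_prs)

lemma prob_space_clocks: "0 < \<rho> \<Longrightarrow> prob_space (clocks \<rho> P)"
  unfolding clocks_def by (intro prob_space_PiM prob_space_exponential_density)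

lemma expo_AE:
  assumes "0 < \<rho>"
  shows "AE z in expo \<rho>. 0 \<le> z" and "AE z in expo \<rho>. z \<noteq> c"
proof -
  show "AE z in expo \<rho>. 0 \<le> z"
    by (subst AE_density) (auto simp: exponential_density_def)
  have "AE z in lborel. z \<noteq> c" by (rule AE_lborel_singleton)
  then show "AE z in expo \<rho>. z \<noteq> c"
    by (subst AE_density) auto
qed

lemma measure_expo_le:
  assumes "0 < \<rho>" "0 \<le> a"
  shows "measure (expo \<rho>) {z. z \<le> a} = 1 - exp (- \<rho> * a)"
proof -
  interpret prob_space "expo \<rho>" using assms prob_space_exponential_density by blast
  have "distributed (expo \<rho>) lborel (\<lambda>x. x) (exponential_density \<rho>)"
    unfolding distributed_def by (auto simp: distr_id2 sets_eq_imp_space_eq)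
  from exponential_distributedD_le[OF this assms(2,1)] show ?thesis by (simp add: mult.commute)
qed

text \<open>A downward closed set of times is an initial interval up to its end point, so its length
  alone determines its exponential probability.\<close>

lemma measure_expo_downset:
  assumes "0 < \<rho>" "0 \<le> t" and b [measurable]: "Measurable.pred borel b"
    and down: "\<And>y z. b z \<Longrightarrow> y \<le> z \<Longrightarrow> b y"
  shows "measure (expo \<rho>) {z. z < t \<and> b z} = 1 - exp (- \<rho> * measure lborel {z\<in>{0..<t}. b z})"
proof -
  \<comment> \<open>The end of the interval of admissible times; the supremum of an empty set
    carries no information, hence the default 0.\<close>
  define L where "L = (if \<exists>z\<in>{0..<t}. b z then Sup {z\<in>{0..<t}. b z} else 0)"
  have bdd: "bdd_above {z\<in>{0..<t}. b z}" by (rule bdd_aboveI[of _ t]) auto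
  have L0: "0 \<le> L"
  proof (cases "\<exists>z\<in>{0..<t}. b z")
    case True
    then obtain z where "z \<in> {0..<t}" "b z" by blast
    moreover from this have "z \<le> Sup {z\<in>{0..<t}. b z}" by (intro cSup_upper[OF _ bdd]) simp
    ultimately show ?thesis using True by (simp add: L_def)
  qed (simp add: L_def)
  have iff: "z < t \<and> b z \<longleftrightarrow> z \<le> L" if "0 \<le> z" "z \<noteq> L" for z
  proof
    assume z: "z < t \<and> b z"
    then have "z \<le> Sup {z\<in>{0..<t}. b z}" using that by (intro cSup_upper bdd) auto
    then show "z \<le> L" using z that by (auto simp: L_def)
  next
    assume "z \<le> L"
    then have zL: "z < L" using that by simp
    then have ex: "\<exists>z\<in>{0..<t}. b z" using that by (auto simp: L_def split: if_splits)
    then have "z < Sup {z\<in>{0..<t}. b z}" using zL by (simp add: L_def)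
    then obtain w where "w \<in> {z\<in>{0..<t}. b z}" "z < w"
      using ex by (subst (asm) less_cSup_iff) (use bdd in auto)
    then show "z < t \<and> b z" using down[of w z] by auto
  qed
  interpret prob_space "expo \<rho>" using assms prob_space_exponential_density by blast
  have "measure lborel {z\<in>{0..<t}. b z} = measure lborel {0..L}"
  proof (rule measure_eq_AE)
    show "AE z in lborel. z \<in> {z\<in>{0..<t}. b z} \<longleftrightarrow> z \<in> {0..L}"
      using AE_lborel_singleton[of L] iff by (auto elim!: eventually_mono)
  qed auto
  moreover have "measure (expo \<rho>) {z. z < t \<and> b z} = measure (expo \<rho>) {z. z \<le> L}"
  proof (rule measure_eq_AE)
    show "AE z in expo \<rho>. z \<in> {z. z < t \<and> b z} \<longleftrightarrow> z \<in> {z. z \<le> L}"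
    proof -
      have "AE z in expo \<rho>. 0 \<le> z \<and> z \<noteq> L" using expo_AE[OF assms(1)] by simp
      then show ?thesis by (rule eventually_mono) (use iff in auto)
    qed
  qed auto
  ultimately show ?thesis using measure_expo_le[OF assms(1) L0] L0 by simp
qed

section \<open>Measurability of the configuration\<close>

lemma measurable_subset_pred:
  assumes "finite P" "\<And>p. p \<in> P \<Longrightarrow> Measurable.pred M (\<lambda>x. B p x)"
  shows "(\<lambda>x. {p\<in>P. B p x}) \<in> measurable M (count_space (Pow P))"
proof (subst measurable_count_space_eq2)
  show "finite (Pow P)" using assms by simp
  have "(\<lambda>x. {p\<in>P. B p x}) -` {S} \<inter> space M \<in> sets M" if "S \<in> Pow P" for S
  proof -
    have "(\<lambda>x. {p\<in>P. B p x}) -` {S} \<inter> space M = {x\<in>space M. \<forall>p\<in>P. B p x \<longleftrightarrow> p \<in> S}"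
      using that by blast
    also have "\<dots> \<in> sets M"
    proof (rule sets.sets_Collect_finite_All)
      fix p assume "p \<in> P"
      then have [measurable]: "Measurable.pred M (\<lambda>x. B p x)" by (rule assms(2))
      show "{x\<in>space M. B p x \<longleftrightarrow> p \<in> S} \<in> sets M" by measurable
    qed (rule assms(1))
    finally show ?thesis .
  qed
  then show "(\<lambda>x. {p\<in>P. B p x}) \<in> space M \<rightarrow> Pow P \<and>
    (\<forall>S\<in>Pow P. (\<lambda>x. {p\<in>P. B p x}) -` {S} \<inter> space M \<in> sets M)" by auto
qed

text \<open>The configuration is a function of two finite data, the order of the clocks and the set
  of clocks below \<open>s\<close>. The time \<open>s\<close> may be random, which covers the
  configuration that a pair meets when its own clock rings.\<close>

lemma measurable_lk:
  assumes "finite P" and c: "\<And>p. p \<in> P \<Longrightarrow> (\<lambda>x. c x p) \<in> borel_measurable M"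
    and s [measurable]: "s \<in> borel_measurable M"
  shows "(\<lambda>x. lk \<alpha> P (c x) (s x)) \<in> measurable M (count_space UNIV)"
proof -
  let ?g = "\<lambda>x. {pq\<in>P \<times> P. c x (fst pq) < c x (snd pq)}" and ?h = "\<lambda>x. {p\<in>P. c x p < s x}"
  define ord where "ord e = {pq\<in>P \<times> P. e (fst pq) < e (snd pq)}" for e :: "nat \<times> nat \<Rightarrow> real"
  \<comment> \<open>\<open>SOME\<close> selects one assignment of clocks for each order relation; by
    \<open>links_cong\<close> the choice is immaterial.\<close>
  define F where "F R Q = links \<alpha> (SOME e. ord e = R) Q" for R Q
  have eq: "lk \<alpha> P (c x) (s x) = F (?g x) (?h x)" for x
  proof -
    let ?e = "SOME e. ord e = ord (c x)"
    have "ord ?e = ord (c x)" by (rule someI[of "\<lambda>e. ord e = ord (c x)"]) simp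
    moreover have "(p, q) \<in> ord e \<longleftrightarrow> e p < e q" if "p \<in> P" "q \<in> P" for p q e
      using that by (simp add: ord_def)
    ultimately have "c x p < c x q \<longleftrightarrow> ?e p < ?e q" if "p \<in> P" "q \<in> P" for p q
      using that by metis
    then show ?thesis unfolding F_def lk_def ord_def[of "c x", symmetric] by (intro links_cong) auto
  qed
  have g: "?g \<in> measurable M (count_space (Pow (P \<times> P)))"
  proof (rule measurable_subset_pred)
    fix pq assume "pq \<in> P \<times> P"
    then have [measurable]: "(\<lambda>x. c x (fst pq)) \<in> borel_measurable M" "(\<lambda>x. c x (snd pq)) \<in> borel_measurable M"
      using c by auto
    show "Measurable.pred M (\<lambda>x. c x (fst pq) < c x (snd pq))" by measurable
  qed (use assms in auto)
  have h: "?h \<in> measurable M (count_space (Pow P))"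
  proof (rule measurable_subset_pred)
    fix p assume "p \<in> P"
    then have [measurable]: "(\<lambda>x. c x p) \<in> borel_measurable M" using c by auto
    show "Measurable.pred M (\<lambda>x. c x p < s x)" by measurable
  qed (use assms in auto)
  have "(\<lambda>x. F (?g x) (?h x)) \<in> measurable M (count_space UNIV)"
  proof (rule measurable_compose_countable'[OF _ g])
    fix R assume "R \<in> Pow (P \<times> P)"
    show "(\<lambda>x. F R (?h x)) \<in> measurable M (count_space UNIV)"
      by (rule measurable_compose[OF h]) simp
  qed (use assms in \<open>auto intro: countable_finite\<close>)
  then show ?thesis unfolding eq .
qed

lemma measurable_clock [measurable]: "p \<in> P \<Longrightarrow> (\<lambda>e. e p) \<in> borel_measurable (clocks \<rho> P)"
  unfolding clocks_def
  using measurable_component_singleton[of p P "\<lambda>_. expo \<rho>"] by simp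

lemma measurable_lk_clocks:
  assumes "finite P" "Q \<subseteq> P"
  shows "(\<lambda>e. lk \<alpha> Q e t) \<in> measurable (clocks \<rho> P) (count_space UNIV)"
  by (rule measurable_lk) (use assms finite_subset in auto)

lemma lk_cong:
  assumes "\<And>p. p \<in> P \<Longrightarrow> e p = e' p" shows "lk \<alpha> P e t = lk \<alpha> P e' t"
proof -
  have "{p \<in> P. e p < t} = {p \<in> P. e' p < t}" using assms by auto
  moreover have "links \<alpha> e {p \<in> P. e' p < t} = links \<alpha> e' {p \<in> P. e' p < t}"
    by (rule links_cong) (use assms in auto)
  ultimately show ?thesis unfolding lk_def by simp
qed

subsection \<open>The time spent in solution\<close>

definition life :: "real \<Rightarrow> (nat \<times> nat) set \<Rightarrow> real \<Rightarrow> (nat \<times> nat \<Rightarrow> real) \<Rightarrow> nat \<Rightarrow> real" where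
  "life \<alpha> P t e v = measure lborel {s\<in>{0..<t}. in_sol \<alpha> (lk \<alpha> P e s) v}"

text \<open>Time in the gel is recorded rather than time in solution, because particles of an
  isolated set contribute nothing to it: the value is the same with and without them. For
  \<open>N\<close> particles and \<open>\<rho> = 1/N\<close> it equals
  \<open>t - X(t)\<close>.\<close>

definition gelled :: "real \<Rightarrow> real \<Rightarrow> nat set \<Rightarrow> real \<Rightarrow> (nat \<times> nat \<Rightarrow> real) \<Rightarrow> real" where
  "gelled \<rho> \<alpha> V t e = \<rho> * (\<Sum>v\<in>V. t - life \<alpha> (prs V) t e v)"

lemma pred_in_sol_time [measurable]:
  "finite P \<Longrightarrow> Measurable.pred borel (\<lambda>s. in_sol \<alpha> (lk \<alpha> P e s) v)"
  by (rule measurable_compose[OF measurable_lk]) auto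

lemma life_nonneg: "0 \<le> life \<alpha> P t e v" by (simp add: life_def)

lemma life_le:
  assumes "finite P" "0 \<le> t" shows "life \<alpha> P t e v \<le> t"
proof -
  have "life \<alpha> P t e v \<le> measure lborel {0..<t}"
    unfolding life_def using assms by (intro measure_mono_fmeasurable) (auto simp: fmeasurable_def)
  then show ?thesis using assms by simp
qed

lemma life_integral:
  "finite P \<Longrightarrow> life \<alpha> P t e v = (\<integral>s. indicat_real {0..<t} s * of_bool (in_sol \<alpha> (lk \<alpha> P e s) v) \<partial>lborel)"
proof -
  assume "finite P"
  have "(\<integral>s. indicat_real {0..<t} s * of_bool (in_sol \<alpha> (lk \<alpha> P e s) v) \<partial>lborel)
     = (\<integral>s. indicat_real {s\<in>{0..<t}. in_sol \<alpha> (lk \<alpha> P e s) v} s \<partial>lborel)"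
    by (rule Bochner_Integration.integral_cong) (auto simp: indicator_def of_bool_def)
  then show ?thesis by (simp add: life_def)
qed

lemma measurable_life [measurable]:
  assumes "finite P" "Q \<subseteq> P"
  shows "(\<lambda>e. life \<alpha> Q t e v) \<in> borel_measurable (clocks \<rho> P)"
proof -
  have fin: "finite Q" using assms finite_subset by blast
  have [measurable]: "(\<lambda>x. lk \<alpha> Q (fst x) (snd x)) \<in> measurable (clocks \<rho> P \<Otimes>\<^sub>M lborel) (count_space UNIV)"
    by (rule measurable_lk[OF fin]) (use assms in auto)
  have [measurable]: "Measurable.pred (clocks \<rho> P \<Otimes>\<^sub>M lborel) (\<lambda>x. in_sol \<alpha> (lk \<alpha> Q (fst x) (snd x)) v)"
    by (rule measurable_compose[of "\<lambda>x. lk \<alpha> Q (fst x) (snd x)" _ "count_space UNIV"]) measurable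
  show ?thesis unfolding life_integral[OF fin]
    by (rule lborel.borel_measurable_lebesgue_integral) (simp add: split_beta)
qed

lemma measurable_gelled [measurable]:
  "finite V \<Longrightarrow> B \<subseteq> V \<Longrightarrow> gelled \<rho>' \<alpha> B t \<in> borel_measurable (clocks \<rho> (prs V))"
  unfolding gelled_def[abs_def]
  by (intro borel_measurable_times borel_measurable_const borel_measurable_sum borel_measurable_diff
      measurable_life finite_prs prs_mono)

lemma gelled_bounds:
  assumes "finite V" "0 \<le> \<rho>" "0 \<le> t"
  shows "0 \<le> gelled \<rho> \<alpha> V t e" "gelled \<rho> \<alpha> V t e \<le> \<rho> * real (card V) * t"
proof -
  show "0 \<le> gelled \<rho> \<alpha> V t e"
    unfolding gelled_def using assms life_le[of "prs V"] by (intro mult_nonneg_nonneg sum_nonneg) auto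
  have "(\<Sum>v\<in>V. t - life \<alpha> (prs V) t e v) \<le> (\<Sum>v\<in>V. t)"
    by (rule sum_mono) (simp add: life_nonneg)
  then show "gelled \<rho> \<alpha> V t e \<le> \<rho> * real (card V) * t"
    unfolding gelled_def using assms by (simp add: mult_left_mono mult.assoc)
qed

lemma life_cong:
  "(\<And>p. p \<in> P \<Longrightarrow> e p = e' p) \<Longrightarrow> life \<alpha> P t e v = life \<alpha> P t e' v"
  unfolding life_def using lk_cong[of P e e' \<alpha>] by simp

lemma gelled_cong:
  "(\<And>p. p \<in> prs V \<Longrightarrow> e p = e' p) \<Longrightarrow> gelled \<rho> \<alpha> V t e = gelled \<rho> \<alpha> V t e'"
  unfolding gelled_def using life_cong[of "prs V" e e' \<alpha> t] by simp

lemma gelled_isolated: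
  assumes "finite V" "A \<subseteq> V" "real (card A) < \<alpha>" "H \<subseteq> prs A" "0 \<le> t"
    and "touching A (lk \<alpha> (prs V) e t) = H"
  shows "gelled \<rho> \<alpha> V t e = gelled \<rho> \<alpha> (V - A) t e"
proof -
  have "{s\<in>{0..<t}. in_sol \<alpha> (lk \<alpha> (prs V) e s) v} = {0..<t}" if "v \<in> A" for v
    using isolated_in_sol(1)[OF assms(1-4,6) _ that] by auto
  then have 1: "life \<alpha> (prs V) t e v = t" if "v \<in> A" for v using that assms by (simp add: life_def)
  have "{s\<in>{0..<t}. in_sol \<alpha> (lk \<alpha> (prs V) e s) v} = {s\<in>{0..<t}. in_sol \<alpha> (lk \<alpha> (prs (V - A)) e s) v}"
    if "v \<in> V - A" for v
    using isolated_in_sol(2)[OF assms(1-4,6) _ that] by auto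
  then have 2: "life \<alpha> (prs V) t e v = life \<alpha> (prs (V - A)) t e v" if "v \<in> V - A" for v
    using that by (simp add: life_def)
  have "(\<Sum>v\<in>V. t - life \<alpha> (prs V) t e v) = (\<Sum>v\<in>V - A. t - life \<alpha> (prs (V - A)) t e v)"
    using assms(1,2) 1 2 by (intro sum.mono_neutral_cong_right) auto
  then show ?thesis by (simp add: gelled_def)
qed

lemma sum_cross_pairs:
  fixes h :: "nat \<Rightarrow> real"
  assumes "finite V" "A \<subseteq> V"
  shows "(\<Sum>p\<in>prs V - prs A - prs (V - A). h (outer A p)) = real (card A) * (\<Sum>v\<in>V - A. h v)"
proof -
  have "(\<Sum>p\<in>prs V - prs A - prs (V - A). h (outer A p)) = (\<Sum>(a, v)\<in>A \<times> (V - A). h v)"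
    by (rule sum.reindex_bij_witness[where i = "\<lambda>(a, v). (min a v, max a v)"
        and j = "\<lambda>p. (if fst p \<in> A then fst p else snd p, outer A p)"])
      (use assms in \<open>auto simp: prs_def outer_def min_def max_def nat_less_le split: if_splits\<close>)
  also have "\<dots> = real (card A) * (\<Sum>v\<in>V - A. h v)"
    by (simp add: sum.cartesian_product[symmetric])
  finally show ?thesis .
qed

lemma prod_of_bool: "finite J \<Longrightarrow> (\<Prod>p\<in>J. of_bool (Q p)) = (of_bool (\<forall>p\<in>J. Q p) :: real)"
  by (induction rule: finite_induct) auto

lemma (in prob_space) integral_of_bool:
  "Measurable.pred M Q \<Longrightarrow> (\<integral>x. of_bool (Q x) \<partial>M) = prob {x\<in>space M. Q x}"
proof -
  assume [measurable]: "Measurable.pred M Q"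
  have "(\<integral>x. of_bool (Q x) \<partial>M) = (\<integral>x. indicat_real {x\<in>space M. Q x} x \<partial>M)"
    by (intro Bochner_Integration.integral_cong) (auto simp: indicator_def)
  then show ?thesis by simp
qed

text \<open>The three factors contributed by single clocks: a link inside the isolated set, a
  missing link inside it, and a crossing clock. For the last one the forbidden times form an initial
  interval of length \<open>life\<close>, since a particle that has left the solution never
  returns.\<close>

lemma expo_integrals:
  assumes "0 < \<rho>" "0 \<le> t"
  shows "(\<integral>z. of_bool (z < t) \<partial>expo \<rho>) = 1 - exp (- \<rho> * t)"
    and "(\<integral>z. of_bool (\<not> z < t) \<partial>expo \<rho>) = exp (- \<rho> * t)"
    and "finite P \<Longrightarrow> (\<integral>z. of_bool (z < t \<longrightarrow> \<not> in_sol \<alpha> (lk \<alpha> P x z) v) \<partial>expo \<rho>) = exp (- \<rho> * life \<alpha> P t x v)"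
proof -
  interpret prob_space "expo \<rho>" using assms prob_space_exponential_density by blast
  have 1: "prob {z. z < t} = 1 - exp (- \<rho> * t)"
  proof -
    have "{z\<in>{0..<t}. True} = {0..<t}" by auto
    then show ?thesis using measure_expo_downset[of \<rho> t "\<lambda>_. True"] assms by simp
  qed
  then show "(\<integral>z. of_bool (z < t) \<partial>expo \<rho>) = 1 - exp (- \<rho> * t)"
    by (subst integral_of_bool) simp_all
  show "(\<integral>z. of_bool (\<not> z < t) \<partial>expo \<rho>) = exp (- \<rho> * t)"
    using 1 prob_neg[of "\<lambda>z. z < t"] by (subst integral_of_bool) simp_all
  assume P: "finite P"
  have [measurable]: "Measurable.pred borel (\<lambda>z. in_sol \<alpha> (lk \<alpha> P x z) v)" by (rule pred_in_sol_time[OF P])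
  have "prob {z. z < t \<and> in_sol \<alpha> (lk \<alpha> P x z) v} = 1 - exp (- \<rho> * life \<alpha> P t x v)"
    unfolding life_def by (rule measure_expo_downset) (use assms in_sol_lk_antimono[OF P] in auto)
  moreover have "{z. z < t \<longrightarrow> \<not> in_sol \<alpha> (lk \<alpha> P x z) v} = {z. \<not> (z < t \<and> in_sol \<alpha> (lk \<alpha> P x z) v)}" by blast
  ultimately show "(\<integral>z. of_bool (z < t \<longrightarrow> \<not> in_sol \<alpha> (lk \<alpha> P x z) v) \<partial>expo \<rho>) = exp (- \<rho> * life \<alpha> P t x v)"
    using prob_neg[of "\<lambda>z. z < t \<and> in_sol \<alpha> (lk \<alpha> P x z) v"] by (subst integral_of_bool) simp_all
qed

text \<open>With the clocks outside \<open>A\<close> fixed, isolation is a product of conditions on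
  independent single clocks, so integrating these out leaves a product. Each outer particle is
  joined to \<open>A\<close> by \<open>card A\<close> clocks; this puts \<open>card A\<close> times
  the total outer time in solution, \<open>\<rho> * card (V - A) * t - gelled\<close>, into the
  exponent. The weight \<open>\<psi>\<close> passes through because on the event the gelled times
  with and without \<open>A\<close> agree.\<close>

theorem expectation_isolated:
  fixes \<psi> :: "real \<Rightarrow> real"
  assumes V: "finite V" "A \<subseteq> V" "real (card A) < \<alpha>" "H \<subseteq> prs A"
    and pos: "0 < \<rho>" "0 \<le> t"
    and \<psi> [measurable]: "\<psi> \<in> borel_measurable borel" and bnd: "\<And>w. \<bar>\<psi> w\<bar> \<le> C"
  shows "(\<integral>e. of_bool (touching A (lk \<alpha> (prs V) e t) = H) * \<psi> (gelled \<rho> \<alpha> V t e) \<partial>clocks \<rho> (prs V)) =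
    (1 - exp (- \<rho> * t)) ^ card H * exp (- \<rho> * t) ^ (card (prs A) - card H) *
    (\<integral>e. exp (- real (card A) * (\<rho> * real (card (V - A)) * t - gelled \<rho> \<alpha> (V - A) t e)) *
       \<psi> (gelled \<rho> \<alpha> (V - A) t e) \<partial>clocks \<rho> (prs (V - A)))"
    (is "?L = ?c * ?R")
proof -
  let ?B = "V - A"
  let ?I = "prs ?B" and ?J = "prs V - prs ?B"
  let ?X = "prs V - prs A - prs ?B"
  define f where "f e = of_bool (touching A (lk \<alpha> (prs V) e t) = H) * \<psi> (gelled \<rho> \<alpha> V t e)" for e
  \<comment> \<open>One factor per clock; \<open>touching_lk_iff\<close> turns the indicator of the
    event into their product.\<close>
  define g where "g x p z = (of_bool (if p \<in> prs A then z < t \<longleftrightarrow> p \<in> H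
      else z < t \<longrightarrow> \<not> in_sol \<alpha> (lk \<alpha> ?I x z) (outer A p)) :: real)" for x p z
  interpret E: prob_space "expo \<rho>" using pos prob_space_exponential_density by blast
  interpret product_sigma_finite "\<lambda>_::nat \<times> nat. expo \<rho>" by unfold_locales
  interpret PV: prob_space "clocks \<rho> (prs V)" by (rule prob_space_clocks[OF pos(1)])
  have finV: "finite (prs V)" using V by simp
  have finI: "finite ?I" using V by simp
  have finJ: "finite ?J" using V by simp
  have AV: "finite A" "prs A \<subseteq> prs V" "prs A \<inter> ?I = {}" using V finite_subset by (auto simp: prs_def)
  have [measurable]: "(\<lambda>e. lk \<alpha> (prs V) e t) \<in> measurable (clocks \<rho> (prs V)) (count_space UNIV)"
    by (rule measurable_lk_clocks) (use V in auto)
  have [measurable]: "Measurable.pred (clocks \<rho> (prs V)) (\<lambda>e. touching A (lk \<alpha> (prs V) e t) = H)"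
    by (rule measurable_compose[of "\<lambda>e. lk \<alpha> (prs V) e t" _ "count_space UNIV"]) measurable
  have "integrable (clocks \<rho> (prs V)) f"
  proof (rule PV.integrable_const_bound[where B = C])
    show "AE e in clocks \<rho> (prs V). norm (f e) \<le> C"
      using bnd order_trans[OF abs_ge_zero bnd] by (auto simp: f_def)
    have [measurable]: "gelled \<rho> \<alpha> V t \<in> borel_measurable (clocks \<rho> (prs V))"
      by (rule measurable_gelled) (use V in auto)
    show "f \<in> borel_measurable (clocks \<rho> (prs V))" unfolding f_def[abs_def] by measurable
  qed
  moreover have UN: "?I \<union> ?J = prs V" using prs_mono[of ?B V] by blast
  ultimately have "integral\<^sup>L (clocks \<rho> (prs V)) f =
      (\<integral>x. (\<integral>y. f (merge ?I ?J (x, y)) \<partial>clocks \<rho> ?J) \<partial>clocks \<rho> ?I)"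
    using product_integral_fold[of ?I ?J f] finI finJ by (simp add: clocks_def)
  also have "\<dots> = (\<integral>x. ?c * (exp (- real (card A) * (\<rho> * real (card ?B) * t - gelled \<rho> \<alpha> ?B t x)) *
       \<psi> (gelled \<rho> \<alpha> ?B t x)) \<partial>clocks \<rho> ?I)"
  proof (rule Bochner_Integration.integral_cong[OF refl])
    fix x
    have meas: "Measurable.pred borel (\<lambda>z. in_sol \<alpha> (lk \<alpha> ?I x z) v)" for v
      by (rule pred_in_sol_time[OF finI])
    have fm: "f (merge ?I ?J (x, y)) = \<psi> (gelled \<rho> \<alpha> ?B t x) * (\<Prod>p\<in>?J. g x p (y p))" for y
    proof -
      let ?e = "merge ?I ?J (x, y)"
      have JX: "prs A \<union> ?X = ?J" using AV by blast
      have m: "?e p = y p" if "p \<in> ?J" for p using that by (simp add: merge_def)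
      have mA: "?e p = y p" if "p \<in> prs A" for p
        by (rule m) (use AV that in blast)
      have mX: "?e p = y p" if "p \<in> ?X" for p
        by (rule m) (use that in blast)
      have lkI: "lk \<alpha> ?I ?e s = lk \<alpha> ?I x s" for s by (rule lk_cong) (simp add: merge_def)
      have "touching A (lk \<alpha> (prs V) ?e t) = H \<longleftrightarrow>
         {p \<in> prs A. ?e p < t} = H \<and> (\<forall>p\<in>?X. ?e p < t \<longrightarrow> \<not> in_sol \<alpha> (lk \<alpha> ?I x (?e p)) (outer A p))"
        using touching_lk_iff[OF V, of ?e t] lkI by simp
      also have "{p \<in> prs A. ?e p < t} = H \<longleftrightarrow> (\<forall>p\<in>prs A. ?e p < t \<longleftrightarrow> p \<in> H)"
        using V by blast
      also have "(\<forall>p\<in>prs A. ?e p < t \<longleftrightarrow> p \<in> H) \<longleftrightarrow> (\<forall>p\<in>prs A. y p < t \<longleftrightarrow> p \<in> H)"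
        by (rule ball_cong) (simp_all only: mA)
      also have "(\<forall>p\<in>?X. ?e p < t \<longrightarrow> \<not> in_sol \<alpha> (lk \<alpha> ?I x (?e p)) (outer A p)) \<longleftrightarrow>
          (\<forall>p\<in>?X. y p < t \<longrightarrow> \<not> in_sol \<alpha> (lk \<alpha> ?I x (y p)) (outer A p))"
        by (rule ball_cong) (simp_all only: mX)
      also have "(\<forall>p\<in>prs A. y p < t \<longleftrightarrow> p \<in> H) \<and>
          (\<forall>p\<in>?X. y p < t \<longrightarrow> \<not> in_sol \<alpha> (lk \<alpha> ?I x (y p)) (outer A p)) \<longleftrightarrow>
          (\<forall>p\<in>prs A \<union> ?X. if p \<in> prs A then y p < t \<longleftrightarrow> p \<in> H
              else y p < t \<longrightarrow> \<not> in_sol \<alpha> (lk \<alpha> ?I x (y p)) (outer A p))"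
        by (simp add: ball_Un)
      also note JX
      finally have "of_bool (touching A (lk \<alpha> (prs V) ?e t) = H) = (\<Prod>p\<in>?J. g x p (y p))"
        unfolding g_def by (subst prod_of_bool[OF finJ]) simp
      moreover have "gelled \<rho> \<alpha> V t ?e = gelled \<rho> \<alpha> ?B t x" if "touching A (lk \<alpha> (prs V) ?e t) = H"
      proof -
        have "gelled \<rho> \<alpha> V t ?e = gelled \<rho> \<alpha> ?B t ?e" by (rule gelled_isolated[OF V pos(2) that])
        also have "\<dots> = gelled \<rho> \<alpha> ?B t x" by (rule gelled_cong) (simp add: merge_def)
        finally show ?thesis .
      qed
      ultimately show ?thesis unfolding f_def by (cases "touching A (lk \<alpha> (prs V) ?e t) = H") auto
    qed
    have int: "integrable (expo \<rho>) (g x p)" for p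
    proof (rule E.integrable_const_bound[where B = 1])
      show "g x p \<in> borel_measurable (expo \<rho>)" unfolding g_def[abs_def] using meas by (cases "p \<in> prs A") simp_all
    qed (simp add: g_def)
    have gA: "integral\<^sup>L (expo \<rho>) (g x p) = (if p \<in> H then 1 - exp (- \<rho> * t) else exp (- \<rho> * t))"
      if "p \<in> prs A" for p
      using expo_integrals(1,2)[OF pos] that by (cases "p \<in> H") (simp_all add: g_def[abs_def])
    have gX: "integral\<^sup>L (expo \<rho>) (g x p) = exp (- \<rho> * life \<alpha> ?I t x (outer A p))" if "p \<in> ?X" for p
      using expo_integrals(3)[OF pos finI, of \<alpha> x "outer A p"] that by (simp add: g_def[abs_def])
    have "(\<integral>y. f (merge ?I ?J (x, y)) \<partial>clocks \<rho> ?J) = \<psi> (gelled \<rho> \<alpha> ?B t x) * (\<Prod>p\<in>?J. integral\<^sup>L (expo \<rho>) (g x p))"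
      unfolding fm clocks_def using product_integral_prod[OF finJ int] by simp
    also have "(\<Prod>p\<in>?J. integral\<^sup>L (expo \<rho>) (g x p)) =
        (\<Prod>p\<in>prs A. integral\<^sup>L (expo \<rho>) (g x p)) * (\<Prod>p\<in>?X. integral\<^sup>L (expo \<rho>) (g x p))"
      using AV finV by (subst prod.union_disjoint[symmetric]) (auto intro!: prod.cong)
    also have "(\<Prod>p\<in>prs A. integral\<^sup>L (expo \<rho>) (g x p)) =
       (\<Prod>p\<in>prs A. if p \<in> H then 1 - exp (- \<rho> * t) else exp (- \<rho> * t))"
      by (rule prod.cong) (simp_all add: gA)
    also have "\<dots> = ?c"
    proof -
      have "(\<Prod>p\<in>prs A. if p \<in> H then 1 - exp (- \<rho> * t) else exp (- \<rho> * t)) =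
        (1 - exp (- \<rho> * t)) ^ card (prs A \<inter> H) * exp (- \<rho> * t) ^ card (prs A \<inter> - H)"
        using AV by (subst prod.If_cases) auto
      moreover have "prs A \<inter> H = H" "prs A \<inter> - H = prs A - H" using V by auto
      moreover have "card (prs A - H) = card (prs A) - card H" using V AV
        by (intro card_Diff_subset) (auto intro: finite_subset)
      ultimately show ?thesis by simp
    qed
    also have "(\<Prod>p\<in>?X. integral\<^sup>L (expo \<rho>) (g x p)) = (\<Prod>p\<in>?X. exp (- \<rho> * life \<alpha> ?I t x (outer A p)))"
      by (rule prod.cong) (simp_all add: gX)
    also have "\<dots> = exp (- \<rho> * (real (card A) * (\<Sum>v\<in>?B. life \<alpha> ?I t x v)))"
      using finV sum_cross_pairs[OF V(1,2), of "life \<alpha> ?I t x"] by (simp add: exp_sum[symmetric] sum_distrib_left[symmetric] sum_negf)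
    also have "- \<rho> * (real (card A) * (\<Sum>v\<in>?B. life \<alpha> ?I t x v)) =
        - real (card A) * (\<rho> * real (card ?B) * t - gelled \<rho> \<alpha> ?B t x)"
      by (simp add: gelled_def sum_subtractf algebra_simps)
    finally show "(\<integral>y. f (merge ?I ?J (x, y)) \<partial>clocks \<rho> ?J) = ?c * (exp (- real (card A) *
       (\<rho> * real (card ?B) * t - gelled \<rho> \<alpha> ?B t x)) * \<psi> (gelled \<rho> \<alpha> ?B t x))"
      by (simp add: mult_ac)
  qed
  finally show ?thesis unfolding f_def by simp
qed

subsection \<open>Relabelling\<close>

text \<open>Pairs are encoded in increasing order, so only monotone relabellings act on them; this is
  enough to identify every set of particles with an initial segment.\<close>

lemma expectation_relabel:
  fixes h :: "real \<Rightarrow> real"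
  assumes "0 < \<rho>" "finite B" and [measurable]: "h \<in> borel_measurable borel"
  shows "(\<integral>e. h (gelled \<rho> \<alpha> B t e) \<partial>clocks \<rho> (prs B)) =
    (\<integral>e. h (gelled \<rho> \<alpha> {..<card B} t e) \<partial>clocks \<rho> (prs {..<card B}))"
proof -
  let ?K = "{..<card B}"
  obtain f where bij: "bij_betw f ?K B" and mono: "strict_mono_on ?K f"
    by (rule ex_bij_betw_strict_mono_card[OF assms(2)])
  have inj: "inj_on f ?K" and fB: "f ` ?K = B" using bij by (auto simp: bij_betw_def)
  let ?g = "map_prod f f" and ?r = "\<lambda>\<omega>::nat \<times> nat \<Rightarrow> real. \<lambda>p\<in>prs ?K. \<omega> (map_prod f f p)"
  have lt: "f i < f j \<longleftrightarrow> i < j" if "i \<in> ?K" "j \<in> ?K" for i j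
    using strict_mono_on_less[OF mono that] .
  have gB: "?g ` prs ?K = prs B"
  proof
    show "?g ` prs ?K \<subseteq> prs B" using fB lt by (auto simp: prs_def)
    show "prs B \<subseteq> ?g ` prs ?K"
    proof
      fix p assume "p \<in> prs B"
      then have "fst p \<in> f ` ?K" "snd p \<in> f ` ?K" "fst p < snd p" using fB by (auto simp: prs_def)
      then obtain i j where "i \<in> ?K" "j \<in> ?K" "p = (f i, f j)" "f i < f j"
        by (metis imageE prod.collapse)
      then show "p \<in> ?g ` prs ?K" using lt by (auto simp: prs_def intro!: image_eqI[of _ _ "(i, j)"])
    qed
  qed
  have gi: "inj_on ?g (prs ?K)"
    by (rule inj_on_subset[OF map_prod_inj_on[OF inj inj] prs_subset])
  have distr: "distr (clocks \<rho> (prs B)) (clocks \<rho> (prs ?K)) ?r = clocks \<rho> (prs ?K)"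
    unfolding clocks_def
    by (rule distr_PiM_reindex[where f = ?g]) (use gi gB assms prob_space_exponential_density in auto)
  have r: "?r \<in> measurable (clocks \<rho> (prs B)) (clocks \<rho> (prs ?K))"
    unfolding clocks_def
  proof (rule measurable_restrict)
    fix p assume "p \<in> prs ?K"
    then show "(\<lambda>\<omega>. \<omega> (?g p)) \<in> measurable (Pi\<^sub>M (prs B) (\<lambda>p. expo \<rho>)) (expo \<rho>)"
      using gB by (intro measurable_component_singleton) blast
  qed
  have g: "gelled \<rho> \<alpha> ?K t (?r \<omega>) = gelled \<rho> \<alpha> B t \<omega>" for \<omega>
  proof -
    have "life \<alpha> (prs ?K) t (?r \<omega>) v = life \<alpha> (prs B) t \<omega> (f v)" if "v \<in> ?K" for v
    proof -
      have "lk \<alpha> (prs B) \<omega> s = ?g ` lk \<alpha> (prs ?K) (?r \<omega>) s" for s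
      proof -
        have "lk \<alpha> (prs B) \<omega> s = ?g ` lk \<alpha> (prs ?K) (\<omega> \<circ> ?g) s"
          unfolding gB[symmetric] by (rule lk_image[OF inj prs_subset]) simp
        also have "lk \<alpha> (prs ?K) (\<omega> \<circ> ?g) s = lk \<alpha> (prs ?K) (?r \<omega>) s"
          by (rule lk_cong) simp
        finally show ?thesis .
      qed
      moreover have "lk \<alpha> (prs ?K) (?r \<omega>) s \<subseteq> ?K \<times> ?K" for s
        using lk_subset[of "prs ?K" \<alpha> "?r \<omega>" s] prs_subset[of ?K] by auto
      ultimately show ?thesis unfolding life_def using in_sol_image[OF inj _ that] by simp
    qed
    then have "(\<Sum>v\<in>?K. t - life \<alpha> (prs ?K) t (?r \<omega>) v) = (\<Sum>v\<in>?K. t - life \<alpha> (prs B) t \<omega> (f v))"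
      by simp
    also have "\<dots> = (\<Sum>v\<in>B. t - life \<alpha> (prs B) t \<omega> v)"
      by (rule sum.reindex_bij_betw[OF bij])
    finally show ?thesis by (simp add: gelled_def)
  qed
  have [measurable]: "gelled \<rho> \<alpha> ?K t \<in> borel_measurable (clocks \<rho> (prs ?K))" by (rule measurable_gelled) auto
  have "(\<integral>e. h (gelled \<rho> \<alpha> ?K t e) \<partial>clocks \<rho> (prs ?K)) =
    (\<integral>e. h (gelled \<rho> \<alpha> ?K t e) \<partial>distr (clocks \<rho> (prs B)) (clocks \<rho> (prs ?K)) ?r)" by (simp only: distr)
  also have "\<dots> = (\<integral>e. h (gelled \<rho> \<alpha> ?K t (?r e)) \<partial>clocks \<rho> (prs B))"
    by (rule integral_distr[OF r]) measurable
  finally show ?thesis by (simp only: g)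
qed

text \<open>The rate \<open>\<rho>\<close> is not tied to the number of particles \<open>K\<close>:
  removing an isolated set lowers \<open>K\<close> but leaves the remaining clocks at rate
  \<open>1/N\<close>.\<close>

definition gel_mean :: "real \<Rightarrow> real \<Rightarrow> real \<Rightarrow> nat \<Rightarrow> (real \<Rightarrow> real) \<Rightarrow> real" where
  "gel_mean \<rho> \<alpha> t K h = (\<integral>e. h (gelled \<rho> \<alpha> {..<K} t e) \<partial>clocks \<rho> (prs {..<K}))"

lemma integrable_gelled:
  fixes h :: "real \<Rightarrow> real"
  assumes "0 < \<rho>" "0 \<le> t" "h \<in> borel_measurable borel" "\<And>w. 0 \<le> w \<Longrightarrow> w \<le> \<rho> * real K * t \<Longrightarrow> \<bar>h w\<bar> \<le> C"
  shows "integrable (clocks \<rho> (prs {..<K})) (\<lambda>e. h (gelled \<rho> \<alpha> {..<K} t e))"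
proof -
  interpret prob_space "clocks \<rho> (prs {..<K})" by (rule prob_space_clocks[OF assms(1)])
  note [measurable] = assms(3)
  have [measurable]: "gelled \<rho> \<alpha> {..<K} t \<in> borel_measurable (clocks \<rho> (prs {..<K}))" by (rule measurable_gelled) auto
  show ?thesis
    by (rule integrable_const_bound[where B = C])
      (use assms gelled_bounds[of "{..<K}" \<rho> t \<alpha>] in auto)
qed

lemma gel_mean_cong:
  assumes "0 < \<rho>" "0 \<le> t" "\<And>w. 0 \<le> w \<Longrightarrow> w \<le> \<rho> * real K * t \<Longrightarrow> h w = h' w"
  shows "gel_mean \<rho> \<alpha> t K h = gel_mean \<rho> \<alpha> t K h'"
  unfolding gel_mean_def
  by (rule Bochner_Integration.integral_cong) (use assms gelled_bounds[of "{..<K}" \<rho> t \<alpha>] in auto)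

lemma gel_mean_cmult: "gel_mean \<rho> \<alpha> t K (\<lambda>w. c * h w) = c * gel_mean \<rho> \<alpha> t K h"
  unfolding gel_mean_def by simp

lemma gel_mean_bounds:
  assumes "0 < \<rho>" "0 \<le> t" "h \<in> borel_measurable borel"
    and "\<And>w. 0 \<le> w \<Longrightarrow> w \<le> \<rho> * real K * t \<Longrightarrow> 0 \<le> h w"
    and "\<And>w. 0 \<le> w \<Longrightarrow> w \<le> \<rho> * real K * t \<Longrightarrow> h w \<le> C"
  shows "0 \<le> gel_mean \<rho> \<alpha> t K h" "gel_mean \<rho> \<alpha> t K h \<le> C"
proof -
  interpret prob_space "clocks \<rho> (prs {..<K})" by (rule prob_space_clocks[OF assms(1)])
  have b: "0 \<le> h (gelled \<rho> \<alpha> {..<K} t e)" "h (gelled \<rho> \<alpha> {..<K} t e) \<le> C" for e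
    using assms gelled_bounds[of "{..<K}" \<rho> t \<alpha>] by auto
  show "0 \<le> gel_mean \<rho> \<alpha> t K h" unfolding gel_mean_def using b by simp
  show "gel_mean \<rho> \<alpha> t K h \<le> C" unfolding gel_mean_def
    by (rule integral_le_const[OF integrable_gelled[where C = C]]) (use assms b in fastforce)+
qed

lemma gel_mean_isolated:
  fixes \<psi> :: "real \<Rightarrow> real"
  assumes "A \<subseteq> {..<K}" "card A = m" "real m < \<alpha>" "H \<subseteq> prs A" "card H = k" "card (prs A) = l" "0 < \<rho>" "0 \<le> t"
    and "\<psi> \<in> borel_measurable borel" "\<And>w. \<bar>\<psi> w\<bar> \<le> C"
  shows "(\<integral>e. of_bool (touching A (lk \<alpha> (prs {..<K}) e t) = H) * \<psi> (gelled \<rho> \<alpha> {..<K} t e) \<partial>clocks \<rho> (prs {..<K})) =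
    (1 - exp (- \<rho> * t)) ^ k * exp (- \<rho> * t) ^ (l - k) *
    gel_mean \<rho> \<alpha> t (K - m) (\<lambda>w. exp (- real m * (\<rho> * real (K - m) * t - w)) * \<psi> w)"
proof -
  have c: "card ({..<K} - A) = K - m" using assms(1,2) by (subst card_Diff_subset) (auto intro: finite_subset)
  note [measurable] = assms(9)
  have "(\<lambda>w. exp (- real m * (\<rho> * real (K - m) * t - w)) * \<psi> w) \<in> borel_measurable borel" by measurable
  from expectation_relabel[OF assms(7) _ this, of "{..<K} - A" \<alpha> t] show ?thesis
    using expectation_isolated[of "{..<K}" A \<alpha> H \<rho> t \<psi> C] assms c by (simp add: gel_mean_def)
qed

subsection \<open>Stability in the number of particles\<close>

lemma prs_singleton [simp]: "prs {v} = {}" by (auto simp: prs_def)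

lemma card_prs_doubleton: "u \<noteq> v \<Longrightarrow> card (prs {u, v}) = 1"
proof -
  assume "u \<noteq> v"
  then have "prs {u, v} = {(min u v, max u v)}" by (auto simp: prs_def min_def max_def)
  then show ?thesis by simp
qed

lemma touching_doubleton: "touching {u, v} E = {} \<longleftrightarrow> touching {u} E = {} \<and> touching {v} E = {}"
  by (auto simp: touching_def)

lemma pred_touching:
  assumes "finite P" "Q \<subseteq> P"
  shows "Measurable.pred (clocks \<rho> P) (\<lambda>e. touching A (lk \<alpha> Q e t) = H)"
  by (rule measurable_compose[OF measurable_lk_clocks[OF assms]]) measurable

text \<open>A nonnegative second moment, expanded. Isolating two particles yields
  \<open>G (K - 2)\<close>, isolating one yields \<open>G (K - 1)\<close>, and the constant term
  yields \<open>G K\<close>, with the coefficients 1, -2, 1 of a square. Of the two errors,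
  \<open>exp (3 * \<kappa>) - 1\<close> comes from the shift of \<open>K\<close> by two and the
  clock joining the two particles; the other bounds the diagonal, where both particles
  coincide.\<close>

lemma gel_mean_almost_convex:
  fixes h :: "real \<Rightarrow> real"
  assumes "2 < \<alpha>" "0 < \<rho>" "0 \<le> t" and K: "2 \<le> K"
    and h [measurable]: "h \<in> borel_measurable borel" and h01: "\<And>w. 0 \<le> h w" "\<And>w. h w \<le> 1"
  defines "\<kappa> \<equiv> \<rho> * t"
  shows "gel_mean \<rho> \<alpha> t K h - 2 * gel_mean \<rho> \<alpha> t (K - 1) h + gel_mean \<rho> \<alpha> t (K - 2) h
    \<ge> - ((exp (3 * \<kappa>) - 1) + exp (\<kappa> + \<kappa> * real K) / real K)"
proof -
  let ?M = "clocks \<rho> (prs {..<K})" and ?W = "gelled \<rho> \<alpha> {..<K} t"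
  define G where "G k = gel_mean \<rho> \<alpha> t k h" for k
  \<comment> \<open>The truncation makes \<open>q\<close> bounded on the whole line. On the range of
    the gelled time it is, up to a factor \<open>exp \<kappa>\<close>, the reciprocal of the weight
    with which one particle is isolated.\<close>
  define q where "q w = exp (\<kappa> * real K - max 0 (min w (\<kappa> * real K)))" for w
  define iso where "iso v e = (of_bool (touching {v} (lk \<alpha> (prs {..<K}) e t) = {}) :: real)" for v e
  define Y where "Y e = (\<Sum>v<K. iso v e)" for e
  have \<kappa>0: "0 \<le> \<kappa>" using assms by (simp add: \<kappa>_def)
  have [measurable]: "q \<in> borel_measurable borel" unfolding q_def[abs_def] by measurable
  have q_bounds: "1 \<le> q w" "q w \<le> exp (\<kappa> * real K)" for w
    using \<kappa>0 by (auto simp: q_def)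
  have q_eq: "q w = exp (\<kappa> * real K - w)" if "0 \<le> w" "w \<le> \<kappa> * real K" for w
    using that by (simp add: q_def)
  have hq: "\<bar>h w * q w ^ j\<bar> \<le> exp (\<kappa> * real K) ^ j" for w j
  proof -
    have "h w * q w ^ j \<le> 1 * exp (\<kappa> * real K) ^ j"
      using h01 q_bounds[of w] by (intro mult_mono power_mono) auto
    then show ?thesis using h01[of w] q_bounds[of w] by simp
  qed
  interpret prob_space ?M by (rule prob_space_clocks[OF assms(2)])
  have [measurable]: "?W \<in> borel_measurable ?M" by (rule measurable_gelled) auto
  have [measurable]: "iso v \<in> borel_measurable ?M" for v
  proof -
    have [measurable]: "Measurable.pred ?M (\<lambda>e. touching {v} (lk \<alpha> (prs {..<K}) e t) = {})"
      by (rule pred_touching) auto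
    show ?thesis unfolding iso_def[abs_def] by measurable
  qed
  have iso01: "0 \<le> iso v e" "iso v e \<le> 1" for v e by (auto simp: iso_def)
  have int: "integrable ?M (\<lambda>e. iso u e * iso v e * (h (?W e) * q (?W e) ^ j))" for u v j
  proof (rule integrable_const_bound[where B = "exp (\<kappa> * real K) ^ j"])
    have "\<bar>iso u e * iso v e * (h (?W e) * q (?W e) ^ j)\<bar> \<le> exp (\<kappa> * real K) ^ j" for e
      using hq[of "?W e" j] by (auto simp: iso_def)
    then show "AE e in ?M. norm (iso u e * iso v e * (h (?W e) * q (?W e) ^ j)) \<le> exp (\<kappa> * real K) ^ j" by simp
  qed measurable
  have iso2: "iso v e * iso v e = iso v e" for v e by (simp add: iso_def)
  have int1: "integrable ?M (\<lambda>e. iso v e * (h (?W e) * q (?W e) ^ j))" for v j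
    using int[of v v j] by (simp add: iso2)
  have int0: "integrable ?M (\<lambda>e. h (?W e))"
    by (rule integrable_const_bound[where B = 1]) (use h01 in auto)
  have one: "(\<integral>e. iso v e * (h (?W e) * q (?W e) ^ j) \<partial>?M) =
      gel_mean \<rho> \<alpha> t (K - 1) (\<lambda>w. exp (- (\<kappa> * real (K - 1) - w)) * (h w * q w ^ j))" if "v < K" for v j
  proof -
    have "(\<lambda>w. h w * q w ^ j) \<in> borel_measurable borel" by measurable
    from gel_mean_isolated[of "{v}" K 1 \<alpha> "{}" 0 0 \<rho> t, OF _ _ _ _ _ _ assms(2,3) this hq]
    show ?thesis using that assms by (simp add: iso_def \<kappa>_def mult_ac)
  qed
  have two: "(\<integral>e. iso u e * iso v e * (h (?W e) * q (?W e) ^ 2) \<partial>?M) = exp (3 * \<kappa>) * G (K - 2)"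
    if "u < K" "v < K" "u \<noteq> v" for u v
  proof -
    have "(\<lambda>w. h w * q w ^ 2) \<in> borel_measurable borel" by measurable
    from gel_mean_isolated[of "{u, v}" K 2 \<alpha> "{}" 0 1 \<rho> t, OF _ _ _ _ _ _ assms(2,3) this hq]
    have "(\<integral>e. iso u e * iso v e * (h (?W e) * q (?W e) ^ 2) \<partial>?M) = exp (- \<kappa>) *
      gel_mean \<rho> \<alpha> t (K - 2) (\<lambda>w. exp (- 2 * (\<rho> * real (K - 2) * t - w)) * (h w * q w ^ 2))"
      using that assms card_prs_doubleton[of u v]
      by (simp add: iso_def \<kappa>_def touching_doubleton of_bool_conj)
    also have "gel_mean \<rho> \<alpha> t (K - 2) (\<lambda>w. exp (- 2 * (\<rho> * real (K - 2) * t - w)) * (h w * q w ^ 2)) =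
       gel_mean \<rho> \<alpha> t (K - 2) (\<lambda>w. exp (4 * \<kappa>) * h w)"
    proof (rule gel_mean_cong[OF assms(2,3)])
      fix w assume w: "0 \<le> w" "w \<le> \<rho> * real (K - 2) * t"
      have "\<kappa> * real (K - 2) \<le> \<kappa> * real K" using \<kappa>0 by (intro mult_left_mono) auto
      then have "\<rho> * real (K - 2) * t \<le> \<kappa> * real K" by (simp add: \<kappa>_def mult_ac)
      then have "q w = exp (\<kappa> * real K - w)" using w by (intro q_eq) auto
      then have "exp (- 2 * (\<rho> * real (K - 2) * t - w)) * q w ^ 2 = exp (- 2 * (\<rho> * real (K - 2) * t - w) + 2 * (\<kappa> * real K - w))"
        by (simp only: power2_eq_square mult_exp_exp) simp
      also have "- 2 * (\<rho> * real (K - 2) * t - w) + 2 * (\<kappa> * real K - w) = 4 * \<kappa>"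
        using K by (simp add: \<kappa>_def of_nat_diff algebra_simps)
      finally show "exp (- 2 * (\<rho> * real (K - 2) * t - w)) * (h w * q w ^ 2) = exp (4 * \<kappa>) * h w"
        by (simp add: mult_ac)
    qed
    \<comment> \<open>Two particles times a shift of \<open>K\<close> by two give
      \<open>4 * \<kappa>\<close>; the clock between the two, which must not ring, takes one
      \<open>\<kappa>\<close> back.\<close>
    also have "exp (- \<kappa>) * gel_mean \<rho> \<alpha> t (K - 2) (\<lambda>w. exp (4 * \<kappa>) * h w) = exp (3 * \<kappa>) * G (K - 2)"
      by (simp add: gel_mean_cmult G_def mult.assoc[symmetric] mult_exp_exp)
    finally show ?thesis .
  qed
  have rangeK1: "q w = exp (\<kappa> * real K - w)" if "0 \<le> w" "w \<le> \<rho> * real (K - 1) * t" for w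
  proof -
    have "\<kappa> * real (K - 1) \<le> \<kappa> * real K" using \<kappa>0 by (intro mult_left_mono) auto
      then have "\<rho> * real (K - 1) * t \<le> \<kappa> * real K" by (simp add: \<kappa>_def mult_ac)
    then show ?thesis using that by (intro q_eq) auto
  qed
  have one1: "(\<integral>e. iso v e * (h (?W e) * q (?W e) ^ 1) \<partial>?M) = exp \<kappa> * G (K - 1)" if "v < K" for v
    unfolding one[OF that] G_def gel_mean_cmult[symmetric]
  proof (rule gel_mean_cong[OF assms(2,3)])
    fix w assume w: "0 \<le> w" "w \<le> \<rho> * real (K - 1) * t"
    have "exp (- (\<kappa> * real (K - 1) - w)) * exp (\<kappa> * real K - w) = exp \<kappa>"
      using K by (simp add: mult_exp_exp of_nat_diff algebra_simps)
    then show "exp (- (\<kappa> * real (K - 1) - w)) * (h w * q w ^ 1) = exp \<kappa> * h w"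
      unfolding rangeK1[OF w] by (simp add: mult_ac)
  qed
  have one2: "(\<integral>e. iso v e * (h (?W e) * q (?W e) ^ 2) \<partial>?M) \<le> exp (\<kappa> + \<kappa> * real K)" if "v < K" for v
    unfolding one[OF that]
  proof (rule gel_mean_bounds(2)[OF assms(2,3)])
    fix w assume w: "0 \<le> w" "w \<le> \<rho> * real (K - 1) * t"
    have "exp (- (\<kappa> * real (K - 1) - w)) * q w ^ 2 = exp (\<kappa> + \<kappa> * real K - w)"
      unfolding rangeK1[OF w] power2_eq_square mult_exp_exp using K by (simp add: of_nat_diff algebra_simps)
    moreover have "\<dots> \<le> exp (\<kappa> + \<kappa> * real K)" using w by simp
    ultimately have "h w * (exp (- (\<kappa> * real (K - 1) - w)) * q w ^ 2) \<le> 1 * exp (\<kappa> + \<kappa> * real K)"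
      using h01[of w] by (intro mult_mono) auto
    then show "exp (- (\<kappa> * real (K - 1) - w)) * (h w * q w ^ 2) \<le> exp (\<kappa> + \<kappa> * real K)"
      by (simp add: mult_ac)
    show "0 \<le> exp (- (\<kappa> * real (K - 1) - w)) * (h w * q w ^ 2)" using h01 by simp
  qed measurable
  \<comment> \<open>The number of isolated particles is compared with its prediction \<open>K * exp (- (\<kappa> K - W))\<close>; the
    weight \<open>h q\<^sup>2\<close> makes every term of the second moment a multiple of \<open>G\<close>.\<close>
  have "0 \<le> (\<integral>e. (Y e * q (?W e) - real K)\<^sup>2 * h (?W e) \<partial>?M)"
    using h01 by (intro Bochner_Integration.integral_nonneg) simp
  also have "\<dots> = (\<integral>e. (\<Sum>u<K. \<Sum>v<K. iso u e * iso v e * (h (?W e) * q (?W e) ^ 2))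
      - 2 * real K * (\<Sum>v<K. iso v e * (h (?W e) * q (?W e) ^ 1)) + (real K)\<^sup>2 * h (?W e) \<partial>?M)"
  proof (rule Bochner_Integration.integral_cong[OF refl])
    fix e
    have "(\<Sum>u<K. \<Sum>v<K. iso u e * iso v e * (h (?W e) * q (?W e) ^ 2)) = Y e * Y e * (h (?W e) * q (?W e) ^ 2)"
      unfolding Y_def sum_product by (simp add: sum_distrib_right)
    moreover have "(\<Sum>v<K. iso v e * (h (?W e) * q (?W e) ^ 1)) = Y e * (h (?W e) * q (?W e))"
      unfolding Y_def by (simp add: sum_distrib_right)
    ultimately show "(Y e * q (?W e) - real K)\<^sup>2 * h (?W e) =
       (\<Sum>u<K. \<Sum>v<K. iso u e * iso v e * (h (?W e) * q (?W e) ^ 2))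
      - 2 * real K * (\<Sum>v<K. iso v e * (h (?W e) * q (?W e) ^ 1)) + (real K)\<^sup>2 * h (?W e)"
      by (simp add: power2_eq_square algebra_simps)
  qed
  also have "\<dots> = (\<Sum>u<K. \<Sum>v<K. \<integral>e. iso u e * iso v e * (h (?W e) * q (?W e) ^ 2) \<partial>?M)
      - 2 * real K * (\<Sum>v<K. \<integral>e. iso v e * (h (?W e) * q (?W e) ^ 1) \<partial>?M) + (real K)\<^sup>2 * G K"
    using int int1[of _ 1] int0 by (simp add: G_def gel_mean_def)
  also have "\<dots> \<le> (real K * (exp (\<kappa> + \<kappa> * real K) + real (K - 1) * (exp (3 * \<kappa>) * G (K - 2))))
      - 2 * real K * (real K * (exp \<kappa> * G (K - 1))) + (real K)\<^sup>2 * G K"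
  proof -
    have "(\<Sum>v<K. \<integral>e. iso u e * iso v e * (h (?W e) * q (?W e) ^ 2) \<partial>?M) \<le>
        exp (\<kappa> + \<kappa> * real K) + real (K - 1) * (exp (3 * \<kappa>) * G (K - 2))" if "u < K" for u
    proof -
      have "(\<Sum>v<K. \<integral>e. iso u e * iso v e * (h (?W e) * q (?W e) ^ 2) \<partial>?M) =
          (\<integral>e. iso u e * iso u e * (h (?W e) * q (?W e) ^ 2) \<partial>?M) +
          (\<Sum>v\<in>{..<K} - {u}. \<integral>e. iso u e * iso v e * (h (?W e) * q (?W e) ^ 2) \<partial>?M)"
        using that by (intro sum.remove) auto
      also have "(\<Sum>v\<in>{..<K} - {u}. \<integral>e. iso u e * iso v e * (h (?W e) * q (?W e) ^ 2) \<partial>?M) =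
          (\<Sum>v\<in>{..<K} - {u}. exp (3 * \<kappa>) * G (K - 2))"
        by (rule sum.cong) (use that two in auto)
      finally show ?thesis using one2[OF that] that by (simp add: iso2)
    qed
    then have "(\<Sum>u<K. \<Sum>v<K. \<integral>e. iso u e * iso v e * (h (?W e) * q (?W e) ^ 2) \<partial>?M) \<le>
       (\<Sum>u<K. exp (\<kappa> + \<kappa> * real K) + real (K - 1) * (exp (3 * \<kappa>) * G (K - 2)))"
      by (intro sum_mono) auto
    moreover have "(\<Sum>v<K. \<integral>e. iso v e * (h (?W e) * q (?W e) ^ 1) \<partial>?M) = (\<Sum>v<K. exp \<kappa> * G (K - 1))"
      by (rule sum.cong) (use one1 in auto)
    ultimately show ?thesis using K by (simp add: of_nat_diff)
  qed
  also have "\<dots> = (real K)\<^sup>2 * (exp (\<kappa> + \<kappa> * real K) / real K +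
      (real (K - 1) / real K) * (exp (3 * \<kappa>) * G (K - 2)) - 2 * (exp \<kappa> * G (K - 1)) + G K)"
  proof -
    have "x * (a + b * g) - 2 * x * (x * d) + x\<^sup>2 * f = x\<^sup>2 * (a / x + (b / x) * g - 2 * d + f)"
      if "x \<noteq> 0" for x a b g d f :: real
      using that by (simp add: power2_eq_square field_simps)
    then show ?thesis using K by simp
  qed
  finally have "0 \<le> (real K)\<^sup>2 * (exp (\<kappa> + \<kappa> * real K) / real K +
      (real (K - 1) / real K) * (exp (3 * \<kappa>) * G (K - 2)) - 2 * (exp \<kappa> * G (K - 1)) + G K)" .
  then have "0 \<le> exp (\<kappa> + \<kappa> * real K) / real K + (real (K - 1) / real K) * (exp (3 * \<kappa>) * G (K - 2))
      - 2 * (exp \<kappa> * G (K - 1)) + G K"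
    using K by (simp add: zero_le_mult_iff)
  moreover have G01: "0 \<le> G k" "G k \<le> 1" for k
    unfolding G_def using h01 by (auto intro!: gel_mean_bounds assms)
  moreover have "(real (K - 1) / real K) * (exp (3 * \<kappa>) * G (K - 2)) \<le> 1 * (exp (3 * \<kappa>) * G (K - 2))"
    using K G01 by (intro mult_right_mono) auto
  moreover have "(exp (3 * \<kappa>) - 1) * G (K - 2) \<le> (exp (3 * \<kappa>) - 1) * 1"
    using \<kappa>0 G01 by (intro mult_left_mono) auto
  moreover have "1 * G (K - 1) \<le> exp \<kappa> * G (K - 1)"
    using \<kappa>0 G01 by (intro mult_right_mono) auto
  ultimately show ?thesis by (simp add: G_def[symmetric] algebra_simps)
qed

text \<open>The slope can drop by at most \<open>c\<close> per step. A large positive slope at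
  \<open>k\<close> therefore persists over the next \<open>L\<close> steps, and a large negative one
  prevailed over the preceding \<open>L\<close> steps, up to \<open>c * L\<close>; but a sequence in
  \<open>[0, 1]\<close> changes by at most 1 in total.\<close>

lemma almost_convex_increment:
  fixes a :: "nat \<Rightarrow> real"
  assumes a01: "\<And>k. 0 \<le> a k" "\<And>k. a k \<le> 1" and c: "0 \<le> c" and L: "0 < L" "L \<le> k"
    and conv: "\<And>j. k - L \<le> j \<Longrightarrow> j \<le> k + L \<Longrightarrow> a (j + 2) - 2 * a (j + 1) + a j \<ge> - c"
  shows "\<bar>a (k + 1) - a k\<bar> \<le> 1 / real L + c * real L"
proof -
  define d where "d j = a (j + 1) - a j" for j
  have step: "d (j + 1) \<ge> d j - c" if "k - L \<le> j" "j \<le> k + L" for j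
    using conv[OF that] by (simp add: d_def)
  have up: "d (k + j) \<ge> d k - c * real j" if "j \<le> L" for j
    using that
  proof (induction j)
    case (Suc j)
    moreover have "k - L \<le> k + j" "k + j \<le> k + L" using Suc.prems by simp_all
    ultimately show ?case using step[of "k + j"] by (simp add: algebra_simps)
  qed simp
  have down: "d (k - j) \<le> d k + c * real j" if "j \<le> L" for j
    using that
  proof (induction j)
    case (Suc j)
    have "k - Suc j + 1 = k - j" using Suc L by simp
    moreover have "k - L \<le> k - Suc j" "k - Suc j \<le> k + L" using Suc.prems by simp_all
    ultimately show ?case using step[of "k - Suc j"] Suc by (simp add: algebra_simps)
  qed simp
  have "real L * (d k - c * real L) = (\<Sum>j<L. d k - c * real L)" by simp
  also have "\<dots> \<le> (\<Sum>j<L. d (k + j))"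
  proof (rule sum_mono)
    fix j assume "j \<in> {..<L}"
    then have "c * real j \<le> c * real L" using c by (intro mult_left_mono) auto
    then show "d k - c * real L \<le> d (k + j)" using up[of j] \<open>j \<in> {..<L}\<close> by simp
  qed
  also have "\<dots> = a (k + L) - a k"
    unfolding d_def using sum_lessThan_telescope[of "\<lambda>j. a (k + j)" L] by simp
  finally have 1: "real L * (d k - c * real L) \<le> 1" using a01(1)[of k] a01(2)[of "k + L"] by simp
  have "(\<Sum>j<L. d (k - j)) \<le> (\<Sum>j<L. d k + c * real L)"
  proof (rule sum_mono)
    fix j assume "j \<in> {..<L}"
    then have "c * real j \<le> c * real L" using c by (intro mult_left_mono) auto
    then show "d (k - j) \<le> d k + c * real L" using down[of j] \<open>j \<in> {..<L}\<close> by simp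
  qed
  moreover have "(\<Sum>j<n. d (k - j)) = a (k + 1) - a (k + 1 - n)" if "n \<le> L" for n
    using that
  proof (induction n)
    case (Suc n)
    have "k - n + 1 = k + 1 - n" "k + 1 - Suc n = k - n" using Suc L by simp_all
    then show ?case using Suc by (simp add: d_def)
  qed simp
  ultimately have 2: "- 1 \<le> real L * (d k + c * real L)"
    using a01(1)[of "k + 1"] a01(2)[of "k + 1 - L"] by simp
  have "d k - c * real L \<le> 1 / real L" "- (1 / real L) \<le> d k + c * real L"
    using 1 2 L by (simp_all add: field_simps)
  then show ?thesis unfolding d_def by (simp add: abs_le_iff)
qed

subsection \<open>Plane trees and rooted isomorphisms\<close>

fun tree_size :: "ptree \<Rightarrow> nat" where
  "tree_size (PNode ts) = Suc (sum_list (map tree_size ts))"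

text \<open>The product of the factorials of all child numbers. Its reciprocal is the combinatorial
  part of the Poisson weight of a plane tree, and it also counts the plane trees equipped with an
  isomorphism onto the given tree (\<open>card_orders\<close>). This coincidence takes the place of
  automorphism groups.\<close>

fun orderings :: "ptree \<Rightarrow> nat" where
  "orderings (PNode ts) = fact (length ts) * prod_list (map orderings ts)"

lemma orderings_pos [simp]: "0 < orderings s"
proof (induction s)
  case (PNode ts)
  have "0 < prod_list (map f xs)" if "\<forall>x\<in>set xs. 0 < f x" for f :: "ptree \<Rightarrow> nat" and xs
    using that by (induction xs) auto
  then show ?case using PNode by simp
qed

lemma tree_size_pos [simp]: "0 < tree_size s"
  by (cases s) simp

lemma tree_verts_PNode:
  "tree_verts (PNode ts) = insert [] (\<Union>i<length ts. (#) i ` tree_verts (ts ! i))"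
proof -
  have "tree_vertex (PNode ts) p \<longleftrightarrow> p = [] \<or> (\<exists>i q. i < length ts \<and> p = i # q \<and> tree_vertex (ts ! i) q)" for p
    by (subst tree_vertex.simps) auto
  then show ?thesis unfolding tree_verts_def by auto
qed

lemma Nil_in_tree_verts [simp]: "[] \<in> tree_verts s"
  by (simp add: tree_verts_def tree_vertex.root)

lemma Cons_in_tree_verts [simp]:
  "i # p \<in> tree_verts (PNode ts) \<longleftrightarrow> i < length ts \<and> p \<in> tree_verts (ts ! i)"
  by (auto simp: tree_verts_PNode)

lemma snoc_in_tree_verts: "u @ [k] \<in> tree_verts s \<Longrightarrow> u \<in> tree_verts s"
proof (induction u arbitrary: s)
  case (Cons i u)
  then show ?case by (cases s) auto
qed simp

lemma tree_verts_finite_card: "finite (tree_verts s) \<and> card (tree_verts s) = tree_size s"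
proof (induction s)
  case (PNode ts)
  have IH: "finite (tree_verts (ts ! i))" "card (tree_verts (ts ! i)) = tree_size (ts ! i)" if "i < length ts" for i
    using PNode that by auto
  have "card (\<Union>i<length ts. (#) i ` tree_verts (ts ! i)) = (\<Sum>i<length ts. card ((#) i ` tree_verts (ts ! i)))"
    by (rule card_UN_disjoint) (use IH in auto)
  also have "\<dots> = (\<Sum>i<length ts. tree_size (ts ! i))"
    by (rule sum.cong) (use IH in \<open>auto simp: card_image\<close>)
  finally show ?case unfolding tree_verts_PNode using IH
    by (subst card_insert_disjoint) (auto simp: sum_list_sum_nth atLeast0LessThan)
qed

lemmas finite_tree_verts [simp] = tree_verts_finite_card[THEN conjunct1]
lemmas card_tree_verts = tree_verts_finite_card[THEN conjunct2]

lemma tree_adj_simps [simp]: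
  "\<not> tree_adj s [] []"
  "tree_adj (PNode ts) [] (j # q) \<longleftrightarrow> j < length ts \<and> q = []"
  "tree_adj (PNode ts) (j # q) [] \<longleftrightarrow> j < length ts \<and> q = []"
  "tree_adj (PNode ts) (i # p) (j # q) \<longleftrightarrow> i = j \<and> j < length ts \<and> tree_adj (ts ! j) p q"
  by (auto simp: tree_adj_def)

text \<open>Extensionality ensures that each isomorphism is counted once. The target is an arbitrary
  graph, since plane trees are compared with clusters of particles as well as with each
  other.\<close>

definition isos :: "ptree \<Rightarrow> 'a set \<Rightarrow> ('a \<Rightarrow> 'a \<Rightarrow> bool) \<Rightarrow> 'a \<Rightarrow> (nat list \<Rightarrow> 'a) set" where
  "isos s V R r = {f \<in> extensional (tree_verts s). bij_betw f (tree_verts s) V \<and> f [] = r \<and>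
     (\<forall>x\<in>tree_verts s. \<forall>y\<in>tree_verts s. tree_adj s x y \<longleftrightarrow> R (f x) (f y))}"

abbreviation tree_isos :: "ptree \<Rightarrow> ptree \<Rightarrow> (nat list \<Rightarrow> nat list) set" where
  "tree_isos s T \<equiv> isos s (tree_verts T) (tree_adj T) []"

lemma isosD:
  assumes "f \<in> isos s V R r"
  shows "bij_betw f (tree_verts s) V" "f [] = r" "f \<in> extensional (tree_verts s)"
    "\<And>x y. x \<in> tree_verts s \<Longrightarrow> y \<in> tree_verts s \<Longrightarrow> tree_adj s x y \<longleftrightarrow> R (f x) (f y)"
    "inj_on f (tree_verts s)" "f ` tree_verts s = V" "\<And>x. x \<in> tree_verts s \<Longrightarrow> f x \<in> V"
  using assms unfolding isos_def by (auto dest: bij_betw_imp_inj_on bij_betw_imp_surj_on)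

lemma rooted_iso_iff_isos:
  "rooted_iso (tree_verts s) (tree_adj s) [] V R r \<longleftrightarrow> isos s V R r \<noteq> {}"
proof
  assume "rooted_iso (tree_verts s) (tree_adj s) [] V R r"
  then obtain f where f: "bij_betw f (tree_verts s) V" "f [] = r"
     "\<forall>x\<in>tree_verts s. \<forall>y\<in>tree_verts s. tree_adj s x y \<longleftrightarrow> R (f x) (f y)"
    unfolding rooted_iso_def by blast
  then have "restrict f (tree_verts s) \<in> isos s V R r"
    by (auto simp: isos_def bij_betw_restrict_eq)
  then show "isos s V R r \<noteq> {}" by blast
next
  assume "isos s V R r \<noteq> {}"
  then show "rooted_iso (tree_verts s) (tree_adj s) [] V R r"
    unfolding rooted_iso_def isos_def by auto
qed

lemma rooted_iso_sym:
  "rooted_iso V1 A1 r1 V2 A2 r2 \<Longrightarrow> rooted_iso V2 A2 r2 V1 A1 r1"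
proof -
  assume "rooted_iso V1 A1 r1 V2 A2 r2"
  then obtain f where f: "bij_betw f V1 V2" "r1 \<in> V1" "f r1 = r2"
    "\<And>x y. x \<in> V1 \<Longrightarrow> y \<in> V1 \<Longrightarrow> A1 x y \<longleftrightarrow> A2 (f x) (f y)"
    unfolding rooted_iso_def by blast
  let ?g = "inv_into V1 f"
  have g: "bij_betw ?g V2 V1" using f(1) by (rule bij_betw_inv_into)
  have "A2 x y \<longleftrightarrow> A1 (?g x) (?g y)" if "x \<in> V2" "y \<in> V2" for x y
    using f(4)[of "?g x" "?g y"] that bij_betwE[OF g] bij_betw_inv_into_right[OF f(1)] by simp
  moreover have "r2 \<in> V2" "?g r2 = r1" using f bij_betwE[OF f(1)] bij_betw_inv_into_left[OF f(1,2)] by auto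
  ultimately show ?thesis unfolding rooted_iso_def using g by blast
qed

lemma rooted_iso_trans:
  assumes "rooted_iso V1 A1 r1 V2 A2 r2" "rooted_iso V2 A2 r2 V3 A3 r3"
  shows "rooted_iso V1 A1 r1 V3 A3 r3"
proof -
  obtain f where f: "bij_betw f V1 V2" "r1 \<in> V1" "f r1 = r2"
    "\<And>x y. x \<in> V1 \<Longrightarrow> y \<in> V1 \<Longrightarrow> A1 x y \<longleftrightarrow> A2 (f x) (f y)"
    using assms(1) unfolding rooted_iso_def by blast
  obtain g where g: "bij_betw g V2 V3" "g r2 = r3"
    "\<And>x y. x \<in> V2 \<Longrightarrow> y \<in> V2 \<Longrightarrow> A2 x y \<longleftrightarrow> A3 (g x) (g y)"
    using assms(2) unfolding rooted_iso_def by blast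
  have "bij_betw (g \<circ> f) V1 V3" using f(1) g(1) by (rule bij_betw_trans)
  moreover have "A1 x y \<longleftrightarrow> A3 ((g \<circ> f) x) ((g \<circ> f) y)" if "x \<in> V1" "y \<in> V1" for x y
    using f(4)[OF that] g(3)[of "f x" "f y"] bij_betwE[OF f(1)] that by simp
  ultimately show ?thesis unfolding rooted_iso_def using f g by (intro exI[of _ "g \<circ> f"]) auto
qed

text \<open>Adjacency alone says that the image of a child is a child or the parent of the image.
  The root has no parent; further down the parent is excluded by injectivity, being already the
  image of the parent.\<close>

lemma tree_iso_snoc:
  assumes f: "f \<in> tree_isos s T" and u: "u @ [k] \<in> tree_verts s"
  shows "\<exists>j. f (u @ [k]) = f u @ [j]"
  using u
proof (induction u arbitrary: k rule: rev_induct)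
  case Nil
  have "tree_adj s [] [k]" using Nil by (simp add: tree_adj_def)
  then have "tree_adj T [] (f [k])" using isosD(2,4)[OF f] Nil by force
  then show ?case using isosD(2)[OF f] by (auto simp: tree_adj_def)
next
  case (snoc i u)
  have ui: "u @ [i] \<in> tree_verts s" "u \<in> tree_verts s" using snoc.prems snoc_in_tree_verts by blast+
  have "tree_adj s (u @ [i]) ((u @ [i]) @ [k])" using snoc.prems ui by (simp add: tree_adj_def)
  then have "tree_adj T (f (u @ [i])) (f ((u @ [i]) @ [k]))" using isosD(4)[OF f ui(1) snoc.prems] by simp
  moreover obtain j where j: "f (u @ [i]) = f u @ [j]" using snoc.IH ui by blast
  moreover have "f ((u @ [i]) @ [k]) \<noteq> f u"
  proof
    assume "f ((u @ [i]) @ [k]) = f u"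
    then have "(u @ [i]) @ [k] = u" using inj_onD[OF isosD(5)[OF f]] snoc.prems ui by blast
    then show False by simp
  qed
  ultimately show ?case by (auto simp: tree_adj_def)
qed

lemma tree_iso_length:
  assumes f: "f \<in> tree_isos s T" shows "p \<in> tree_verts s \<Longrightarrow> length (f p) = length p"
proof (induction p rule: rev_induct)
  case Nil
  then show ?case using isosD(2)[OF f] by simp
next
  case (snoc k u)
  then show ?case using tree_iso_snoc[OF f snoc.prems] snoc_in_tree_verts by force
qed

lemma tree_iso_hd:
  assumes f: "f \<in> tree_isos (PNode ss) T"
  shows "p \<in> tree_verts (ss ! i) \<Longrightarrow> i < length ss \<Longrightarrow> f (i # p) = hd (f [i]) # tl (f (i # p))"
proof (induction p rule: rev_induct)
  case Nil
  then have "length (f [i]) = 1" using tree_iso_length[OF f, of "[i]"] by simp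
  then show ?case by (cases "f [i]") auto
next
  case (snoc k u)
  then have "u \<in> tree_verts (ss ! i)" using snoc_in_tree_verts by blast
  then have IH: "f (i # u) = hd (f [i]) # tl (f (i # u))" using snoc by blast
  have "(i # u) @ [k] \<in> tree_verts (PNode ss)" using snoc.prems by simp
  then obtain j where "f ((i # u) @ [k]) = f (i # u) @ [j]" using tree_iso_snoc[OF f] by blast
  then show ?case using IH by (metis append_Cons list.sel(1,3))
qed

text \<open>Inverse to cutting an isomorphism at the root: \<open>\<pi>\<close> tells to which
  branch of the target each branch is sent, and \<open>h i\<close> holds the \<open>i\<close>-th
  branch of the new tree together with its isomorphism onto branch \<open>\<pi> i\<close>.\<close>

definition assemble :: "nat \<Rightarrow> (nat \<Rightarrow> nat) \<Rightarrow> (nat \<Rightarrow> ptree \<times> (nat list \<Rightarrow> nat list)) \<Rightarrow> ptree \<times> (nat list \<Rightarrow> nat list)" where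
  "assemble d \<pi> h = (let s = PNode (map (\<lambda>i. fst (h i)) [0..<d]) in
     (s, \<lambda>p\<in>tree_verts s. case p of [] \<Rightarrow> [] | i # q \<Rightarrow> \<pi> i # snd (h i) q))"

abbreviation orders :: "ptree \<Rightarrow> (ptree \<times> (nat list \<Rightarrow> nat list)) set" where
  "orders T \<equiv> {(s, f). f \<in> tree_isos s T}"

lemma assemble_in_orders:
  assumes \<pi>: "\<pi> permutes {..<length ts}" and h: "\<And>i. i < length ts \<Longrightarrow> h i \<in> orders (ts ! \<pi> i)"
  shows "assemble (length ts) \<pi> h \<in> orders (PNode ts)"
proof -
  let ?d = "length ts"
  let ?s = "PNode (map (\<lambda>i. fst (h i)) [0..<?d])"
  let ?F = "\<lambda>p. case p of [] \<Rightarrow> [] | i # q \<Rightarrow> \<pi> i # snd (h i) q"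
  have hi: "snd (h i) \<in> tree_isos (fst (h i)) (ts ! \<pi> i)" if "i < ?d" for i using h[OF that] by auto
  have \<pi>d: "\<pi> i < ?d \<longleftrightarrow> i < ?d" for i using permutes_in_image[OF \<pi>, of i] by simp
  have \<pi>i: "\<pi> i = \<pi> j \<longleftrightarrow> i = j" for i j using permutes_inj[OF \<pi>] by (auto dest: injD)
  have "inj_on ?F (tree_verts ?s)"
  proof (rule inj_onI)
    fix p q assume pq: "p \<in> tree_verts ?s" "q \<in> tree_verts ?s" "?F p = ?F q"
    then show "p = q"
      using isosD(5)[OF hi] by (cases p; cases q) (auto simp: \<pi>i dest: inj_onD)
  qed
  moreover have "?F ` tree_verts ?s = tree_verts (PNode ts)"
  proof (intro equalityI subsetI)
    fix x assume "x \<in> ?F ` tree_verts ?s"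
    then obtain p where p: "p \<in> tree_verts ?s" "x = ?F p" by blast
    then show "x \<in> tree_verts (PNode ts)"
      using isosD(7)[OF hi] by (cases p) (auto simp: \<pi>d)
  next
    fix x assume x: "x \<in> tree_verts (PNode ts)"
    show "x \<in> ?F ` tree_verts ?s"
    proof (cases x)
      case Nil
      then show ?thesis by (intro image_eqI[of _ _ "[]"]) auto
    next
      case (Cons j q)
      then have j: "j < ?d" "q \<in> tree_verts (ts ! j)" using x by auto
      obtain i where i: "i < ?d" "\<pi> i = j" using permutes_image[OF \<pi>] j by (metis imageE lessThan_iff)
      then obtain p where "p \<in> tree_verts (fst (h i))" "snd (h i) p = q"
        using isosD(6)[OF hi[OF i(1)]] j by (metis imageE)
      then show ?thesis using i Cons by (intro image_eqI[of _ _ "i # p"]) auto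
    qed
  qed
  moreover have "tree_adj ?s x y \<longleftrightarrow> tree_adj (PNode ts) (?F x) (?F y)"
    if "x \<in> tree_verts ?s" "y \<in> tree_verts ?s" for x y
  proof -
    have e: "snd (h i) q = [] \<longleftrightarrow> q = []" if "i < ?d" "q \<in> tree_verts (fst (h i))" for i q
      using tree_iso_length[OF hi[OF that(1)] that(2)] by (metis length_0_conv)
    show ?thesis using that
      by (cases x; cases y) (auto simp: \<pi>d \<pi>i e isosD(4)[OF hi])
  qed
  ultimately show ?thesis
    unfolding assemble_def Let_def by (auto simp: isos_def bij_betw_def cong: inj_on_cong)
qed

lemma assemble_inj:
  assumes "\<pi> permutes {..<length ts}" "\<pi>' permutes {..<length ts}"
    and "h \<in> (\<Pi>\<^sub>E i\<in>{..<length ts}. orders (ts ! \<pi> i))" "h' \<in> (\<Pi>\<^sub>E i\<in>{..<length ts}. orders (ts ! \<pi>' i))"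
    and eq: "assemble (length ts) \<pi> h = assemble (length ts) \<pi>' h'"
  shows "\<pi> = \<pi>' \<and> h = h'"
proof -
  let ?d = "length ts"
  have o: "snd (h i) \<in> tree_isos (fst (h i)) (ts ! \<pi> i)" "snd (h' i) \<in> tree_isos (fst (h' i)) (ts ! \<pi>' i)"
    if "i < ?d" for i using PiE_mem[OF assms(3), of i] PiE_mem[OF assms(4), of i] that by (auto simp: split_beta)
  have "map (\<lambda>i. fst (h i)) [0..<?d] = map (\<lambda>i. fst (h' i)) [0..<?d]"
    using eq by (simp add: assemble_def Let_def)
  then have fst: "fst (h i) = fst (h' i)" if "i < ?d" for i using that by (simp add: map_eq_conv)
  have val: "\<pi> i # snd (h i) q = \<pi>' i # snd (h' i) q" if "i < ?d" "q \<in> tree_verts (fst (h i))" for i q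
    using fun_cong[OF arg_cong[OF eq, of snd], of "i # q"] that fst by (simp add: assemble_def Let_def)
  have pp: "\<pi>' = \<pi>"
  proof (rule ext)
   fix i show "\<pi>' i = \<pi> i"
   proof (cases "i < ?d")
    case True
    then show ?thesis using val[of i "[]"] by simp
  next
    case False
    then show ?thesis using permutes_not_in[OF assms(1), of i] permutes_not_in[OF assms(2), of i] by simp
   qed
  qed
  have "h i = h' i" if "i \<in> {..<?d}" for i
  proof -
    have i: "i < ?d" using that by simp
    have "snd (h i) = snd (h' i)"
    proof (rule extensionalityI[of _ "tree_verts (fst (h i))"])
      show "snd (h i) \<in> extensional (tree_verts (fst (h i)))" by (rule isosD(3)[OF o(1)[OF i]])
      show "snd (h' i) \<in> extensional (tree_verts (fst (h i)))" unfolding fst[OF i] by (rule isosD(3)[OF o(2)[OF i]])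
    qed (use val[OF i] in auto)
    then show ?thesis using fst[OF i] by (rule prod_eqI[rotated])
  qed
  then have "h = h'" by (rule PiE_ext[OF assms(3) assms(4)[unfolded pp]])
  then show ?thesis using pp by blast
qed

text \<open>An isomorphism preserves depth, and by \<open>tree_iso_hd\<close> the branch of a vertex
  is determined by the image of the child of the root below it. So the branches are permuted, and
  the map restricts to an isomorphism on each.\<close>

lemma orders_decompose:
  assumes f: "f \<in> tree_isos (PNode ss) (PNode ts)"
  obtains \<pi> h where "\<pi> permutes {..<length ts}" "h \<in> (\<Pi>\<^sub>E i\<in>{..<length ts}. orders (ts ! \<pi> i))"
    "(PNode ss, f) = assemble (length ts) \<pi> h" "length ss = length ts" "\<And>i. i < length ts \<Longrightarrow> fst (h i) = ss ! i"
proof -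
  let ?s = "PNode ss" and ?T = "PNode ts"
  \<comment> \<open>Beyond the children of the root a permutation of \<open>{..<length ts}\<close>
    has to be the identity.\<close>
  define \<pi> where "\<pi> i = (if i < length ss then hd (f [i]) else i)" for i
  have fi: "f (i # p) = \<pi> i # tl (f (i # p))" if "i < length ss" "p \<in> tree_verts (ss ! i)" for i p
    using tree_iso_hd[OF f that(2,1)] that by (simp add: \<pi>_def)
  have f1: "f [i] = [\<pi> i]" if "i < length ss" for i
    using fi[of i "[]"] tree_iso_length[OF f, of "[i]"] that by (cases "f [i]") auto
  have in_T: "\<pi> i < length ts" "tl (f (i # p)) \<in> tree_verts (ts ! \<pi> i)"
    if "i < length ss" "p \<in> tree_verts (ss ! i)" for i p
  proof -
    have "\<pi> i # tl (f (i # p)) \<in> tree_verts ?T"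
      using isosD(7)[OF f, of "i # p"] that fi[OF that] by simp
    then show "\<pi> i < length ts" "tl (f (i # p)) \<in> tree_verts (ts ! \<pi> i)" by auto
  qed
  have \<pi>inj: "i = j" if "i < length ss" "j < length ss" "\<pi> i = \<pi> j" for i j
    using inj_onD[OF isosD(5)[OF f], of "[i]" "[j]"] that f1 by simp
  have lift: "\<exists>i p. i < length ss \<and> p \<in> tree_verts (ss ! i) \<and> \<pi> i = j \<and> tl (f (i # p)) = q"
    if "j < length ts" "q \<in> tree_verts (ts ! j)" for j q
  proof -
    have "j # q \<in> tree_verts ?T" using that by simp
    then obtain x where x: "x \<in> tree_verts ?s" "f x = j # q" using isosD(6)[OF f] by (metis imageE)
    then obtain i p where ip: "x = i # p" using isosD(2)[OF f] by (cases x) auto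
    then have "i < length ss" "p \<in> tree_verts (ss ! i)" using x by auto
    then show ?thesis using x ip fi[of i p] by (intro exI[of _ i] exI[of _ p]) simp
  qed
  have bij: "bij_betw \<pi> {..<length ss} {..<length ts}"
    unfolding bij_betw_def
  proof
    show "inj_on \<pi> {..<length ss}" using \<pi>inj by (auto intro: inj_onI)
    show "\<pi> ` {..<length ss} = {..<length ts}"
      using in_T(1)[OF _ Nil_in_tree_verts] lift[OF _ Nil_in_tree_verts] by fastforce
  qed
  then have len: "length ss = length ts" using bij_betw_same_card by fastforce
  have \<pi>p: "\<pi> permutes {..<length ts}"
    by (rule bij_imp_permutes) (use bij len in \<open>auto simp: \<pi>_def\<close>)
  define g where "g i = (\<lambda>p\<in>tree_verts (ss ! i). tl (f (i # p)))" for i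
  define h where "h = (\<lambda>i\<in>{..<length ts}. (ss ! i, g i))"
  have gi: "g i \<in> tree_isos (ss ! i) (ts ! \<pi> i)" if i: "i < length ss" for i
  proof -
    have gf: "f (i # p) = \<pi> i # g i p" if "p \<in> tree_verts (ss ! i)" for p
      using fi[OF i that] that by (simp add: g_def)
    have inj: "inj_on (g i) (tree_verts (ss ! i))"
    proof (rule inj_onI)
      fix p q assume pq: "p \<in> tree_verts (ss ! i)" "q \<in> tree_verts (ss ! i)" "g i p = g i q"
      then have "f (i # p) = f (i # q)" using gf by simp
      then show "p = q" using inj_onD[OF isosD(5)[OF f], of "i # p" "i # q"] pq i by simp
    qed
    have img: "g i ` tree_verts (ss ! i) = tree_verts (ts ! \<pi> i)"
    proof (intro equalityI subsetI)
      fix q assume q: "q \<in> tree_verts (ts ! \<pi> i)"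
      obtain k p where kp: "k < length ss" "p \<in> tree_verts (ss ! k)" "\<pi> k = \<pi> i" "tl (f (k # p)) = q"
        using lift[OF in_T(1)[OF i Nil_in_tree_verts] q] by blast
      then have "k = i" using \<pi>inj i by blast
      then show "q \<in> g i ` tree_verts (ss ! i)" using kp by (auto simp: g_def intro!: image_eqI[of _ _ p])
    qed (use in_T(2)[OF i] in \<open>auto simp: g_def\<close>)
    have "tree_adj (ss ! i) x y \<longleftrightarrow> tree_adj (ts ! \<pi> i) (g i x) (g i y)"
      if "x \<in> tree_verts (ss ! i)" "y \<in> tree_verts (ss ! i)" for x y
      using isosD(4)[OF f, of "i # x" "i # y"] that i in_T(1)[OF i Nil_in_tree_verts] by (simp add: gf)
    moreover have "g i [] = []" using f1[OF i] by (simp add: g_def)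
    ultimately show ?thesis using inj img by (auto simp: isos_def bij_betw_def g_def)
  qed
  have "h \<in> (\<Pi>\<^sub>E i\<in>{..<length ts}. orders (ts ! \<pi> i))"
    using gi len by (auto simp: h_def)
  moreover have "(?s, f) = assemble (length ts) \<pi> h"
  proof -
    have ss: "map (\<lambda>i. fst (h i)) [0..<length ts] = ss"
      using len by (intro nth_equalityI) (auto simp: h_def)
    have "f = (\<lambda>p\<in>tree_verts ?s. case p of [] \<Rightarrow> [] | i # q \<Rightarrow> \<pi> i # snd (h i) q)"
    proof (rule extensionalityI[OF isosD(3)[OF f]])
      fix x assume x: "x \<in> tree_verts ?s"
      then show "f x = (\<lambda>p\<in>tree_verts ?s. case p of [] \<Rightarrow> [] | i # q \<Rightarrow> \<pi> i # snd (h i) q) x"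
        using isosD(2)[OF f] fi len by (cases x) (auto simp: h_def g_def)
    qed auto
    then show ?thesis unfolding assemble_def Let_def ss by simp
  qed
  ultimately show ?thesis using \<pi>p len that[of \<pi> h] by (simp add: h_def)
qed

text \<open>Recursion at the root: one of \<open>fact d\<close> permutations, then an isomorphic
  plane copy of each branch. The number of copies is the same for every permutation, which only
  reorders the factors.\<close>

lemma card_orders: "finite (orders T) \<and> card (orders T) = orderings T"
proof (induction T)
  case (PNode ts)
  let ?d = "length ts"
  let ?D = "Sigma {\<pi>. \<pi> permutes {..<?d}} (\<lambda>\<pi>. \<Pi>\<^sub>E i\<in>{..<?d}. orders (ts ! \<pi> i))"
  have IH: "finite (orders (ts ! i))" "card (orders (ts ! i)) = orderings (ts ! i)" if "i < ?d" for i
    using PNode that by auto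
  have pd: "\<pi> i < ?d" if "\<pi> permutes {..<?d}" "i < ?d" for \<pi> i
    using permutes_in_image[OF that(1), of i] that(2) by simp
  have bij: "bij_betw (\<lambda>(\<pi>, h). assemble ?d \<pi> h) ?D (orders (PNode ts))"
    unfolding bij_betw_def
  proof
    show "inj_on (\<lambda>(\<pi>, h). assemble ?d \<pi> h) ?D"
      by (rule inj_onI) (use assemble_inj[of _ ts] in auto)
    show "(\<lambda>(\<pi>, h). assemble ?d \<pi> h) ` ?D = orders (PNode ts)"
    proof (intro equalityI subsetI)
      fix x assume "x \<in> (\<lambda>(\<pi>, h). assemble ?d \<pi> h) ` ?D"
      then obtain \<pi> h where p: "\<pi> permutes {..<?d}" and h: "h \<in> (\<Pi>\<^sub>E i\<in>{..<?d}. orders (ts ! \<pi> i))"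
        and x: "x = assemble ?d \<pi> h" by auto
      show "x \<in> orders (PNode ts)" unfolding x
        by (rule assemble_in_orders[OF p]) (use PiE_mem[OF h] in auto)
    next
      fix x assume x: "x \<in> orders (PNode ts)"
      obtain s f where sf: "x = (s, f)" by (cases x)
      obtain ss where s: "s = PNode ss" by (cases s)
      have "f \<in> tree_isos (PNode ss) (PNode ts)" using x sf s by simp
      then obtain \<pi> h where ph: "\<pi> permutes {..<?d}" "h \<in> (\<Pi>\<^sub>E i\<in>{..<?d}. orders (ts ! \<pi> i))"
        "(PNode ss, f) = assemble ?d \<pi> h" by (rule orders_decompose)
      have "(\<pi>, h) \<in> ?D" using ph(1,2) by blast
      then show "x \<in> (\<lambda>(\<pi>, h). assemble ?d \<pi> h) ` ?D"
        by (rule rev_image_eqI) (simp add: sf s ph(3))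
    qed
  qed
  have fin: "finite (\<Pi>\<^sub>E i\<in>{..<?d}. orders (ts ! \<pi> i))" if "\<pi> permutes {..<?d}" for \<pi>
    by (rule finite_PiE) (use IH pd[OF that] in auto)
  have "card ?D = (\<Sum>\<pi>\<in>{\<pi>. \<pi> permutes {..<?d}}. card (\<Pi>\<^sub>E i\<in>{..<?d}. orders (ts ! \<pi> i)))"
    by (rule card_SigmaI) (use fin finite_permutations in auto)
  also have "\<dots> = (\<Sum>\<pi>\<in>{\<pi>. \<pi> permutes {..<?d}}. \<Prod>i<?d. orderings (ts ! i))"
  proof (rule sum.cong[OF refl])
    fix \<pi> assume "\<pi> \<in> {\<pi>. \<pi> permutes {..<?d}}"
    then have p: "\<pi> permutes {..<?d}" by simp
    have "card (\<Pi>\<^sub>E i\<in>{..<?d}. orders (ts ! \<pi> i)) = (\<Prod>i<?d. orderings (ts ! \<pi> i))"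
      using IH pd[OF p] by (simp add: card_PiE)
    also have "\<dots> = (\<Prod>i<?d. orderings (ts ! i))"
      using prod.permute[OF p, of "\<lambda>i. orderings (ts ! i)"] by (simp add: comp_def)
    finally show "card (\<Pi>\<^sub>E i\<in>{..<?d}. orders (ts ! \<pi> i)) = (\<Prod>i<?d. orderings (ts ! i))" .
  qed
  also have "\<dots> = fact ?d * (\<Prod>i<?d. orderings (ts ! i))"
    by (simp add: card_permutations)
  also have "\<dots> = orderings (PNode ts)"
    by (simp add: prod.list_conv_set_nth atLeast0LessThan)
  finally have "card ?D = orderings (PNode ts)" .
  moreover have "finite ?D" using fin finite_permutations by (intro finite_SigmaI) auto
  ultimately show ?case using bij_betw_same_card[OF bij] bij_betw_finite[OF bij] by simp
qed

lemma orderings_iso: "f \<in> tree_isos s T \<Longrightarrow> orderings s = orderings T"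
proof (induction T arbitrary: s f)
  case (PNode ts)
  obtain ss where s: "s = PNode ss" by (cases s)
  obtain \<pi> h where p: "\<pi> permutes {..<length ts}"
    and h: "h \<in> (\<Pi>\<^sub>E i\<in>{..<length ts}. orders (ts ! \<pi> i))" and len: "length ss = length ts"
    and hs: "\<And>i. i < length ts \<Longrightarrow> fst (h i) = ss ! i"
    by (rule orders_decompose[OF PNode.prems[unfolded s]]) blast
  have "orderings (ss ! i) = orderings (ts ! \<pi> i)" if "i < length ts" for i
  proof -
    have "snd (h i) \<in> tree_isos (ss ! i) (ts ! \<pi> i)" using PiE_mem[OF h, of i] hs[OF that] that by auto
    moreover have "ts ! \<pi> i \<in> set ts" using permutes_in_image[OF p, of i] that by auto
    ultimately show ?thesis using PNode.IH by blast
  qed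
  then have "(\<Prod>i<length ts. orderings (ss ! i)) = (\<Prod>i<length ts. orderings (ts ! \<pi> i))" by simp
  also have "\<dots> = (\<Prod>i<length ts. orderings (ts ! i))"
    using prod.permute[OF p, of "\<lambda>i. orderings (ts ! i)"] by (simp add: comp_def)
  finally show ?case unfolding s by (simp add: prod.list_conv_set_nth atLeast0LessThan len)
qed

section \<open>Passing from \<open>N - m\<close> to \<open>N\<close> particles, and limits for
  isolated sets\<close>

text \<open>Each of the \<open>m\<close> steps costs at most \<open>(2 + C) / sqrt N\<close>, by
  \<open>almost_convex_increment\<close> with convexity defect \<open>C / N\<close> and
  \<open>L\<close> of order \<open>sqrt N\<close>, which balances \<open>1 / L\<close> against
  \<open>C * L / N\<close>. The bound is uniform in \<open>\<alpha>\<close> and \<open>h\<close>,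
  both of which will vary with \<open>N\<close>.\<close>

lemma gel_mean_stable:
  assumes t: "0 \<le> t"
  obtains \<epsilon> :: "nat \<Rightarrow> real" where "\<epsilon> \<longlonglongrightarrow> 0"
    and "\<And>N \<alpha> h. 0 < N \<Longrightarrow> 2 < \<alpha> \<Longrightarrow> h \<in> borel_measurable borel \<Longrightarrow> (\<And>w. 0 \<le> h w \<and> h w \<le> 1) \<Longrightarrow>
      \<bar>gel_mean (1 / real N) \<alpha> t (N - m) h - gel_mean (1 / real N) \<alpha> t N h\<bar> \<le> \<epsilon> N"
proof -
  \<comment> \<open>Bounds \<open>N\<close> times the sum of the two errors in
    \<open>gel_mean_almost_convex\<close>, for \<open>\<kappa> = t / N\<close> and particle numbers
    between \<open>N / 2\<close> and \<open>2 * N\<close>.\<close>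
  define C where "C = (3 * t + 2) * exp (3 * t)"
  \<comment> \<open>Large enough that windows of radius \<open>L\<close> around the indices in
    question stay between \<open>N / 2\<close> and \<open>2 * N\<close>; for smaller
    \<open>N\<close> the trivial bound 1 is used.\<close>
  define N0 where "N0 = 4 * m + 100"
  define \<epsilon> where "\<epsilon> N = (if N < N0 then 1 else real m * ((2 + C) / sqrt (real N)))" for N
  have C0: "0 \<le> C" using t by (simp add: C_def)
  have "(\<lambda>N. real m * ((2 + C) / sqrt (real N))) \<longlonglongrightarrow> 0" by real_asymp
  moreover have "eventually (\<lambda>N. real m * ((2 + C) / sqrt (real N)) = \<epsilon> N) sequentially"
    using eventually_ge_at_top[of N0] by eventually_elim (simp add: \<epsilon>_def)
  ultimately have "\<epsilon> \<longlonglongrightarrow> 0" by (rule Lim_transform_eventually)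
  moreover have "\<bar>gel_mean (1 / real N) \<alpha> t (N - m) h - gel_mean (1 / real N) \<alpha> t N h\<bar> \<le> \<epsilon> N"
    if N: "0 < N" and \<alpha>: "2 < \<alpha>" and h: "h \<in> borel_measurable borel" and h01: "\<And>w. 0 \<le> h w \<and> h w \<le> 1"
    for N \<alpha> h
  proof -
    define G where "G k = gel_mean (1 / real N) \<alpha> t k h" for k
    have G01: "0 \<le> G k" "G k \<le> 1" for k
      unfolding G_def using h01 N t h by (auto intro!: gel_mean_bounds)
    show ?thesis
    proof (cases "N < N0")
      case True
      then show ?thesis using G01[of "N - m"] G01[of N] by (simp add: \<epsilon>_def G_def abs_le_iff)
    next
      case False
      define L where "L = nat \<lfloor>sqrt (real N)\<rfloor>"
      have N100: "100 \<le> N" "4 * m + 100 \<le> N" using False by (simp_all add: N0_def)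
      have sq10: "10 \<le> sqrt (real N)" using N100 by (intro real_le_rsqrt) simp
      have L_up: "real L \<le> sqrt (real N)" using sq10 by (simp add: L_def)
      have L_lo: "sqrt (real N) / 2 \<le> real L" using sq10 unfolding L_def by linarith
      have "10 * sqrt (real N) \<le> sqrt (real N) * sqrt (real N)" using sq10 by (intro mult_right_mono) auto
      then have sqN: "10 * real L \<le> real N" using L_up by simp
      have inc: "\<bar>G (k + 1) - G k\<bar> \<le> (2 + C) / sqrt (real N)" if k: "N - m \<le> k" "k < N" for k
      proof -
        have "\<bar>G (k + 1) - G k\<bar> \<le> 1 / real L + C / real N * real L"
        proof (rule almost_convex_increment[where L = L])
          show "0 < L" using L_lo sq10 by simp
          show "L \<le> k" using sqN k N100 by linarith
          fix j assume j: "k - L \<le> j" "j \<le> k + L"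
          have jN: "real N / 2 \<le> real (j + 2)" "real (j + 2) \<le> 2 * real N" using j k sqN N100 by linarith+
          let ?\<kappa> = "1 / real N * t"
          have "- (C / real N) \<le> - ((exp (3 * ?\<kappa>) - 1) + exp (?\<kappa> + ?\<kappa> * real (j + 2)) / real (j + 2))"
          proof -
            have \<kappa>: "0 \<le> ?\<kappa>" "?\<kappa> \<le> t" using t N by (auto simp: field_simps mult_le_cancel_left1)
            have "1 - 3 * ?\<kappa> \<le> exp (- (3 * ?\<kappa>))" using exp_ge_add_one_self[of "- (3 * ?\<kappa>)"] by simp
            then have "(1 - 3 * ?\<kappa>) * exp (3 * ?\<kappa>) \<le> exp (- (3 * ?\<kappa>)) * exp (3 * ?\<kappa>)" by (intro mult_right_mono) auto
            then have "exp (3 * ?\<kappa>) - 1 \<le> 3 * ?\<kappa> * exp (3 * ?\<kappa>)" by (simp add: mult_exp_exp algebra_simps)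
            also have "\<dots> \<le> 3 * ?\<kappa> * exp (3 * t)" using \<kappa> by (intro mult_left_mono) auto
            finally have a: "exp (3 * ?\<kappa>) - 1 \<le> 3 * t * exp (3 * t) / real N" by simp
            have "?\<kappa> * real (j + 2) \<le> ?\<kappa> * (2 * real N)" using jN \<kappa> by (intro mult_left_mono) auto
            then have "?\<kappa> + ?\<kappa> * real (j + 2) \<le> 3 * t" using \<kappa> N by simp
            then have "exp (?\<kappa> + ?\<kappa> * real (j + 2)) / real (j + 2) \<le> exp (3 * t) / (real N / 2)"
              using jN N by (intro frac_le) auto
            moreover have "C / real N = 3 * t * exp (3 * t) / real N + exp (3 * t) / (real N / 2)"
              using N by (simp add: C_def field_simps)
            ultimately show ?thesis using a by linarith
          qed
          also have "\<dots> \<le> G (j + 2) - 2 * G (j + 1) + G j"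
            using gel_mean_almost_convex[of \<alpha> "1 / real N" t "j + 2" h] \<alpha> N t h h01 by (simp add: G_def)
          finally show "- (C / real N) \<le> G (j + 2) - 2 * G (j + 1) + G j" .
        qed (use G01 C0 in auto)
        also have "\<dots> \<le> 1 / (sqrt (real N) / 2) + C / real N * sqrt (real N)"
          using L_up L_lo sq10 C0 N by (intro add_mono frac_le mult_left_mono) auto
        also have "\<dots> = (2 + C) / sqrt (real N)"
          using N by (simp add: field_simps)
        finally show ?thesis .
      qed
      define D where "D = (2 + C) / sqrt (real N)"
      have "\<bar>G (N - m) - G (N - m + i)\<bar> \<le> real i * D" if "i \<le> m" for i
        using that
      proof (induction i)
        case (Suc i)
        have 1: "\<bar>G (N - m + Suc i) - G (N - m + i)\<bar> \<le> D"
          using inc[of "N - m + i"] Suc.prems N100 by (simp add: D_def)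
        have 2: "\<bar>G (N - m) - G (N - m + i)\<bar> \<le> real i * D" using Suc by simp
        have "real (Suc i) * D = D + real i * D" by (simp add: ring_distribs)
        then show ?case using 1 2 by linarith
      qed simp
      from this[of m] show ?thesis using False N100 by (simp add: \<epsilon>_def G_def D_def)
    qed
  qed
  ultimately show ?thesis using that by blast
qed

text \<open>The value in \<open>gel_mean_isolated\<close>, common to all sets of \<open>m\<close>
  particles and all choices of \<open>k\<close> links inside; \<open>m choose 2\<close> is the
  number of pairs inside such a set.\<close>

definition iso_mean :: "real \<Rightarrow> real \<Rightarrow> real \<Rightarrow> nat \<Rightarrow> nat \<Rightarrow> nat \<Rightarrow> (real \<Rightarrow> real) \<Rightarrow> real" where
  "iso_mean \<rho> \<alpha> t K m k \<psi> = (1 - exp (- \<rho> * t)) ^ k * exp (- \<rho> * t) ^ ((m choose 2) - k) *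
     gel_mean \<rho> \<alpha> t (K - m) (\<lambda>w. exp (- real m * (\<rho> * real (K - m) * t - w)) * \<psi> w)"

lemma card_prs: "finite A \<Longrightarrow> card (prs A) = card A choose 2"
proof -
  assume A: "finite A"
  have "bij_betw (\<lambda>(i, j). {i, j}) (prs A) {B. B \<subseteq> A \<and> card B = 2}"
    unfolding bij_betw_def
  proof
    show "inj_on (\<lambda>(i, j). {i, j}) (prs A)"
      by (auto simp: inj_on_def prs_def doubleton_eq_iff)
    show "(\<lambda>(i, j). {i, j}) ` prs A = {B. B \<subseteq> A \<and> card B = 2}"
    proof (intro equalityI subsetI)
      fix B assume "B \<in> {B. B \<subseteq> A \<and> card B = 2}"
      then obtain x y where "B = {x, y}" "x \<noteq> y" "x \<in> A" "y \<in> A" by (auto simp: card_2_iff)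
      then show "B \<in> (\<lambda>(i, j). {i, j}) ` prs A"
        by (intro image_eqI[of _ _ "(min x y, max x y)"]) (auto simp: prs_def min_def max_def)
    qed (auto simp: prs_def)
  qed
  then show ?thesis using n_subsets[OF A, of 2] by (simp add: bij_betw_same_card)
qed

lemma gel_mean_touching:
  fixes \<psi> :: "real \<Rightarrow> real"
  assumes "A \<subseteq> {..<K}" "card A = m" "real m < \<alpha>" "H \<subseteq> prs A" "card H = k" "0 < \<rho>" "0 \<le> t"
    and "\<psi> \<in> borel_measurable borel" "\<And>w. \<bar>\<psi> w\<bar> \<le> C"
  shows "(\<integral>e. of_bool (touching A (lk \<alpha> (prs {..<K}) e t) = H) * \<psi> (gelled \<rho> \<alpha> {..<K} t e) \<partial>clocks \<rho> (prs {..<K})) =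
    iso_mean \<rho> \<alpha> t K m k \<psi>"
  using gel_mean_isolated[OF assms(1-5) card_prs[of A] assms(6-9)] assms(1,2) finite_subset[OF assms(1)]
  by (simp add: iso_mean_def)

text \<open>Replacing \<open>\<rho> * (N - m) * t\<close> by \<open>t\<close> in the exponent costs
  a factor \<open>exp (m ^ 2 * t / N)\<close>, which tends to 1, as does the factor of the missing
  links. The change in the number of particles remains, and \<open>gel_mean_stable\<close> removes
  it. Truncating \<open>w\<close> at \<open>t\<close> keeps the test function in
  \<open>[0, 1]\<close> outside the range of the gelled time as well.\<close>

lemma iso_mean_limit:
  fixes \<alpha> :: "nat \<Rightarrow> real" and \<psi> :: "nat \<Rightarrow> real \<Rightarrow> real"
  assumes \<alpha>: "filterlim \<alpha> at_top sequentially" and t: "0 \<le> t"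
    and \<psi>: "\<And>N. \<psi> N \<in> borel_measurable borel" and \<psi>01: "\<And>N w. 0 \<le> \<psi> N w \<and> \<psi> N w \<le> 1"
    and c: "(\<lambda>N. real N ^ (m - 1) * (1 - exp (- (1 / real N) * t)) ^ k) \<longlonglongrightarrow> c"
  shows "(\<lambda>N. real N ^ (m - 1) * iso_mean (1 / real N) (\<alpha> N) t N m k (\<psi> N) -
      c * gel_mean (1 / real N) (\<alpha> N) t N (\<lambda>w. exp (- real m * (t - min w t)) * \<psi> N w)) \<longlonglongrightarrow> 0"
proof -
  define h where "h N w = exp (- real m * (t - min w t)) * \<psi> N w" for N w
  obtain \<epsilon> where \<epsilon>: "\<epsilon> \<longlonglongrightarrow> 0" and stable: "\<And>N \<alpha> h. 0 < N \<Longrightarrow> 2 < \<alpha> \<Longrightarrow> h \<in> borel_measurable borel \<Longrightarrow>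
      (\<And>w. 0 \<le> h w \<and> h w \<le> 1) \<Longrightarrow>
      \<bar>gel_mean (1 / real N) \<alpha> t (N - m) h - gel_mean (1 / real N) \<alpha> t N h\<bar> \<le> \<epsilon> N"
    using gel_mean_stable[OF t] by blast
  have hm: "h N \<in> borel_measurable borel" for N
    unfolding h_def[abs_def] using \<psi>[of N] by measurable
  have h01: "0 \<le> h N w \<and> h N w \<le> 1" for N w
  proof -
    have "exp (- real m * (t - min w t)) * \<psi> N w \<le> 1 * 1"
      using \<psi>01[of N w] by (intro mult_mono) auto
    then show ?thesis using \<psi>01[of N w] by (simp add: h_def)
  qed
  define G where "G N k = gel_mean (1 / real N) (\<alpha> N) t k (h N)" for N k
  define cN where "cN N = real N ^ (m - 1) * (1 - exp (- (1 / real N) * t)) ^ k *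
      (exp (- (1 / real N) * t) ^ ((m choose 2) - k) * exp ((real m)\<^sup>2 * t / real N))" for N
  have "cN \<longlonglongrightarrow> c * (1 ^ ((m choose 2) - k) * 1)"
    unfolding cN_def
    by (intro tendsto_mult[OF c] tendsto_mult tendsto_power) real_asymp+
  then have cN: "cN \<longlonglongrightarrow> c" by simp
  have ev: "eventually (\<lambda>N. 2 < \<alpha> N \<and> 0 < N \<and> m \<le> N) sequentially"
    using filterlim_at_top_dense[THEN iffD1, OF \<alpha>, rule_format, of 2]
      eventually_gt_at_top[of 0] eventually_ge_at_top[of m] by eventually_elim auto
  have eq: "eventually (\<lambda>N. real N ^ (m - 1) * iso_mean (1 / real N) (\<alpha> N) t N m k (\<psi> N) = cN N * G N (N - m)) sequentially"
    using ev
  proof eventually_elim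
    case (elim N)
    have "gel_mean (1 / real N) (\<alpha> N) t (N - m) (\<lambda>w. exp (- real m * ((1 / real N) * real (N - m) * t - w)) * \<psi> N w)
       = gel_mean (1 / real N) (\<alpha> N) t (N - m) (\<lambda>w. exp ((real m)\<^sup>2 * t / real N) * h N w)"
    proof (rule gel_mean_cong)
      fix w assume w: "0 \<le> w" "w \<le> 1 / real N * real (N - m) * t"
      have "1 / real N * real (N - m) * t \<le> 1 * t" using t elim by (intro mult_right_mono) auto
      then have "min w t = w" using w by simp
      moreover have "- real m * ((1 / real N) * real (N - m) * t - w) = (real m)\<^sup>2 * t / real N + - real m * (t - w)"
        using elim by (simp add: of_nat_diff field_simps power2_eq_square)
      ultimately show "exp (- real m * ((1 / real N) * real (N - m) * t - w)) * \<psi> N w = exp ((real m)\<^sup>2 * t / real N) * h N w"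
        unfolding h_def by (simp only: exp_add mult.assoc)
    qed (use elim t in auto)
    then show ?case by (simp add: iso_mean_def cN_def G_def gel_mean_cmult)
  qed
  have G01: "eventually (\<lambda>N. norm (G N (N - m)) \<le> 1) sequentially"
    using ev
  proof eventually_elim
    case (elim N)
    have "0 \<le> G N (N - m)" "G N (N - m) \<le> 1"
      unfolding G_def using h01 hm elim t by (auto intro!: gel_mean_bounds)
    then show ?case by simp
  qed
  have d: "(\<lambda>N. G N (N - m) - G N N) \<longlonglongrightarrow> 0"
  proof (rule Lim_null_comparison[OF _ \<epsilon>])
    show "eventually (\<lambda>N. norm (G N (N - m) - G N N) \<le> \<epsilon> N) sequentially"
      using ev by eventually_elim (use stable hm h01 in \<open>auto simp: G_def\<close>)
  qed
  have "(\<lambda>N. cN N - c) \<longlonglongrightarrow> 0" using tendsto_diff[OF cN tendsto_const[of c]] by simp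
  then have "(\<lambda>N. (cN N - c) * G N (N - m)) \<longlonglongrightarrow> 0"
    by (rule lim_null_mult_right_bounded[OF _ G01])
  then have "(\<lambda>N. (cN N - c) * G N (N - m) + c * (G N (N - m) - G N N)) \<longlonglongrightarrow> 0 + c * 0"
    using d by (intro tendsto_intros)
  then have "(\<lambda>N. cN N * G N (N - m) - c * G N N) \<longlonglongrightarrow> 0" by (simp add: algebra_simps)
  moreover have "eventually (\<lambda>N. cN N * G N (N - m) - c * G N N = real N ^ (m - 1) * iso_mean (1 / real N) (\<alpha> N) t N m k (\<psi> N) -
      c * gel_mean (1 / real N) (\<alpha> N) t N (\<lambda>w. exp (- real m * (t - min w t)) * \<psi> N w)) sequentially"
    using eq by eventually_elim (simp add: G_def h_def[abs_def])
  ultimately show ?thesis by (rule Lim_transform_eventually)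
qed

lemma tree_rate_limit: "(\<lambda>N. real N ^ (m - 1) * (1 - exp (- (1 / real N) * t)) ^ (m - 1)) \<longlonglongrightarrow> t ^ (m - 1)"
proof -
  have "(\<lambda>N. real N * (1 - exp (- (1 / real N) * t))) \<longlonglongrightarrow> t" by real_asymp
  then show ?thesis by (subst power_mult_distrib[symmetric]) (rule tendsto_power)
qed

text \<open>Each link costs a factor of order \<open>1/N\<close>, and the power
  \<open>N ^ (m - 1)\<close> pays only for the links of a tree. Components with a cycle therefore
  vanish in the limit.\<close>

lemma excess_rate_limit:
  assumes "m \<le> k" "0 < m" shows "(\<lambda>N. real N ^ (m - 1) * (1 - exp (- (1 / real N) * t)) ^ k) \<longlonglongrightarrow> 0"
proof -
  define j where "j = k - m"
  have k: "k = (m - 1) + Suc j" using assms by (simp add: j_def)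
  have "(\<lambda>N. 1 - exp (- (1 / real N) * t)) \<longlonglongrightarrow> 0" by real_asymp
  then have "(\<lambda>N. real N ^ (m - 1) * (1 - exp (- (1 / real N) * t)) ^ (m - 1) * (1 - exp (- (1 / real N) * t)) ^ Suc j)
     \<longlonglongrightarrow> t ^ (m - 1) * 0 ^ Suc j"
    by (intro tendsto_mult tree_rate_limit tendsto_power)
  then show ?thesis unfolding k power_add by (simp add: mult_ac)
qed

section \<open>Isomorphisms from plane trees onto arbitrary rooted graphs\<close>

lemma finite_isos: "finite V \<Longrightarrow> finite (isos s V R r)"
proof (rule finite_subset)
  show "isos s V R r \<subseteq> (\<Pi>\<^sub>E x\<in>tree_verts s. V)"
  proof
    fix f assume f: "f \<in> isos s V R r"
    show "f \<in> (\<Pi>\<^sub>E x\<in>tree_verts s. V)" by (simp add: PiE_def Pi_def isosD(3)[OF f] isosD(7)[OF f])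
  qed
  show "finite V \<Longrightarrow> finite (\<Pi>\<^sub>E x\<in>tree_verts s. V)" by (rule finite_PiE) auto
qed

lemma card_isos_eq:
  assumes "rooted_iso V R r V' R' r'"
  shows "card (isos s V R r) = card (isos s V' R' r')"
proof -
  obtain g where g: "bij_betw g V V'" "r \<in> V" "g r = r'"
    "\<And>x y. x \<in> V \<Longrightarrow> y \<in> V \<Longrightarrow> R x y \<longleftrightarrow> R' (g x) (g y)"
    using assms unfolding rooted_iso_def by blast
  let ?k = "inv_into V g"
  have k: "bij_betw ?k V' V" using g(1) by (rule bij_betw_inv_into)
  have gk: "g (?k y) = y" if "y \<in> V'" for y using bij_betw_inv_into_right[OF g(1) that] .
  have kg: "?k (g x) = x" if "x \<in> V" for x using bij_betw_inv_into_left[OF g(1) that] .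
  have gV: "g x \<in> V'" if "x \<in> V" for x using bij_betwE[OF g(1)] that by blast
  have kV: "?k y \<in> V" if "y \<in> V'" for y using bij_betwE[OF k] that by blast
  have "bij_betw (\<lambda>f. \<lambda>x\<in>tree_verts s. g (f x)) (isos s V R r) (isos s V' R' r')"
  proof (rule bij_betw_byWitness[where f' = "\<lambda>f. \<lambda>x\<in>tree_verts s. ?k (f x)"])
    show "\<forall>f\<in>isos s V R r. (\<lambda>x\<in>tree_verts s. ?k ((\<lambda>x\<in>tree_verts s. g (f x)) x)) = f"
    proof
      fix f assume f: "f \<in> isos s V R r"
      show "(\<lambda>x\<in>tree_verts s. ?k ((\<lambda>x\<in>tree_verts s. g (f x)) x)) = f"
        by (rule extensionalityI[of _ "tree_verts s"]) (use isosD(3,7)[OF f] kg in auto)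
    qed
    show "\<forall>f\<in>isos s V' R' r'. (\<lambda>x\<in>tree_verts s. g ((\<lambda>x\<in>tree_verts s. ?k (f x)) x)) = f"
    proof
      fix f assume f: "f \<in> isos s V' R' r'"
      show "(\<lambda>x\<in>tree_verts s. g ((\<lambda>x\<in>tree_verts s. ?k (f x)) x)) = f"
        by (rule extensionalityI[of _ "tree_verts s"]) (use isosD(3,7)[OF f] gk in auto)
    qed
    show "(\<lambda>f. \<lambda>x\<in>tree_verts s. g (f x)) ` isos s V R r \<subseteq> isos s V' R' r'"
    proof clarify
      fix f assume f: "f \<in> isos s V R r"
      have "bij_betw (g \<circ> f) (tree_verts s) V'" using bij_betw_trans[OF isosD(1)[OF f] g(1)] .
      then have "bij_betw (\<lambda>x\<in>tree_verts s. g (f x)) (tree_verts s) V'" by (simp add: bij_betw_restrict_eq comp_def)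
      then show "(\<lambda>x\<in>tree_verts s. g (f x)) \<in> isos s V' R' r'"
        using isosD(2,4,7)[OF f] g(3,4) by (auto simp: isos_def)
    qed
    show "(\<lambda>f. \<lambda>x\<in>tree_verts s. ?k (f x)) ` isos s V' R' r' \<subseteq> isos s V R r"
    proof clarify
      fix f assume f: "f \<in> isos s V' R' r'"
      have "bij_betw (?k \<circ> f) (tree_verts s) V" using bij_betw_trans[OF isosD(1)[OF f] k] .
      then have b: "bij_betw (\<lambda>x\<in>tree_verts s. ?k (f x)) (tree_verts s) V" by (simp add: bij_betw_restrict_eq comp_def)
      have "tree_adj s x y \<longleftrightarrow> R (?k (f x)) (?k (f y))" if "x \<in> tree_verts s" "y \<in> tree_verts s" for x y
        using isosD(4)[OF f that] isosD(7)[OF f that(1)] isosD(7)[OF f that(2)] g(4)[of "?k (f x)" "?k (f y)"]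
        by (simp add: gk kV)
      then show "(\<lambda>x\<in>tree_verts s. ?k (f x)) \<in> isos s V R r"
        using b isosD(2)[OF f] g(2,3) kg[of r] by (auto simp: isos_def)
    qed
  qed
  then show ?thesis by (rule bij_betw_same_card)
qed

abbreviation shape_class :: "ptree \<Rightarrow> ptree set" where
  "shape_class T \<equiv> {s. rooted_iso (tree_verts s) (tree_adj s) [] (tree_verts T) (tree_adj T) []}"

lemma finite_shape_class: "finite (shape_class T)"
proof -
  have "shape_class T = fst ` orders T" unfolding rooted_iso_iff_isos by force
  then show ?thesis using card_orders[of T] by simp
qed

lemma shape_class_invariants:
  assumes "s \<in> shape_class T"
  shows "orderings s = orderings T" "tree_size s = tree_size T"
proof -
  obtain f where f: "f \<in> tree_isos s T" using assms by (auto simp: rooted_iso_iff_isos)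
  show "orderings s = orderings T" by (rule orderings_iso[OF f])
  show "tree_size s = tree_size T" using bij_betw_same_card[OF isosD(1)[OF f]] by (simp add: card_tree_verts)
qed

text \<open>Numbers of isomorphisms may be computed with \<open>T\<close> itself as target, where
  \<open>card_orders\<close> counts all pairs of a plane tree and an isomorphism. Summing over plane
  representatives with weight \<open>1 / orderings\<close> thus counts every graph of shape
  \<open>T\<close> exactly once.\<close>

lemma sum_isos_shape_class:
  assumes "rooted_iso (tree_verts T) (tree_adj T) [] V R r"
  shows "(\<Sum>s\<in>shape_class T. real (card (isos s V R r)) / real (orderings s)) = 1"
proof -
  have "orders T = Sigma (shape_class T) (\<lambda>s. tree_isos s T)" unfolding rooted_iso_iff_isos by auto
  then have "card (orders T) = (\<Sum>s\<in>shape_class T. card (tree_isos s T))"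
    using finite_shape_class finite_isos[of "tree_verts T"] by (simp add: card_SigmaI)
  then have "(\<Sum>s\<in>shape_class T. real (card (tree_isos s T))) = real (orderings T)"
    using card_orders[of T] by simp
  moreover have "(\<Sum>s\<in>shape_class T. real (card (isos s V R r)) / real (orderings s)) =
     (\<Sum>s\<in>shape_class T. real (card (tree_isos s T)) / real (orderings T))"
    by (rule sum.cong) (use shape_class_invariants card_isos_eq[OF assms] in auto)
  ultimately show ?thesis using orderings_pos[of T] by (simp add: sum_divide_distrib[symmetric])
qed

text \<open>A rooted graph belongs to at most one shape class, and the terms outside that class
  vanish.\<close>

lemma sum_isos_le_1:
  assumes "finite F"
  shows "(\<Sum>s\<in>F. real (card (isos s V R r)) / real (orderings s)) \<le> 1"
proof (cases "\<exists>T\<in>F. isos T V R r \<noteq> {}")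
  case True
  then obtain T where T: "T \<in> F" "rooted_iso (tree_verts T) (tree_adj T) [] V R r"
    by (auto simp: rooted_iso_iff_isos)
  have empty: "isos s V R r = {}" if "s \<notin> shape_class T" for s
  proof (rule ccontr)
    assume "isos s V R r \<noteq> {}"
    then have "rooted_iso (tree_verts s) (tree_adj s) [] V R r" by (simp add: rooted_iso_iff_isos)
    from rooted_iso_trans[OF this rooted_iso_sym[OF T(2)]] show False using that by simp
  qed
  have 0: "real (card (isos s V R r)) / real (orderings s) = 0" if "s \<notin> shape_class T" for s
    unfolding empty[OF that] by simp
  have "(\<Sum>s\<in>F. real (card (isos s V R r)) / real (orderings s)) =
     (\<Sum>s\<in>F \<inter> shape_class T. real (card (isos s V R r)) / real (orderings s))"
  proof (rule sum.mono_neutral_right[OF assms])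
    show "\<forall>s\<in>F - F \<inter> shape_class T. real (card (isos s V R r)) / real (orderings s) = 0"
    proof
      fix s assume "s \<in> F - F \<inter> shape_class T"
      then have "s \<notin> shape_class T" by simp
      then show "real (card (isos s V R r)) / real (orderings s) = 0" by (rule 0)
    qed
  qed (rule Int_lower1)
  also have "\<dots> \<le> (\<Sum>s\<in>shape_class T. real (card (isos s V R r)) / real (orderings s))"
    by (rule sum_mono2[OF finite_shape_class Int_lower2]) simp
  finally show ?thesis unfolding sum_isos_shape_class[OF T(2)] .
next
  case False
  then have "(\<Sum>s\<in>F. real (card (isos s V R r)) / real (orderings s)) = (\<Sum>s\<in>F. 0)"
    by (intro sum.cong) auto
  then show ?thesis by simp
qed

text \<open>Every vertex contributes \<open>exp (- lam)\<close>, every vertex but the root a factor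
  \<open>lam\<close> through the offspring number of its parent, and the factorials multiply to
  \<open>orderings\<close>.\<close>

lemma gw_plane_prob_poisson:
  "gw_plane_prob (poisson_p lam) s = lam ^ (tree_size s - 1) * exp (- lam * real (tree_size s)) / real (orderings s)"
proof (induction s)
  case (PNode ts)
  have "lam ^ length xs * prod_list (map (gw_plane_prob (poisson_p lam)) xs) =
      lam ^ sum_list (map tree_size xs) * exp (- lam * real (sum_list (map tree_size xs))) / real (prod_list (map orderings xs))"
    if "set xs \<subseteq> set ts" for xs
    using that
  proof (induction xs)
    case (Cons x xs)
    have "lam * gw_plane_prob (poisson_p lam) x = lam ^ tree_size x * exp (- lam * real (tree_size x)) / real (orderings x)"
      using PNode.IH[of x] Cons.prems tree_size_pos[of x] by (cases "tree_size x") auto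
    then have "(lam * gw_plane_prob (poisson_p lam) x) * (lam ^ length xs * prod_list (map (gw_plane_prob (poisson_p lam)) xs)) =
      (lam ^ tree_size x * exp (- lam * real (tree_size x)) / real (orderings x)) *
      (lam ^ sum_list (map tree_size xs) * exp (- lam * real (sum_list (map tree_size xs))) / real (prod_list (map orderings xs)))"
      using Cons by simp
    then show ?case by (simp add: power_add exp_add[symmetric] ring_distribs mult_ac exp_diff)
  qed simp
  note * = this[OF subset_refl]
  have "gw_plane_prob (poisson_p lam) (PNode ts) =
      exp (- lam) / fact (length ts) * (lam ^ length ts * prod_list (map (gw_plane_prob (poisson_p lam)) ts))"
    by (simp add: poisson_p_def[of lam "length ts"])
  then show ?case unfolding * by (simp add: field_simps exp_diff exp_minus exp_add)
qed

subsection \<open>The exponential generating function of plane trees diverges beyond \<open>1/e\<close>\<close>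

text \<open>A finite exhaustion of the plane trees. One index bounds both height and numbers of
  children, so that the recursion for the weights is a truncated exponential series.\<close>

primrec tree_level :: "nat \<Rightarrow> ptree set" where
  "tree_level 0 = {}"
| "tree_level (Suc n) = PNode ` {ts. set ts \<subseteq> tree_level n \<and> length ts \<le> n}"

lemma finite_tree_level: "finite (tree_level n)"
  by (induction n) (auto simp: finite_lists_length_le)

lemma tree_level_mono: "tree_level n \<subseteq> tree_level (Suc n)"
proof (induction n)
  case (Suc n)
  show ?case
  proof
    fix s assume "s \<in> tree_level (Suc n)"
    then obtain ts where "s = PNode ts" "set ts \<subseteq> tree_level n" "length ts \<le> n" by auto
    moreover have "tree_level n \<subseteq> tree_level (Suc n)" by (rule Suc.IH)
    ultimately have "s = PNode ts" "set ts \<subseteq> tree_level (Suc n)" "length ts \<le> Suc n" by auto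
    then show "s \<in> tree_level (Suc (Suc n))" unfolding tree_level.simps(2)[of "Suc n"] by blast
  qed
qed simp

lemma sum_lists_prod:
  fixes f :: "'a \<Rightarrow> real"
  assumes "finite F"
  shows "(\<Sum>ts\<in>{ts. set ts \<subseteq> F \<and> length ts = k}. prod_list (map f ts)) = (\<Sum>s\<in>F. f s) ^ k"
proof (induction k)
  case 0
  have "{ts. set ts \<subseteq> F \<and> length ts = 0} = {[]}" by auto
  then show ?case by simp
next
  case (Suc k)
  have "(\<Sum>ts\<in>{ts. set ts \<subseteq> F \<and> length ts = Suc k}. prod_list (map f ts)) =
     (\<Sum>(s, ts)\<in>F \<times> {ts. set ts \<subseteq> F \<and> length ts = k}. f s * prod_list (map f ts))"
    by (rule sum.reindex_bij_witness[where i = "\<lambda>(s, ts). s # ts" and j = "\<lambda>ts. (hd ts, tl ts)"])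
      (auto simp: length_Suc_conv)
  also have "\<dots> = (\<Sum>s\<in>F. f s) * (\<Sum>ts\<in>{ts. set ts \<subseteq> F \<and> length ts = k}. prod_list (map f ts))"
    by (simp add: sum.cartesian_product[symmetric] sum_product)
  finally show ?case using Suc by simp
qed

text \<open>Bounded partial sums would converge to some \<open>l > 0\<close> with
  \<open>x * exp l \<le> l\<close>. Since \<open>exp l \<ge> exp 1 * l\<close>, the tangent at
  \<open>l = 1\<close>, this forces \<open>x \<le> 1/e\<close>.\<close>

lemma tree_sum_unbounded:
  assumes x: "exp (- 1) < x"
  obtains F where "finite F" "B < (\<Sum>s\<in>F. x ^ tree_size s / real (orderings s))"
proof -
  define \<omega> where "\<omega> s = x ^ tree_size s / real (orderings s)" for s
  define w where "w n = (\<Sum>s\<in>tree_level n. \<omega> s)" for n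
  have x0: "0 < x" using x by (meson exp_gt_zero less_trans)
  have \<omega>0: "0 \<le> \<omega> s" for s using x0 by (simp add: \<omega>_def)
  have \<omega>_node: "\<omega> (PNode ts) = x * (prod_list (map \<omega> ts) / fact (length ts))" for ts
  proof -
    have "prod_list (map \<omega> ts) = x ^ sum_list (map tree_size ts) / real (prod_list (map orderings ts))"
      by (induction ts) (simp_all add: \<omega>_def power_add)
    then show ?thesis by (simp add: \<omega>_def field_simps)
  qed
  have rec: "w (Suc n) = x * (\<Sum>k\<le>n. w n ^ k / fact k)" for n
  proof -
    have fin: "finite {ts. set ts \<subseteq> tree_level n \<and> length ts = k}" for k
      using finite_lists_length_eq[OF finite_tree_level] by blast
    have "w (Suc n) = (\<Sum>ts\<in>{ts. set ts \<subseteq> tree_level n \<and> length ts \<le> n}. \<omega> (PNode ts))"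
      unfolding w_def tree_level.simps by (subst sum.reindex) (auto simp: inj_on_def)
    also have "{ts. set ts \<subseteq> tree_level n \<and> length ts \<le> n} = (\<Union>k\<le>n. {ts. set ts \<subseteq> tree_level n \<and> length ts = k})"
      by auto
    also have "(\<Sum>ts\<in>\<dots>. \<omega> (PNode ts)) = (\<Sum>k\<le>n. \<Sum>ts\<in>{ts. set ts \<subseteq> tree_level n \<and> length ts = k}. \<omega> (PNode ts))"
      by (rule sum.UNION_disjoint) (use fin in auto)
    also have "\<dots> = (\<Sum>k\<le>n. x * (w n ^ k / fact k))"
    proof (rule sum.cong[OF refl])
      fix k assume "k \<in> {..n}"
      have "(\<Sum>ts\<in>{ts. set ts \<subseteq> tree_level n \<and> length ts = k}. \<omega> (PNode ts)) =
         (\<Sum>ts\<in>{ts. set ts \<subseteq> tree_level n \<and> length ts = k}. (x / fact k) * prod_list (map \<omega> ts))"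
        by (rule sum.cong) (auto simp: \<omega>_node)
      also have "\<dots> = (x / fact k) * w n ^ k"
        unfolding sum_distrib_left[symmetric] w_def by (subst sum_lists_prod) (auto intro: finite_tree_level)
      finally show "(\<Sum>ts\<in>{ts. set ts \<subseteq> tree_level n \<and> length ts = k}. \<omega> (PNode ts)) = x * (w n ^ k / fact k)" by simp
    qed
    finally show ?thesis by (simp add: sum_distrib_left)
  qed
  have w0: "0 \<le> w n" for n unfolding w_def using \<omega>0 by (simp add: sum_nonneg)
  have inc: "incseq w"
    unfolding w_def by (rule incseq_SucI, rule sum_mono2[OF finite_tree_level tree_level_mono \<omega>0])
  have "\<exists>n. B < w n"
  proof (rule ccontr)
    assume "\<not> (\<exists>n. B < w n)"
    then have "w n \<le> B" for n by (simp add: not_less)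
    then obtain l where l: "w \<longlonglongrightarrow> l" "\<forall>n. w n \<le> l" using incseq_convergent[OF inc] by blast
    \<comment> \<open>The order of truncation is frozen at \<open>K\<close> while \<open>n\<close>
      grows; only afterwards does \<open>K\<close> tend to infinity.\<close>
    have "x * (\<Sum>k\<le>K. l ^ k / fact k) \<le> l" for K
    proof (rule LIMSEQ_le)
      show "(\<lambda>n. x * (\<Sum>k\<le>K. w n ^ k / fact k)) \<longlonglongrightarrow> x * (\<Sum>k\<le>K. l ^ k / fact k)"
        by (intro tendsto_intros l) simp_all
      show "(\<lambda>n. w (Suc n)) \<longlonglongrightarrow> l" using l(1) by (rule LIMSEQ_Suc)
      have "x * (\<Sum>k\<le>K. w n ^ k / fact k) \<le> w (Suc n)" if "K \<le> n" for n
        unfolding rec using that w0 x0 by (intro mult_left_mono sum_mono2) auto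
      then show "\<exists>N. \<forall>n\<ge>N. x * (\<Sum>k\<le>K. w n ^ k / fact k) \<le> w (Suc n)" by blast
    qed
    moreover have "(\<lambda>K. x * (\<Sum>k\<le>K. l ^ k / fact k)) \<longlonglongrightarrow> x * exp l"
    proof -
      have "(\<lambda>K. \<Sum>k\<le>K. l ^ k / fact k) \<longlonglongrightarrow> exp l"
        using exp_converges[of l] unfolding sums_def_le by (simp add: scaleR_conv_of_real divide_inverse mult.commute)
      then show ?thesis by (intro tendsto_intros)
    qed
    ultimately have xl: "x * exp l \<le> l" by (intro LIMSEQ_le_const2) auto
    have "exp 1 * l \<le> exp l" using exp_ge_add_one_self[of "l - 1"] by (simp add: exp_diff field_simps)
    then have "x * (exp 1 * l) \<le> l" using xl x0 by (meson mult_left_mono less_imp_le order_trans)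
    moreover have "w 1 = x" using rec[of 0] by simp
    then have "0 < l" using l(2) x0 by (metis less_le_trans)
    ultimately have "x * exp 1 \<le> 1" by (simp add: mult.assoc[symmetric])
    moreover have "exp (- 1) * exp 1 < x * exp 1" using x by (intro mult_strict_right_mono) auto
    ultimately show False by (simp add: mult_exp_exp)
  qed
  then show ?thesis using that finite_tree_level unfolding w_def \<omega>_def by blast
qed

subsection \<open>Mergers of intermediate clusters\<close>

definition mid :: "real \<Rightarrow> real \<Rightarrow> (nat \<times> nat) set \<Rightarrow> nat \<Rightarrow> bool" where
  "mid \<alpha> M E v \<longleftrightarrow> M \<le> real (card (cluster E v)) \<and> in_sol \<alpha> E v"

definition apart :: "real \<Rightarrow> real \<Rightarrow> (nat \<times> nat) set \<Rightarrow> nat \<times> nat \<Rightarrow> bool" where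
  "apart \<alpha> M E p \<longleftrightarrow> mid \<alpha> M E (fst p) \<and> mid \<alpha> M E (snd p) \<and> snd p \<notin> cluster E (fst p)"

text \<open>Every merger of two clusters of size at least \<open>M\<close> lowers this quantity by at least one.\<close>
definition potential :: "real \<Rightarrow> nat set \<Rightarrow> (nat \<times> nat) set \<Rightarrow> real" where
  "potential M V E = (\<Sum>x\<in>V. min (1 / M) (1 / real (card (cluster E x))))"

lemma card_cluster_pos: "finite E \<Longrightarrow> 0 < card (cluster E x)"
  by (metis card_gt_0_iff cluster_self empty_iff finite_cluster)

lemma potential_antimono:
  assumes "finite F" "E \<subseteq> F" shows "potential M V F \<le> potential M V E"
  unfolding potential_def
proof (rule sum_mono)
  fix x
  have E: "finite E" using assms finite_subset by blast
  have "card (cluster E x) \<le> card (cluster F x)" using assms by (intro card_mono cluster_mono) auto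
  then have "1 / real (card (cluster F x)) \<le> 1 / real (card (cluster E x))"
    using card_cluster_pos[OF E] by (intro frac_le) auto
  then show "min (1 / M) (1 / real (card (cluster F x))) \<le> min (1 / M) (1 / real (card (cluster E x)))" by simp
qed

text \<open>A cluster of size at least \<open>M\<close> contributes exactly 1, as each member
  contributes the reciprocal of the size. Two such clusters are replaced by a single one.\<close>

lemma potential_merge:
  assumes V: "finite V" "E \<subseteq> V \<times> V" "a \<in> V" "b \<in> V" and M: "0 < M"
    and A: "M \<le> real (card (cluster E a))" "M \<le> real (card (cluster E b))" "b \<notin> cluster E a"
  shows "potential M V (insert (a, b) E) + 1 \<le> potential M V E"
proof -
  let ?A = "cluster E a" and ?B = "cluster E b" and ?F = "insert (a, b) E"
  let ?\<phi> = "\<lambda>E x. min (1 / M) (1 / real (card (cluster E x)))"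
  have sub: "?A \<subseteq> V" "?B \<subseteq> V" using cluster_subset[OF V(2)] V by auto
  have finE: "finite E" using V finite_subset[OF V(2)] by simp
  have disj: "?A \<inter> ?B = {}" using A(3) by (rule cluster_disjoint)
  have cpos: "0 < card ?A" "0 < card ?B" using card_cluster_pos[OF finE] by auto
  have cU: "card (?A \<union> ?B) = card ?A + card ?B" using disj finE by (intro card_Un_disjoint) auto
  have split: "(\<Sum>x\<in>V. f x) = (\<Sum>x\<in>V - (?A \<union> ?B). f x) + (\<Sum>x\<in>?A \<union> ?B. f x)" for f :: "nat \<Rightarrow> real"
    using sub V by (intro sum.subset_diff) auto
  have out: "(\<Sum>x\<in>V - (?A \<union> ?B). ?\<phi> ?F x) = (\<Sum>x\<in>V - (?A \<union> ?B). ?\<phi> E x)"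
    by (rule sum.cong) (auto simp: cluster_insert[OF A(3)])
  have "(\<Sum>x\<in>?A \<union> ?B. ?\<phi> ?F x) \<le> (\<Sum>x\<in>?A \<union> ?B. 1 / real (card (?A \<union> ?B)))"
  proof (rule sum_mono)
    fix x assume "x \<in> ?A \<union> ?B"
    then have "cluster ?F x = ?A \<union> ?B" unfolding cluster_insert[OF A(3)] by (rule if_P)
    then show "?\<phi> ?F x \<le> 1 / real (card (?A \<union> ?B))" by simp
  qed
  also have "\<dots> = 1" using cU cpos by simp
  finally have after: "(\<Sum>x\<in>?A \<union> ?B. ?\<phi> ?F x) \<le> 1" .
  have in1: "(\<Sum>x\<in>cluster E c. ?\<phi> E x) = 1" if "M \<le> real (card (cluster E c))" for c
  proof -
    have "(\<Sum>x\<in>cluster E c. ?\<phi> E x) = (\<Sum>x\<in>cluster E c. 1 / real (card (cluster E c)))"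
    proof (rule sum.cong[OF refl])
      fix x assume "x \<in> cluster E c"
      then have "cluster E x = cluster E c" by (rule cluster_eqI)
      moreover have "1 / real (card (cluster E c)) \<le> 1 / M" using that M by (intro frac_le) auto
      ultimately show "?\<phi> E x = 1 / real (card (cluster E c))" by simp
    qed
    then show ?thesis using card_cluster_pos[OF finE, of c] by simp
  qed
  have "(\<Sum>x\<in>?A \<union> ?B. ?\<phi> E x) = (\<Sum>x\<in>?A. ?\<phi> E x) + (\<Sum>x\<in>?B. ?\<phi> E x)"
    using disj finE by (intro sum.union_disjoint) auto
  then have before: "(\<Sum>x\<in>?A \<union> ?B. ?\<phi> E x) = 2" using in1[OF A(1)] in1[OF A(2)] by simp
  show ?thesis unfolding potential_def split out using after before by simp
qed

text \<open>The empty graph has potential at most \<open>card V / M\<close>, a merger lowers it by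
  at least one and no link raises it. In order of ringing, the mergers so far plus the remaining
  potential never exceed this initial budget.\<close>

lemma card_mergers:
  assumes "finite Q" and V: "finite V" and M: "0 < M"
    and "Q \<subseteq> V \<times> V" "inj_on e Q"
  shows "real (card {p\<in>Q. apart \<alpha> M (links \<alpha> e {q\<in>Q. e q < e p}) p}) + potential M V (links \<alpha> e Q)
    \<le> real (card V) / M"
  using assms(1,4,5)
proof (induction Q rule: finite_ranking_induct[where f = e])
  case empty
  have "potential M V (links \<alpha> e {}) \<le> (\<Sum>x\<in>V. 1 / M)"
    unfolding potential_def by (rule sum_mono) simp
  then show ?case by simp
next
  case (insert x S)
  show ?case
  proof (cases "x \<in> S")
    case True
    then show ?thesis using insert by (simp add: insert_absorb)
  next
    case False
    let ?E = "links \<alpha> e S" and ?F = "links \<alpha> e (insert x S)"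
    let ?m = "\<lambda>Q p. apart \<alpha> M (links \<alpha> e {q\<in>Q. e q < e p}) p"
    have IH: "real (card {p\<in>S. ?m S p}) + potential M V ?E \<le> real (card V) / M"
      using insert by (auto simp: inj_on_def)
    have lt: "e q < e x" if "q \<in> S" for q
    proof -
      have "e q \<noteq> e x" using insert.prems(2) False that by (auto simp: inj_on_def)
      then show ?thesis using insert.hyps(2)[OF that] by simp
    qed
    have 1: "{q\<in>insert x S. e q < e p} = {q\<in>S. e q < e p}" if "p \<in> S" for p
      using lt[OF that] by auto
    have 2: "{q\<in>insert x S. e q < e x} = S" using lt by auto
    have set: "{p\<in>insert x S. ?m (insert x S) p} = {p\<in>S. ?m S p} \<union> (if apart \<alpha> M ?E x then {x} else {})"
      using 1 2 by auto
    have ES: "?E \<subseteq> S" by (rule links_subset[OF insert.hyps(1)])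
    have C: "created_by \<alpha> e S ?E" by (rule created_by_links[OF insert.hyps(1)])
    have "{q \<in> ?E. e q < e x} = ?E" using lt ES by auto
    then have F: "?F = (if in_sol \<alpha> ?E (fst x) \<and> in_sol \<alpha> ?E (snd x) then insert x ?E else ?E)"
      using created_by_insert[OF C insert.hyps(2) False] insert.hyps(1) by (intro links_eqI) auto
    have EF: "?E \<subseteq> ?F" unfolding F by auto
    show ?thesis
    proof (cases "apart \<alpha> M ?E x")
      case True
      obtain a b where x: "x = (a, b)" by (cases x)
      have Fx: "?F = insert (a, b) ?E" using True F by (simp add: apart_def mid_def x)
      have "potential M V (insert (a, b) ?E) + 1 \<le> potential M V ?E"
        by (rule potential_merge[OF V]) (use True M insert.prems ES in \<open>auto simp: apart_def mid_def x\<close>)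
      moreover have "card {p\<in>insert x S. ?m (insert x S) p} \<le> card {p\<in>S. ?m S p} + 1"
        unfolding set using True card_Un_le[of "{p\<in>S. ?m S p}" "{x}"] by simp
      ultimately show ?thesis unfolding Fx using IH by linarith
    next
      case no: False
      have "potential M V ?F \<le> potential M V ?E"
        by (rule potential_antimono[OF _ EF]) (use insert in simp)
      moreover have "{p\<in>insert x S. ?m (insert x S) p} = {p\<in>S. ?m S p}" unfolding set using no by simp
      ultimately show ?thesis using IH by simp
    qed
  qed
qed

lemma card_mergers_le:
  assumes "finite V" "0 < M" "inj_on e (prs V)"
  shows "real (card {p\<in>prs V. apart \<alpha> M (lk \<alpha> (prs V) e (e p)) p}) \<le> real (card V) / M"
proof -
  have "0 \<le> potential M V (links \<alpha> e (prs V))"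
    unfolding potential_def using assms(2) by (intro sum_nonneg) auto
  then show ?thesis
    using card_mergers[OF _ assms(1,2) prs_subset assms(3), of \<alpha>] assms(1) by (simp add: lk_def)
qed

section \<open>Intensity of mergers\<close>

text \<open>Had the clock of \<open>p\<close> rung before \<open>s\<close>, both ends would have
  been in solution at that moment and the link would exist, so the ends could not be in different
  clusters at \<open>s\<close>. The event thus splits into a condition on the clock of
  \<open>p\<close> and one on the other, independent clocks.\<close>

lemma apart_lk_iff:
  assumes "finite P" "p \<in> P"
  shows "apart \<alpha> M (lk \<alpha> P e s) p \<longleftrightarrow> s \<le> e p \<and> apart \<alpha> M (lk \<alpha> (P - {p}) e s) p"
proof (cases "s \<le> e p")
  case True
  then have "{q \<in> P. e q < s} = {q \<in> P - {p}. e q < s}" by auto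
  then show ?thesis using True by (simp add: lk_def)
next
  case False
  have "\<not> apart \<alpha> M (lk \<alpha> P e s) p"
  proof
    assume a: "apart \<alpha> M (lk \<alpha> P e s) p"
    have "in_sol \<alpha> (lk \<alpha> P e (e p)) (fst p)" "in_sol \<alpha> (lk \<alpha> P e (e p)) (snd p)"
      using a False in_sol_lk_antimono[OF assms(1), of "e p" s \<alpha> e] by (auto simp: apart_def mid_def)
    then have "p \<in> lk \<alpha> P e s" using lk_iff[OF assms, of e s \<alpha>] False by simp
    then have "snd p \<in> cluster (lk \<alpha> P e s) (fst p)"
      by (intro cluster_step[OF cluster_self]) (simp add: link_adj_def)
    then show False using a by (simp add: apart_def)
  qed
  then show ?thesis using False by simp
qed

lemma lk_own_clock: "lk \<alpha> P e (e p) = lk \<alpha> (P - {p}) e (e p)"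
proof -
  have "{q \<in> P. e q < e p} = {q \<in> P - {p}. e q < e p}" by auto
  then show ?thesis by (simp add: lk_def)
qed

lemma nn_integral_clocks_split:
  assumes "0 < \<rho>" "finite P" "p \<in> P" "f \<in> borel_measurable (clocks \<rho> P)"
  shows "(\<integral>\<^sup>+e. f e \<partial>clocks \<rho> P) = (\<integral>\<^sup>+x. \<integral>\<^sup>+y. f (x(p := y)) \<partial>expo \<rho> \<partial>clocks \<rho> (P - {p}))"
proof -
  interpret E: prob_space "expo \<rho>" using assms prob_space_exponential_density by blast
  interpret product_sigma_finite "\<lambda>_::nat \<times> nat. expo \<rho>" by unfold_locales
  have "insert p (P - {p}) = P" using assms by auto
  then show ?thesis using product_nn_integral_insert[of "P - {p}" p f] assms by (simp add: clocks_def)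
qed

lemma AE_inj_clocks:
  assumes "0 < \<rho>" "finite P" shows "AE e in clocks \<rho> P. inj_on e P"
proof -
  have "AE e in clocks \<rho> P. e p \<noteq> e q" if pq: "p \<in> P" "q \<in> P" "p \<noteq> q" for p q
  proof (rule AE_I')
    have m: "{e\<in>space (clocks \<rho> P). e p = e q} \<in> sets (clocks \<rho> P)"
      using pq measurable_clock[of p P \<rho>] measurable_clock[of q P \<rho>] by measurable
    have "emeasure (clocks \<rho> P) {e\<in>space (clocks \<rho> P). e p = e q} =
      (\<integral>\<^sup>+e. indicator {e\<in>space (clocks \<rho> P). e p = e q} e \<partial>clocks \<rho> P)"
      using m by simp
    also have "\<dots> = (\<integral>\<^sup>+x. \<integral>\<^sup>+y. indicator {e\<in>space (clocks \<rho> P). e p = e q} (x(p := y)) \<partial>expo \<rho> \<partial>clocks \<rho> (P - {p}))"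
      by (rule nn_integral_clocks_split[OF assms pq(1)]) (use m in measurable)
    also have "\<dots> = (\<integral>\<^sup>+x. 0 \<partial>clocks \<rho> (P - {p}))"
    proof (rule nn_integral_cong)
      fix x
      have "AE y in expo \<rho>. indicator {e\<in>space (clocks \<rho> P). e p = e q} (x(p := y)) = (0::ennreal)"
        using expo_AE(2)[OF assms(1), of "x q"] by (rule eventually_mono) (use pq in auto)
      then have "(\<integral>\<^sup>+y. indicator {e\<in>space (clocks \<rho> P). e p = e q} (x(p := y)) \<partial>expo \<rho>) = (\<integral>\<^sup>+y. 0 \<partial>expo \<rho>)"
        by (rule nn_integral_cong_AE)
      then show "(\<integral>\<^sup>+y. indicator {e\<in>space (clocks \<rho> P). e p = e q} (x(p := y)) \<partial>expo \<rho>) = 0" by simp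
    qed
    finally show "{e\<in>space (clocks \<rho> P). e p = e q} \<in> null_sets (clocks \<rho> P)" using m by (simp add: null_sets_def)
  qed auto
  then have "AE e in clocks \<rho> P. \<forall>p\<in>P. \<forall>q\<in>P. p \<noteq> q \<longrightarrow> e p \<noteq> e q"
    using assms(2) by (simp add: AE_finite_all)
  then show ?thesis by (rule eventually_mono) (auto simp: inj_on_def)
qed

lemma measurable_lk_pair:
  assumes "finite P" "Q \<subseteq> P"
  shows "(\<lambda>x. lk \<alpha> Q (snd x) (fst x)) \<in> measurable (lborel \<Otimes>\<^sub>M clocks \<rho> P) (count_space UNIV)"
    and "(\<lambda>x. lk \<alpha> Q (fst x) (snd x)) \<in> measurable (clocks \<rho> P \<Otimes>\<^sub>M lborel) (count_space UNIV)"
proof -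
  have [measurable]: "(\<lambda>e. e p) \<in> borel_measurable (clocks \<rho> P)" if "p \<in> Q" for p
    using that assms by (intro measurable_clock) auto
  have Q: "finite Q" using assms finite_subset by auto
  show "(\<lambda>x. lk \<alpha> Q (snd x) (fst x)) \<in> measurable (lborel \<Otimes>\<^sub>M clocks \<rho> P) (count_space UNIV)"
    by (rule measurable_lk[OF Q]) measurable
  show "(\<lambda>x. lk \<alpha> Q (fst x) (snd x)) \<in> measurable (clocks \<rho> P \<Otimes>\<^sub>M lborel) (count_space UNIV)"
    by (rule measurable_lk[OF Q]) measurable
qed

lemma borel_measurable_of_count_space:
  fixes g :: "'b \<Rightarrow> 'c::topological_space"
  shows "f \<in> measurable M (count_space UNIV) \<Longrightarrow> (\<lambda>x. g (f x)) \<in> borel_measurable M"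
  by (rule measurable_compose[of f _ "count_space UNIV"]) simp_all

text \<open>The number of mergers is compensated by its intensity: the clock of a pair rings at rate
  \<open>\<rho>\<close>, independently of the configuration formed by the other clocks.\<close>
lemma merger_intensity:
  assumes "0 < \<rho>" "0 \<le> t" "finite P" "p \<in> P"
  shows "(\<integral>\<^sup>+e. of_bool (0 \<le> e p \<and> e p < t \<and> apart \<alpha> M (lk \<alpha> P e (e p)) p) \<partial>clocks \<rho> P) =
    ennreal \<rho> * (\<integral>\<^sup>+s. indicator {0..<t} s * (\<integral>\<^sup>+e. of_bool (apart \<alpha> M (lk \<alpha> P e s) p) \<partial>clocks \<rho> P) \<partial>lborel)"
proof -
  let ?P = "P - {p}"
  interpret E: prob_space "expo \<rho>" using assms prob_space_exponential_density by blast
  interpret C: prob_space "clocks \<rho> ?P" by (rule prob_space_clocks[OF assms(1)])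
  interpret PS: pair_sigma_finite "clocks \<rho> ?P" lborel by unfold_locales
  note [measurable] = measurable_clock[OF assms(4), of \<rho>]
  define a where "a x s = (of_bool (apart \<alpha> M (lk \<alpha> ?P x s) p) :: ennreal)" for x s
  have P: "finite ?P" using assms by simp
  note mg = borel_measurable_of_count_space[where g = "\<lambda>E. of_bool (apart \<alpha> M E p) :: ennreal"]
  have [measurable]: "(\<lambda>x. a (fst x) (snd x)) \<in> borel_measurable (clocks \<rho> ?P \<Otimes>\<^sub>M lborel)"
    unfolding a_def by (rule mg[OF measurable_lk_pair(2)[OF P order_refl]])
  have a_meas [measurable]: "a x \<in> borel_measurable borel" for x
    unfolding a_def[abs_def] by (rule mg, rule measurable_lk[OF P]) auto
  have a_meas2 [measurable]: "(\<lambda>x. a x s) \<in> borel_measurable (clocks \<rho> ?P)" for s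
    unfolding a_def by (rule mg[OF measurable_lk_clocks[OF P order_refl]])
  have upd: "lk \<alpha> ?P (x(p := y)) s = lk \<alpha> ?P x s" for x y s by (rule lk_cong) auto
  have mlk1: "(\<lambda>e. lk \<alpha> P e (e p)) \<in> measurable (clocks \<rho> P) (count_space UNIV)"
    using assms by (intro measurable_lk) auto
  have mlk2: "(\<lambda>e. lk \<alpha> P e s) \<in> measurable (clocks \<rho> P) (count_space UNIV)" for s
    using assms by (intro measurable_lk) auto
  have [measurable]: "Measurable.pred (clocks \<rho> P) (\<lambda>e. apart \<alpha> M (lk \<alpha> P e (e p)) p)"
    by (rule measurable_compose[OF mlk1]) simp
  have [measurable]: "Measurable.pred (clocks \<rho> P) (\<lambda>e. apart \<alpha> M (lk \<alpha> P e s) p)" for s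
    by (rule measurable_compose[OF mlk2]) simp
  have "(\<integral>\<^sup>+e. of_bool (0 \<le> e p \<and> e p < t \<and> apart \<alpha> M (lk \<alpha> P e (e p)) p) \<partial>clocks \<rho> P) =
     (\<integral>\<^sup>+x. \<integral>\<^sup>+y. of_bool (0 \<le> y \<and> y < t) * a x y \<partial>expo \<rho> \<partial>clocks \<rho> ?P)"
  proof (subst nn_integral_clocks_split[OF assms(1,3,4)])
    show "(\<lambda>e. of_bool (0 \<le> e p \<and> e p < t \<and> apart \<alpha> M (lk \<alpha> P e (e p)) p) :: ennreal) \<in> borel_measurable (clocks \<rho> P)"
      by measurable
    have own: "lk \<alpha> P (x(p := y)) y = lk \<alpha> ?P x y" for x y
      using lk_own_clock[of \<alpha> P "x(p := y)" p] upd[of x y y] by simp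
    show "(\<integral>\<^sup>+x. \<integral>\<^sup>+y. of_bool (0 \<le> (x(p := y)) p \<and> (x(p := y)) p < t \<and>
          apart \<alpha> M (lk \<alpha> P (x(p := y)) ((x(p := y)) p)) p) \<partial>expo \<rho> \<partial>clocks \<rho> ?P) =
       (\<integral>\<^sup>+x. \<integral>\<^sup>+y. of_bool (0 \<le> y \<and> y < t) * a x y \<partial>expo \<rho> \<partial>clocks \<rho> ?P)"
      by (intro nn_integral_cong) (simp add: own a_def)
  qed
  \<comment> \<open>The density of the clock supplies the rate \<open>\<rho>\<close> and a factor
    \<open>exp (- \<rho> * y)\<close>. The latter is the probability that the clock has not rung
    before \<open>y\<close>, so \<open>apart_lk_iff\<close> absorbs it into an expectation over all
    clocks.\<close>
  also have "\<dots> = (\<integral>\<^sup>+x. \<integral>\<^sup>+y. ennreal \<rho> * (indicator {0..<t} y * (ennreal (exp (- \<rho> * y)) * a x y)) \<partial>lborel \<partial>clocks \<rho> ?P)"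
  proof (rule nn_integral_cong)
    fix x
    have "(\<integral>\<^sup>+y. of_bool (0 \<le> y \<and> y < t) * a x y \<partial>expo \<rho>) =
      (\<integral>\<^sup>+y. ennreal (exponential_density \<rho> y) * (of_bool (0 \<le> y \<and> y < t) * a x y) \<partial>lborel)"
      by (subst nn_integral_density) auto
    also have "\<dots> = (\<integral>\<^sup>+y. ennreal \<rho> * (indicator {0..<t} y * (ennreal (exp (- \<rho> * y)) * a x y)) \<partial>lborel)"
      by (rule nn_integral_cong)
        (use assms in \<open>auto simp: exponential_density_def indicator_def ennreal_mult' mult_ac\<close>)
    finally show "(\<integral>\<^sup>+y. of_bool (0 \<le> y \<and> y < t) * a x y \<partial>expo \<rho>) =
       (\<integral>\<^sup>+y. ennreal \<rho> * (indicator {0..<t} y * (ennreal (exp (- \<rho> * y)) * a x y)) \<partial>lborel)" .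
  qed
  also have "\<dots> = (\<integral>\<^sup>+s. \<integral>\<^sup>+x. ennreal \<rho> * (indicator {0..<t} s * (ennreal (exp (- \<rho> * s)) * a x s)) \<partial>clocks \<rho> ?P \<partial>lborel)"
    by (rule PS.Fubini'[symmetric]) measurable
  also have "\<dots> = (\<integral>\<^sup>+s. ennreal \<rho> * (indicator {0..<t} s * (\<integral>\<^sup>+e. of_bool (apart \<alpha> M (lk \<alpha> P e s) p) \<partial>clocks \<rho> P)) \<partial>lborel)"
  proof (rule nn_integral_cong)
    fix s
    have "(\<integral>\<^sup>+e. of_bool (apart \<alpha> M (lk \<alpha> P e s) p) \<partial>clocks \<rho> P) = (\<integral>\<^sup>+x. ennreal (exp (- \<rho> * s)) * a x s \<partial>clocks \<rho> ?P)"
      if "0 \<le> s"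
    proof -
      have "(\<integral>\<^sup>+e. of_bool (apart \<alpha> M (lk \<alpha> P e s) p) \<partial>clocks \<rho> P) =
         (\<integral>\<^sup>+x. \<integral>\<^sup>+y. of_bool (s \<le> y) * a x s \<partial>expo \<rho> \<partial>clocks \<rho> ?P)"
      proof (subst nn_integral_clocks_split[OF assms(1,3,4)])
        show "(\<lambda>e. of_bool (apart \<alpha> M (lk \<alpha> P e s) p) :: ennreal) \<in> borel_measurable (clocks \<rho> P)"
          by measurable
        show "(\<integral>\<^sup>+x. \<integral>\<^sup>+y. of_bool (apart \<alpha> M (lk \<alpha> P (x(p := y)) s) p) \<partial>expo \<rho> \<partial>clocks \<rho> ?P) =
           (\<integral>\<^sup>+x. \<integral>\<^sup>+y. of_bool (s \<le> y) * a x s \<partial>expo \<rho> \<partial>clocks \<rho> ?P)"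
          by (intro nn_integral_cong) (simp add: apart_lk_iff[OF assms(3,4)] upd a_def)
      qed
      also have "\<dots> = (\<integral>\<^sup>+x. ennreal (exp (- \<rho> * s)) * a x s \<partial>clocks \<rho> ?P)"
      proof (rule nn_integral_cong)
        fix x
        have "(\<integral>\<^sup>+y. of_bool (s \<le> y) \<partial>expo \<rho>) = (\<integral>\<^sup>+y. indicator {y. \<not> y < s} y \<partial>expo \<rho>)"
          by (intro nn_integral_cong) (auto simp: indicator_def)
        also have "\<dots> = emeasure (expo \<rho>) {y. \<not> y < s}" by (rule nn_integral_indicator) simp
        also have "\<dots> = ennreal (exp (- \<rho> * s))"
          using expo_integrals(2)[OF assms(1) that] by (subst (asm) E.integral_of_bool) (simp_all add: E.emeasure_eq_measure)
        finally have "(\<integral>\<^sup>+y. of_bool (s \<le> y) \<partial>expo \<rho>) = ennreal (exp (- \<rho> * s))" .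
        then show "(\<integral>\<^sup>+y. of_bool (s \<le> y) * a x s \<partial>expo \<rho>) = ennreal (exp (- \<rho> * s)) * a x s"
          by (subst nn_integral_multc) auto
      qed
      finally show ?thesis .
    qed
    then show "(\<integral>\<^sup>+x. ennreal \<rho> * (indicator {0..<t} s * (ennreal (exp (- \<rho> * s)) * a x s)) \<partial>clocks \<rho> ?P) =
       ennreal \<rho> * (indicator {0..<t} s * (\<integral>\<^sup>+e. of_bool (apart \<alpha> M (lk \<alpha> P e s) p) \<partial>clocks \<rho> P))"
      by (cases "s \<in> {0..<t}") (auto simp: nn_integral_cmult)
  qed
  also have "\<dots> = ennreal \<rho> * (\<integral>\<^sup>+s. indicator {0..<t} s * (\<integral>\<^sup>+e. of_bool (apart \<alpha> M (lk \<alpha> P e s) p) \<partial>clocks \<rho> P) \<partial>lborel)"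
  proof (rule nn_integral_cmult)
    interpret CP: prob_space "clocks \<rho> P" by (rule prob_space_clocks[OF assms(1)])
    have [measurable]: "(\<lambda>x. of_bool (apart \<alpha> M (lk \<alpha> P (snd x) (fst x)) p) :: ennreal) \<in> borel_measurable (lborel \<Otimes>\<^sub>M clocks \<rho> P)"
      by (rule mg[OF measurable_lk_pair(1)[OF assms(3) order_refl]])
    show "(\<lambda>s. indicator {0..<t} s * (\<integral>\<^sup>+e. of_bool (apart \<alpha> M (lk \<alpha> P e s) p) \<partial>clocks \<rho> P)) \<in> borel_measurable lborel"
      by (intro borel_measurable_times_ennreal CP.borel_measurable_nn_integral) (simp_all add: split_beta')
  qed
  finally show ?thesis .
qed

section \<open>Mass of intermediate clusters\<close>

abbreviation sol_graph :: "real \<Rightarrow> nat \<Rightarrow> (nat \<times> nat \<Rightarrow> real) \<Rightarrow> real \<Rightarrow> (nat \<times> nat) set" where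
  "sol_graph \<alpha> N e t \<equiv> lk \<alpha> (prs {..<N}) e t"

abbreviation particle_clocks :: "nat \<Rightarrow> (nat \<times> nat \<Rightarrow> real) measure" where
  "particle_clocks N \<equiv> clocks (1 / real N) (prs {..<N})"

text \<open>Ordered pairs of intermediate particles lie either in a common cluster, with fewer than
  \<open>\<alpha>\<close> choices for the second particle, or in different clusters; in the latter
  case each pair of \<open>prs V\<close> stands for both orders, hence the factor 2.\<close>

lemma card_mid_square:
  assumes V: "finite V" "E \<subseteq> prs V"
  shows "(real (card {v\<in>V. mid \<alpha> M E v}))\<^sup>2 \<le>
    \<alpha> * real (card {v\<in>V. mid \<alpha> M E v}) + 2 * real (card {p\<in>prs V. apart \<alpha> M E p})"
proof -
  define R where "R = {v\<in>V. mid \<alpha> M E v}"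
  let ?Ap = "{p\<in>prs V. apart \<alpha> M E p}"
  let ?S = "Sigma R (\<lambda>u. cluster E u)"
  have EV: "E \<subseteq> V \<times> V" using V prs_subset by blast
  have fin: "finite E" "finite R" "finite ?Ap" using V finite_subset[OF V(2)] by (auto simp: R_def)
  have "R \<times> R \<subseteq> ?S \<union> (?Ap \<union> prod.swap ` ?Ap)"
  proof
    fix x assume "x \<in> R \<times> R"
    then obtain u v where x: "x = (u, v)" and uv: "u \<in> R" "v \<in> R" by blast
    show "x \<in> ?S \<union> (?Ap \<union> prod.swap ` ?Ap)"
    proof (cases "v \<in> cluster E u")
      case True
      then show ?thesis using x uv by auto
    next
      case False
      then have nc: "v \<notin> cluster E u" "u \<notin> cluster E v" using cluster_sym by auto
      then have "u \<noteq> v" by auto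
      then consider "u < v" | "v < u" by linarith
      then show ?thesis
      proof cases
        case 1
        then have "(u, v) \<in> ?Ap" using uv nc by (auto simp: R_def prs_def apart_def)
        then show ?thesis using x by simp
      next
        case 2
        then have "(v, u) \<in> ?Ap" using uv nc by (auto simp: R_def prs_def apart_def)
        then have "prod.swap (v, u) \<in> prod.swap ` ?Ap" by (rule imageI)
        then show ?thesis using x by simp
      qed
    qed
  qed
  then have "card (R \<times> R) \<le> card (?S \<union> (?Ap \<union> prod.swap ` ?Ap))"
    using fin by (intro card_mono) auto
  also have "\<dots> \<le> card ?S + (card ?Ap + card (prod.swap ` ?Ap))"
    by (meson add_left_mono card_Un_le order_trans)
  also have "\<dots> \<le> card ?S + 2 * card ?Ap" using card_image_le[OF fin(3), of prod.swap] by simp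
  finally have "real (card R) * real (card R) \<le> real (card ?S) + 2 * real (card ?Ap)"
    by (simp add: card_cartesian_product flip: of_nat_mult of_nat_add)
  moreover have "real (card ?S) = (\<Sum>u\<in>R. real (card (cluster E u)))"
    using fin by (simp add: card_SigmaI)
  moreover have "\<dots> \<le> (\<Sum>u\<in>R. \<alpha>)"
    by (rule sum_mono) (auto simp: R_def mid_def in_sol_def)
  ultimately show ?thesis by (simp add: R_def[symmetric] power2_eq_square mult.commute)
qed

lemma graph_subset: "sol_graph \<alpha> N e t \<subseteq> prs {..<N}"
  using lk_subset[of "prs {..<N}" \<alpha> e t] by auto

text \<open>By \<open>merger_intensity\<close>, \<open>1/N\<close> times the left side is the
  expected number of mergers before \<open>t\<close>, and \<open>card_mergers_le\<close> bounds that
  number by \<open>N / M\<close> whenever the clocks are distinct.\<close>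

lemma nn_integral_apart_le:
  assumes N: "0 < N" and "0 \<le> t" "0 < M"
  shows "(\<integral>\<^sup>+s. indicator {0..<t} s * (\<integral>\<^sup>+e. real (card {p\<in>prs {..<N}. apart \<alpha> M (sol_graph \<alpha> N e s) p}) \<partial>particle_clocks N) \<partial>lborel)
    \<le> ennreal ((real N)\<^sup>2 / M)"
proof -
  let ?P = "prs {..<N}" and ?\<rho> = "1 / real N"
  let ?I = "\<lambda>p s. \<integral>\<^sup>+e. of_bool (apart \<alpha> M (sol_graph \<alpha> N e s) p) \<partial>particle_clocks N"
  have \<rho>: "0 < ?\<rho>" using N by simp
  have P: "finite ?P" by simp
  interpret C: prob_space "particle_clocks N" by (rule prob_space_clocks[OF \<rho>])
  note mg = borel_measurable_of_count_space[where g = "\<lambda>E. of_bool (apart \<alpha> M E p) :: ennreal" for p]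
  have m1: "(\<lambda>e. of_bool (apart \<alpha> M (sol_graph \<alpha> N e s) p) :: ennreal) \<in> borel_measurable (particle_clocks N)" for s p
    by (rule mg[OF measurable_lk_clocks[OF P order_refl]])
  have m2: "(\<lambda>x. of_bool (apart \<alpha> M (sol_graph \<alpha> N (snd x) (fst x)) p) :: ennreal) \<in> borel_measurable (lborel \<Otimes>\<^sub>M particle_clocks N)" for p
    by (rule mg[OF measurable_lk_pair(1)[OF P order_refl]])
  have m3 [measurable]: "?I p \<in> borel_measurable lborel" for p
    using m2[of p] by (intro C.borel_measurable_nn_integral) (simp add: split_beta')
  have card_sum: "ennreal (real (card {p\<in>?P. Q p})) = (\<Sum>p\<in>?P. of_bool (Q p))" for Q :: "nat \<times> nat \<Rightarrow> bool"
    using P by (simp add: ennreal_of_nat_eq_real_of_nat[symmetric] of_bool_def sum.If_cases Int_def)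
  have I_sum: "(\<integral>\<^sup>+e. real (card {p\<in>?P. apart \<alpha> M (sol_graph \<alpha> N e s) p}) \<partial>particle_clocks N) = (\<Sum>p\<in>?P. ?I p s)" for s
    unfolding card_sum by (rule nn_integral_sum) (rule m1)
  have "ennreal ?\<rho> * (\<integral>\<^sup>+s. indicator {0..<t} s * (\<integral>\<^sup>+e. real (card {p\<in>?P. apart \<alpha> M (sol_graph \<alpha> N e s) p}) \<partial>particle_clocks N) \<partial>lborel)
     = ennreal ?\<rho> * (\<integral>\<^sup>+s. (\<Sum>p\<in>?P. indicator {0..<t} s * ?I p s) \<partial>lborel)"
    unfolding I_sum sum_distrib_left ..
  also have "\<dots> = (\<Sum>p\<in>?P. ennreal ?\<rho> * (\<integral>\<^sup>+s. indicator {0..<t} s * ?I p s \<partial>lborel))"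
    by (subst nn_integral_sum) (auto simp: sum_distrib_left)
  also have "\<dots> = (\<Sum>p\<in>?P. \<integral>\<^sup>+e. of_bool (0 \<le> e p \<and> e p < t \<and> apart \<alpha> M (lk \<alpha> ?P e (e p)) p) \<partial>particle_clocks N)"
    by (rule sum.cong[OF refl]) (rule merger_intensity[OF \<rho> assms(2) P, symmetric])
  also have "\<dots> \<le> (\<Sum>p\<in>?P. \<integral>\<^sup>+e. of_bool (apart \<alpha> M (lk \<alpha> ?P e (e p)) p) \<partial>particle_clocks N)"
    by (intro sum_mono nn_integral_mono) auto
  also have "\<dots> = (\<integral>\<^sup>+e. (\<Sum>p\<in>?P. of_bool (apart \<alpha> M (lk \<alpha> ?P e (e p)) p)) \<partial>particle_clocks N)"
  proof (rule nn_integral_sum[symmetric])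
    fix p assume p: "p \<in> ?P"
    show "(\<lambda>e. of_bool (apart \<alpha> M (lk \<alpha> ?P e (e p)) p) :: ennreal) \<in> borel_measurable (particle_clocks N)"
      by (rule mg, rule measurable_lk[OF P]) (use p in auto)
  qed
  also have "\<dots> \<le> (\<integral>\<^sup>+e. ennreal (real N / M) \<partial>particle_clocks N)"
  proof (rule nn_integral_mono_AE)
    show "AE e in particle_clocks N. (\<Sum>p\<in>?P. of_bool (apart \<alpha> M (lk \<alpha> ?P e (e p)) p)) \<le> ennreal (real N / M)"
      using AE_inj_clocks[OF \<rho> P]
    proof (rule eventually_mono)
      fix e :: "nat \<times> nat \<Rightarrow> real" assume inj: "inj_on e ?P"
      show "(\<Sum>p\<in>?P. of_bool (apart \<alpha> M (lk \<alpha> ?P e (e p)) p)) \<le> ennreal (real N / M)"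
        unfolding card_sum[symmetric] using card_mergers_le[OF finite_lessThan assms(3) inj, of \<alpha>] by (intro ennreal_leI) simp
    qed
  qed
  also have "\<dots> = ennreal (real N / M)" by (simp add: C.emeasure_space_1)
  finally have "ennreal (real N) * (ennreal ?\<rho> * (\<integral>\<^sup>+s. indicator {0..<t} s * (\<integral>\<^sup>+e. real (card {p\<in>?P. apart \<alpha> M (sol_graph \<alpha> N e s) p}) \<partial>particle_clocks N) \<partial>lborel))
     \<le> ennreal (real N) * ennreal (real N / M)" by (rule mult_left_mono) simp
  moreover have "ennreal (real N) * ennreal ?\<rho> = 1" using N by (simp add: ennreal_mult'[symmetric])
  ultimately show ?thesis
    by (simp add: mult.assoc[symmetric] ennreal_mult'[symmetric] power2_eq_square)
qed

definition mid_frac :: "real \<Rightarrow> real \<Rightarrow> nat \<Rightarrow> (nat \<times> nat \<Rightarrow> real) \<Rightarrow> real \<Rightarrow> real" where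
  "mid_frac \<alpha> M N e s = real (card {v\<in>{..<N}. mid \<alpha> M (sol_graph \<alpha> N e s) v}) / real N"

definition small_frac :: "real \<Rightarrow> real \<Rightarrow> nat \<Rightarrow> (nat \<times> nat \<Rightarrow> real) \<Rightarrow> real \<Rightarrow> real" where
  "small_frac \<alpha> M N e s = real (card {v\<in>{..<N}. in_sol \<alpha> (sol_graph \<alpha> N e s) v \<and> real (card (cluster (sol_graph \<alpha> N e s) v)) < M}) / real N"

definition sol_frac :: "real \<Rightarrow> nat \<Rightarrow> (nat \<times> nat \<Rightarrow> real) \<Rightarrow> real \<Rightarrow> real" where
  "sol_frac \<alpha> N e s = real (card {v\<in>{..<N}. in_sol \<alpha> (sol_graph \<alpha> N e s) v}) / real N"

lemma card_frac_bounds: "0 \<le> real (card {v\<in>{..<N}. Q v}) / real N" "real (card {v\<in>{..<N}. Q v}) / real N \<le> 1"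
proof -
  have "card {v\<in>{..<N}. Q v} \<le> card {..<N}" by (intro card_mono) auto
  then show "real (card {v\<in>{..<N}. Q v}) / real N \<le> 1" by (auto simp: divide_le_eq_1)
qed simp

lemma frac_bounds [simp]:
  "0 \<le> mid_frac \<alpha> M N e s" "mid_frac \<alpha> M N e s \<le> 1" "0 \<le> small_frac \<alpha> M N e s" "small_frac \<alpha> M N e s \<le> 1"
  "0 \<le> sol_frac \<alpha> N e s" "sol_frac \<alpha> N e s \<le> 1"
  unfolding mid_frac_def small_frac_def sol_frac_def by (rule card_frac_bounds)+

lemma sol_frac_split: "sol_frac \<alpha> N e s = small_frac \<alpha> M N e s + mid_frac \<alpha> M N e s"
proof -
  have "{v\<in>{..<N}. in_sol \<alpha> (sol_graph \<alpha> N e s) v} = {v\<in>{..<N}. in_sol \<alpha> (sol_graph \<alpha> N e s) v \<and> real (card (cluster (sol_graph \<alpha> N e s) v)) < M}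
      \<union> {v\<in>{..<N}. mid \<alpha> M (sol_graph \<alpha> N e s) v}" by (auto simp: mid_def)
  moreover have "card ({v\<in>{..<N}. in_sol \<alpha> (sol_graph \<alpha> N e s) v \<and> real (card (cluster (sol_graph \<alpha> N e s) v)) < M}
      \<union> {v\<in>{..<N}. mid \<alpha> M (sol_graph \<alpha> N e s) v}) = card {v\<in>{..<N}. in_sol \<alpha> (sol_graph \<alpha> N e s) v \<and> real (card (cluster (sol_graph \<alpha> N e s) v)) < M}
      + card {v\<in>{..<N}. mid \<alpha> M (sol_graph \<alpha> N e s) v}"
    by (rule card_Un_disjoint) (auto simp: mid_def)
  ultimately show ?thesis by (simp add: sol_frac_def small_frac_def mid_frac_def add_divide_distrib)
qed

lemma measurable_fracs:
  shows "(\<lambda>e. mid_frac \<alpha> M N e s) \<in> borel_measurable (particle_clocks N)"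
    and "(\<lambda>e. small_frac \<alpha> M N e s) \<in> borel_measurable (particle_clocks N)"
    and "(\<lambda>e. sol_frac \<alpha> N e s) \<in> borel_measurable (particle_clocks N)"
    and "(\<lambda>x. mid_frac \<alpha> M N (snd x) (fst x)) \<in> borel_measurable (lborel \<Otimes>\<^sub>M particle_clocks N)"
    and "(\<lambda>x. small_frac \<alpha> M N (snd x) (fst x)) \<in> borel_measurable (lborel \<Otimes>\<^sub>M particle_clocks N)"
    and "(\<lambda>x. sol_frac \<alpha> N (snd x) (fst x)) \<in> borel_measurable (lborel \<Otimes>\<^sub>M particle_clocks N)"
    and "sol_frac \<alpha> N e \<in> borel_measurable lborel"
proof -
  have P: "finite (prs {..<N})" by simp
  note 1 = measurable_lk_clocks[OF P order_refl] and 2 = measurable_lk_pair(1)[OF P order_refl]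
  show "(\<lambda>e. mid_frac \<alpha> M N e s) \<in> borel_measurable (particle_clocks N)"
    unfolding mid_frac_def by (rule borel_measurable_of_count_space[OF 1])
  show "(\<lambda>e. small_frac \<alpha> M N e s) \<in> borel_measurable (particle_clocks N)"
    unfolding small_frac_def by (rule borel_measurable_of_count_space[OF 1])
  show "(\<lambda>e. sol_frac \<alpha> N e s) \<in> borel_measurable (particle_clocks N)"
    unfolding sol_frac_def by (rule borel_measurable_of_count_space[OF 1])
  show "(\<lambda>x. mid_frac \<alpha> M N (snd x) (fst x)) \<in> borel_measurable (lborel \<Otimes>\<^sub>M particle_clocks N)"
    unfolding mid_frac_def by (rule borel_measurable_of_count_space[OF 2])
  show "(\<lambda>x. small_frac \<alpha> M N (snd x) (fst x)) \<in> borel_measurable (lborel \<Otimes>\<^sub>M particle_clocks N)"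
    unfolding small_frac_def by (rule borel_measurable_of_count_space[OF 2])
  show "(\<lambda>x. sol_frac \<alpha> N (snd x) (fst x)) \<in> borel_measurable (lborel \<Otimes>\<^sub>M particle_clocks N)"
    unfolding sol_frac_def by (rule borel_measurable_of_count_space[OF 2])
  have "(\<lambda>s. sol_graph \<alpha> N e s) \<in> measurable lborel (count_space UNIV)" by (rule measurable_lk) auto
  then show "sol_frac \<alpha> N e \<in> borel_measurable lborel"
    unfolding sol_frac_def[abs_def] by (rule borel_measurable_of_count_space)
qed

text \<open>The mass satisfies \<open>r ^ 2 \<le> (\<alpha> / N) * r + 2 * A / N ^ 2\<close>, where
  \<open>A\<close> counts the pairs that are \<open>apart\<close> and has a controlled time
  integral. A bound on \<open>r\<close> itself follows from
  \<open>r \<le> \<epsilon> + r ^ 2 / \<epsilon>\<close>, with \<open>\<epsilon>\<close> left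
  free.\<close>

lemma mid_mass_time:
  assumes N: "0 < N" and t: "0 \<le> t" and M: "0 < M" and \<alpha>: "0 \<le> \<alpha>" and \<epsilon>: "0 < \<epsilon>"
  shows "(\<integral>s. indicator {0..<t} s * (\<integral>e. mid_frac \<alpha> M N e s \<partial>particle_clocks N) \<partial>lborel)
    \<le> t * \<epsilon> + (t * (\<alpha> / real N) + 2 / M) / \<epsilon>"
proof -
  let ?C = "particle_clocks N" and ?r = "\<lambda>e s. mid_frac \<alpha> M N e s"
  interpret C: prob_space ?C by (rule prob_space_clocks) (use N in simp)
  note [measurable] = measurable_fracs(1,4)[of \<alpha> M N]
  let ?A = "\<lambda>e s. real (card {p\<in>prs {..<N}. apart \<alpha> M (sol_graph \<alpha> N e s) p})"
  have A2: "(\<lambda>x. ?A (snd x) (fst x)) \<in> borel_measurable (lborel \<Otimes>\<^sub>M ?C)"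
    by (rule borel_measurable_of_count_space[OF measurable_lk_pair(1)]) auto
  have A1 [measurable]: "(\<lambda>e. ?A e s) \<in> borel_measurable ?C" for s
    by (rule borel_measurable_of_count_space[OF measurable_lk_clocks]) auto
  have [measurable]: "(\<lambda>s. \<integral>\<^sup>+e. ennreal (?A e s) \<partial>?C) \<in> borel_measurable lborel"
    using A2 by (intro C.borel_measurable_nn_integral) (simp add: split_beta')
  have Er [measurable]: "(\<lambda>s. \<integral>e. ?r e s \<partial>?C) \<in> borel_measurable lborel"
    by (rule C.borel_measurable_lebesgue_integral) (simp add: split_beta')
  have Er01: "0 \<le> (\<integral>e. ?r e s \<partial>?C)" "(\<integral>e. ?r e s \<partial>?C) \<le> 1" for s
  proof -
    show "0 \<le> (\<integral>e. ?r e s \<partial>?C)" by simp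
    show "(\<integral>e. ?r e s \<partial>?C) \<le> 1"
      by (rule C.integral_le_const[OF C.integrable_const_bound[where B = 1]]) auto
  qed
  have ptw: "?r e s \<le> (\<epsilon> + (\<alpha> / real N) / \<epsilon>) + (2 / ((real N)\<^sup>2 * \<epsilon>)) * ?A e s" for e s
  proof -
    let ?R = "real (card {v\<in>{..<N}. mid \<alpha> M (sol_graph \<alpha> N e s) v})"
    have rR: "?r e s = ?R / real N" by (simp add: mid_frac_def)
    have "?R\<^sup>2 \<le> \<alpha> * ?R + 2 * ?A e s" using card_mid_square[OF _ graph_subset] by simp
    then have "?R\<^sup>2 / (real N)\<^sup>2 \<le> (\<alpha> * ?R + 2 * ?A e s) / (real N)\<^sup>2" by (rule divide_right_mono) simp
    then have "(?r e s)\<^sup>2 \<le> (\<alpha> / real N) * ?r e s + 2 / (real N)\<^sup>2 * ?A e s"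
      unfolding rR by (simp add: power_divide add_divide_distrib power2_eq_square)
    also have "(\<alpha> / real N) * ?r e s \<le> (\<alpha> / real N) * 1" using \<alpha> by (intro mult_left_mono) auto
    finally have sq: "(?r e s)\<^sup>2 / \<epsilon> \<le> ((\<alpha> / real N) * 1 + 2 / (real N)\<^sup>2 * ?A e s) / \<epsilon>"
      using \<epsilon> by (intro divide_right_mono) auto
    have "0 \<le> (\<epsilon> - ?r e s)\<^sup>2 + \<epsilon> * ?r e s" using \<epsilon> by simp
    then have "?r e s * \<epsilon> \<le> \<epsilon> * \<epsilon> + (?r e s)\<^sup>2" by (simp add: power2_eq_square algebra_simps)
    then have "?r e s \<le> \<epsilon> + (?r e s)\<^sup>2 / \<epsilon>" using \<epsilon> by (simp add: field_simps)
    then show ?thesis using sq \<epsilon> by (simp add: add_divide_distrib)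
  qed
  let ?c = "\<epsilon> + (\<alpha> / real N) / \<epsilon>" and ?k = "2 / ((real N)\<^sup>2 * \<epsilon>)"
  have c0: "0 \<le> ?c" "0 \<le> ?k" using \<alpha> \<epsilon> by auto
  have int: "integrable lborel (\<lambda>s. indicator {0..<t} s * (\<integral>e. ?r e s \<partial>?C))"
    by (rule Bochner_Integration.integrable_bound[where f = "indicator {0..<t} :: real \<Rightarrow> real"])
      (use Er01 t in \<open>auto simp: indicator_def\<close>)
  have "ennreal (\<integral>s. indicator {0..<t} s * (\<integral>e. ?r e s \<partial>?C) \<partial>lborel) =
      (\<integral>\<^sup>+s. ennreal (indicator {0..<t} s * (\<integral>e. ?r e s \<partial>?C)) \<partial>lborel)"
    by (rule nn_integral_eq_integral[symmetric, OF int]) simp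
  also have "\<dots> \<le> (\<integral>\<^sup>+s. ennreal ?c * indicator {0..<t} s + ennreal ?k * (indicator {0..<t} s * (\<integral>\<^sup>+e. ennreal (?A e s) \<partial>?C)) \<partial>lborel)"
  proof (rule nn_integral_mono)
    fix s :: real
    have "ennreal (\<integral>e. ?r e s \<partial>?C) = (\<integral>\<^sup>+e. ennreal (?r e s) \<partial>?C)"
      by (rule nn_integral_eq_integral[symmetric, OF C.integrable_const_bound[where B = 1]]) auto
    also have "\<dots> \<le> (\<integral>\<^sup>+e. ennreal ?c + ennreal ?k * ennreal (?A e s) \<partial>?C)"
      using ptw c0 by (intro nn_integral_mono) (simp add: ennreal_plus[symmetric] ennreal_mult'[symmetric] del: ennreal_plus)
    also have "\<dots> = ennreal ?c + ennreal ?k * (\<integral>\<^sup>+e. ennreal (?A e s) \<partial>?C)"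
      by (simp add: nn_integral_add nn_integral_cmult C.emeasure_space_1)
    finally show "ennreal (indicator {0..<t} s * (\<integral>e. ?r e s \<partial>?C)) \<le>
        ennreal ?c * indicator {0..<t} s + ennreal ?k * (indicator {0..<t} s * (\<integral>\<^sup>+e. ennreal (?A e s) \<partial>?C))"
      by (cases "s \<in> {0..<t}") auto
  qed
  also have "\<dots> = ennreal ?c * ennreal t + ennreal ?k * (\<integral>\<^sup>+s. indicator {0..<t} s * (\<integral>\<^sup>+e. ennreal (?A e s) \<partial>?C) \<partial>lborel)"
    using t by (simp add: nn_integral_add nn_integral_cmult)
  also have "\<dots> \<le> ennreal ?c * ennreal t + ennreal ?k * ennreal ((real N)\<^sup>2 / M)"
    by (intro add_left_mono mult_left_mono nn_integral_apart_le[OF N t M]) simp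
  also have "\<dots> = ennreal (?c * t + ?k * ((real N)\<^sup>2 / M))"
  proof -
    have "0 \<le> (real N)\<^sup>2 / M" using M by simp
    then show ?thesis using c0 t by (simp only: ennreal_plus ennreal_mult mult_nonneg_nonneg)
  qed
  finally have "(\<integral>s. indicator {0..<t} s * (\<integral>e. ?r e s \<partial>?C) \<partial>lborel) \<le> ?c * t + ?k * ((real N)\<^sup>2 / M)"
  proof (rule ennreal_le_iff[THEN iffD1, rotated])
    show "0 \<le> ?c * t + ?k * ((real N)\<^sup>2 / M)"
      by (rule add_nonneg_nonneg[OF mult_nonneg_nonneg[OF c0(1) t] mult_nonneg_nonneg[OF c0(2)]]) (use M in simp)
  qed
  also have "\<dots> = t * \<epsilon> + (t * (\<alpha> / real N) + 2 / M) / \<epsilon>"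
    using N \<epsilon> M by (simp add: field_simps)
  finally show ?thesis .
qed

subsection \<open>Tree components in solution\<close>

definition tree_edges :: "ptree \<Rightarrow> (nat list \<Rightarrow> nat) \<Rightarrow> (nat \<times> nat) set" where
  "tree_edges s f = {p. \<exists>x\<in>tree_verts s. \<exists>y\<in>tree_verts s. tree_adj s x y \<and> p = (f x, f y) \<and> f x < f y}"

definition embeddings :: "ptree \<Rightarrow> nat \<Rightarrow> (nat list \<Rightarrow> nat) set" where
  "embeddings s N = {f \<in> tree_verts s \<rightarrow>\<^sub>E {..<N}. inj_on f (tree_verts s)}"

text \<open>Labelled copies of the plane tree are counted, so a rooted component appears once for
  each isomorphism from \<open>s\<close>. Division by \<open>orderings\<close> and summation over a
  shape class turn this into a number of particles.\<close>

definition tree_count :: "real \<Rightarrow> ptree \<Rightarrow> nat \<Rightarrow> (nat \<times> nat \<Rightarrow> real) \<Rightarrow> real \<Rightarrow> real" where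
  "tree_count \<alpha> s N e t = (\<Sum>f\<in>embeddings s N.
     of_bool (touching (f ` tree_verts s) (sol_graph \<alpha> N e t) = tree_edges s f))"

lemma tree_adj_sym: "tree_adj s x y \<longleftrightarrow> tree_adj s y x" by (auto simp: tree_adj_def)

lemma butlast_in_tree_verts: "v \<in> tree_verts s \<Longrightarrow> butlast v \<in> tree_verts s"
  by (cases v rule: rev_cases) (auto dest: snoc_in_tree_verts)

lemma tree_edges_subset: "tree_edges s f \<subseteq> prs (f ` tree_verts s)"
  by (auto simp: tree_edges_def prs_def)

text \<open>Every edge joins a vertex \<open>v\<close> other than the root to its parent
  \<open>butlast v\<close>.\<close>

lemma card_tree_edges:
  assumes f: "inj_on f (tree_verts s)" shows "card (tree_edges s f) = tree_size s - 1"
proof -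
  let ?e = "\<lambda>v. (min (f (butlast v)) (f v), max (f (butlast v)) (f v))"
  let ?V = "tree_verts s - {[]}"
  have feq: "f x = f y \<longleftrightarrow> x = y" if "x \<in> tree_verts s" "y \<in> tree_verts s" for x y
    using inj_onD[OF f _ that] by blast
  have "bij_betw ?e ?V (tree_edges s f)"
    unfolding bij_betw_def
  proof
    show "inj_on ?e ?V"
    proof (rule inj_onI)
      fix v w assume v: "v \<in> ?V" and w: "w \<in> ?V" and eq: "?e v = ?e w"
      have "(f v = f w) \<or> (f (butlast v) = f w \<and> f v = f (butlast w))"
        using eq by (auto simp: min_def max_def split: if_splits)
      \<comment> \<open>By length, two vertices are not parents of each other, so an edge determines
        which end is the child.\<close>
      moreover have "\<not> (butlast v = w \<and> v = butlast w)"
      proof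
        assume "butlast v = w \<and> v = butlast w"
        then have "length v - 1 = length w" "length v = length w - 1" by (metis length_butlast)+
        then show False using v w by (cases v) auto
      qed
      ultimately show "v = w" using v w feq butlast_in_tree_verts by auto
    qed
    show "?e ` ?V = tree_edges s f"
    proof (intro equalityI subsetI)
      fix p assume "p \<in> ?e ` ?V"
      then obtain v where v: "v \<in> ?V" "p = ?e v" by blast
      have b: "butlast v \<in> tree_verts s" using v butlast_in_tree_verts by blast
      have v': "v = butlast v @ [last v]" using v by simp
      then have adj: "tree_adj s (butlast v) v" unfolding tree_adj_def using v b by blast
      have "butlast v \<noteq> v" using v' by (metis not_Cons_self2 append_self_conv)
      then have "f (butlast v) \<noteq> f v" using feq[OF b, of v] v by auto
      then consider "f (butlast v) < f v" | "f v < f (butlast v)" by linarith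
      then show "p \<in> tree_edges s f"
      proof cases
        case 1
        then have "p = (f (butlast v), f v)" using v by simp
        then show ?thesis using 1 adj b v unfolding tree_edges_def by blast
      next
        case 2
        then have "p = (f v, f (butlast v))" using v by simp
        then show ?thesis using 2 adj b v tree_adj_sym[of s v] unfolding tree_edges_def by blast
      qed
    next
      fix p assume "p \<in> tree_edges s f"
      then obtain x y where xy: "x \<in> tree_verts s" "y \<in> tree_verts s" "tree_adj s x y" "p = (f x, f y)" "f x < f y"
        unfolding tree_edges_def by blast
      then consider i where "y = x @ [i]" | i where "x = y @ [i]" unfolding tree_adj_def by blast
      then show "p \<in> ?e ` ?V"
      proof cases
        case 1
        then show ?thesis using xy by (intro image_eqI[of _ _ y]) auto
      next
        case 2
        then show ?thesis using xy by (intro image_eqI[of _ _ x]) auto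
      qed
    qed
  qed
  then have "card (tree_edges s f) = card ?V" by (simp add: bij_betw_same_card)
  also have "\<dots> = tree_size s - 1" by (simp add: card_tree_verts)
  finally show ?thesis .
qed

text \<open>An isolated set carrying the links of a tree is a whole cluster, in solution because its
  size is below \<open>\<alpha>\<close>. The image of the root becomes the marked particle, so the
  union over \<open>i\<close> is disjoint.\<close>

lemma embedding_iff_iso:
  assumes E: "E \<subseteq> prs {..<N}" and \<alpha>: "real (tree_size s) < \<alpha>"
  shows "{f \<in> embeddings s N. touching (f ` tree_verts s) E = tree_edges s f} =
    (\<Union>i\<in>{v\<in>{..<N}. in_sol \<alpha> E v}. isos s (cluster E i) (link_adj E) i)"
proof (intro equalityI subsetI)
  fix f assume "f \<in> {f \<in> embeddings s N. touching (f ` tree_verts s) E = tree_edges s f}"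
  then have f: "f \<in> tree_verts s \<rightarrow>\<^sub>E {..<N}" "inj_on f (tree_verts s)"
    and touch: "touching (f ` tree_verts s) E = tree_edges s f" by (auto simp: embeddings_def)
  let ?A = "f ` tree_verts s"
  have TE: "tree_edges s f \<subseteq> E" using touch by (auto simp: touching_def)
  have adj1: "link_adj E (f x) (f y)" if "tree_adj s x y" "x \<in> tree_verts s" "y \<in> tree_verts s" for x y
  proof -
    have "x \<noteq> y" using that by (auto simp: tree_adj_def)
    then have "f x \<noteq> f y" using f(2) that by (auto dest: inj_onD)
    then have "(f x, f y) \<in> tree_edges s f \<or> (f y, f x) \<in> tree_edges s f"
      using that tree_adj_sym[of s x y] unfolding tree_edges_def by (cases "f x < f y") force+
    then show ?thesis using TE by (auto simp: link_adj_def)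
  qed
  have edge: "tree_adj s x y" if xy: "x \<in> tree_verts s" "y \<in> tree_verts s" and l: "link_adj E (f x) (f y)" for x y
  proof -
    have *: "tree_adj s u v" if uv: "u \<in> tree_verts s" "v \<in> tree_verts s" "(f u, f v) \<in> E" for u v
    proof -
      have "(f u, f v) \<in> tree_edges s f" using uv touch by (auto simp: touching_def)
      then obtain u' v' where "u' \<in> tree_verts s" "v' \<in> tree_verts s" "tree_adj s u' v'" "f u = f u'" "f v = f v'"
        unfolding tree_edges_def by auto
      moreover from this have "u = u'" "v = v'" using inj_onD[OF f(2)] uv by auto
      ultimately show ?thesis by simp
    qed
    show ?thesis using l *[OF xy] *[OF xy(2,1)] tree_adj_sym[of s x y] by (auto simp: link_adj_def)
  qed
  have cl: "cluster E (f []) = ?A"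
  proof
    show "cluster E (f []) \<subseteq> ?A"
    proof (rule cluster_closed)
      fix y z assume y: "y \<in> ?A" and l: "link_adj E y z"
      then have "(y, z) \<in> touching ?A E \<or> (z, y) \<in> touching ?A E" by (auto simp: link_adj_def touching_def)
      then have "(y, z) \<in> prs ?A \<or> (z, y) \<in> prs ?A" using touch tree_edges_subset[of s f] by auto
      then show "z \<in> ?A" unfolding prs_def by blast
    qed simp
    have "f v \<in> cluster E (f [])" if "v \<in> tree_verts s" for v
      using that
    proof (induction v rule: rev_induct)
      case (snoc k u)
      then have u: "u \<in> tree_verts s" using snoc_in_tree_verts by blast
      then have "tree_adj s u (u @ [k])" using snoc.prems by (auto simp: tree_adj_def)
      then have "link_adj E (f u) (f (u @ [k]))" using adj1 u snoc.prems by blast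
      then show ?case using snoc.IH[OF u] cluster_step by blast
    qed simp
    then show "?A \<subseteq> cluster E (f [])" by blast
  qed
  have "card ?A = tree_size s" using card_image[OF f(2)] by (simp add: card_tree_verts)
  then have "in_sol \<alpha> E (f [])" using cl \<alpha> by (simp add: in_sol_def)
  moreover have "f [] < N" using PiE_mem[OF f(1) Nil_in_tree_verts] by simp
  moreover have "f \<in> isos s (cluster E (f [])) (link_adj E) (f [])"
    unfolding isos_def cl using f adj1 edge by (auto simp: bij_betw_def PiE_def)
  ultimately show "f \<in> (\<Union>i\<in>{v\<in>{..<N}. in_sol \<alpha> E v}. isos s (cluster E i) (link_adj E) i)" by blast
next
  fix f assume "f \<in> (\<Union>i\<in>{v\<in>{..<N}. in_sol \<alpha> E v}. isos s (cluster E i) (link_adj E) i)"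
  then obtain i where i: "i < N" and f: "f \<in> isos s (cluster E i) (link_adj E) i" by auto
  have EN: "E \<subseteq> {..<N} \<times> {..<N}" using E prs_subset by blast
  have "cluster E i \<subseteq> {..<N}" by (rule cluster_subset[OF EN]) (use i in simp)
  then have emb: "f \<in> embeddings s N"
    using isosD(3,5,7)[OF f] by (auto simp: embeddings_def PiE_def)
  have img: "f ` tree_verts s = cluster E i" by (rule isosD(6)[OF f])
  have "touching (cluster E i) E = tree_edges s f"
  proof (intro equalityI subsetI)
    fix p assume p: "p \<in> touching (cluster E i) E"
    obtain a b where ab: "p = (a, b)" by (cases p)
    have pE: "(a, b) \<in> E" and c: "a \<in> cluster E i \<or> b \<in> cluster E i" using p ab by (auto simp: touching_def)
    have l: "link_adj E a b" "link_adj E b a" using pE by (auto simp: link_adj_def)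
    have "a \<in> cluster E i" "b \<in> cluster E i" using c l cluster_step by blast+
    then obtain x y where xy: "x \<in> tree_verts s" "y \<in> tree_verts s" "f x = a" "f y = b"
      unfolding img[symmetric] by blast
    moreover have "tree_adj s x y" using isosD(4)[OF f xy(1,2)] l xy by simp
    moreover have "a < b" using pE E by (auto simp: prs_def)
    ultimately show "p \<in> tree_edges s f" unfolding tree_edges_def ab by blast
  next
    fix p assume "p \<in> tree_edges s f"
    then obtain x y where xy: "x \<in> tree_verts s" "y \<in> tree_verts s" "tree_adj s x y" "p = (f x, f y)" "f x < f y"
      unfolding tree_edges_def by blast
    have "link_adj E (f x) (f y)" using isosD(4)[OF f xy(1,2)] xy(3) by simp
    moreover have "(f y, f x) \<notin> E" using E xy(5) by (auto simp: prs_def)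
    ultimately have "p \<in> E" using xy by (auto simp: link_adj_def)
    then show "p \<in> touching (cluster E i) E" using xy isosD(7)[OF f] by (auto simp: touching_def)
  qed
  then show "f \<in> {f \<in> embeddings s N. touching (f ` tree_verts s) E = tree_edges s f}"
    using emb img by simp
qed

lemma finite_embeddings [simp]: "finite (embeddings s N)"
  unfolding embeddings_def by (rule finite_subset[of _ "tree_verts s \<rightarrow>\<^sub>E {..<N}"]) (auto intro: finite_PiE)

lemma tree_count_eq:
  assumes \<alpha>: "real (tree_size s) < \<alpha>"
  shows "tree_count \<alpha> s N e t = (\<Sum>i\<in>{v\<in>{..<N}. in_sol \<alpha> (sol_graph \<alpha> N e t) v}.
    real (card (isos s (cluster (sol_graph \<alpha> N e t) i) (link_adj (sol_graph \<alpha> N e t)) i)))"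
proof -
  let ?E = "sol_graph \<alpha> N e t"
  have "tree_count \<alpha> s N e t = real (card {f \<in> embeddings s N. touching (f ` tree_verts s) ?E = tree_edges s f})"
    unfolding tree_count_def by (simp add: of_bool_def sum.If_cases Int_def)
  also have "\<dots> = real (card (\<Union>i\<in>{v\<in>{..<N}. in_sol \<alpha> ?E v}. isos s (cluster ?E i) (link_adj ?E) i))"
    using embedding_iff_iso[OF graph_subset \<alpha>] by simp
  also have "card (\<Union>i\<in>{v\<in>{..<N}. in_sol \<alpha> ?E v}. isos s (cluster ?E i) (link_adj ?E) i) =
     (\<Sum>i\<in>{v\<in>{..<N}. in_sol \<alpha> ?E v}. card (isos s (cluster ?E i) (link_adj ?E) i))"
  proof (rule card_UN_disjoint)
    show "\<forall>i\<in>{v\<in>{..<N}. in_sol \<alpha> ?E v}. finite (isos s (cluster ?E i) (link_adj ?E) i)"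
      by (auto intro!: finite_isos)
    show "\<forall>i\<in>{v\<in>{..<N}. in_sol \<alpha> ?E v}. \<forall>j\<in>{v\<in>{..<N}. in_sol \<alpha> ?E v}. i \<noteq> j \<longrightarrow>
      isos s (cluster ?E i) (link_adj ?E) i \<inter> isos s (cluster ?E j) (link_adj ?E) j = {}"
      by (auto dest: isosD(2))
  qed simp
  finally show ?thesis by simp
qed

text \<open>After exchanging the sums, each particle in solution contributes at most 1 by
  \<open>sum_isos_le_1\<close>. The divergence of the tree weights beyond \<open>1/e\<close> will be
  played against this bound.\<close>

lemma tree_count_sum_le:
  assumes "finite F" "\<And>s. s \<in> F \<Longrightarrow> real (tree_size s) < \<alpha>"
  shows "(\<Sum>s\<in>F. tree_count \<alpha> s N e t / real (orderings s)) \<le> real N"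
proof -
  let ?E = "sol_graph \<alpha> N e t"
  let ?S = "{v\<in>{..<N}. in_sol \<alpha> ?E v}"
  have "(\<Sum>s\<in>F. tree_count \<alpha> s N e t / real (orderings s)) =
     (\<Sum>s\<in>F. \<Sum>i\<in>?S. real (card (isos s (cluster ?E i) (link_adj ?E) i)) / real (orderings s))"
    by (rule sum.cong) (simp_all add: tree_count_eq assms(2) sum_divide_distrib)
  also have "\<dots> = (\<Sum>i\<in>?S. \<Sum>s\<in>F. real (card (isos s (cluster ?E i) (link_adj ?E) i)) / real (orderings s))"
    by (rule sum.swap)
  also have "\<dots> \<le> (\<Sum>i\<in>?S. 1)" by (rule sum_mono) (rule sum_isos_le_1[OF assms(1)])
  also have "\<dots> \<le> real N"
  proof -
    have "card ?S \<le> card {..<N}" by (intro card_mono) auto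
    then show ?thesis by simp
  qed
  finally show ?thesis .
qed

lemma tree_count_shape_class:
  assumes "real (tree_size T) < \<alpha>"
  shows "(\<Sum>s\<in>shape_class T. tree_count \<alpha> s N e t / real (orderings s)) =
    real (card {i\<in>{..<N}. in_sol \<alpha> (sol_graph \<alpha> N e t) i \<and>
      rooted_iso (tree_verts T) (tree_adj T) [] (cluster (sol_graph \<alpha> N e t) i) (link_adj (sol_graph \<alpha> N e t)) i})"
proof -
  let ?E = "sol_graph \<alpha> N e t"
  let ?S = "{v\<in>{..<N}. in_sol \<alpha> ?E v}"
  let ?iso = "\<lambda>i. rooted_iso (tree_verts T) (tree_adj T) [] (cluster ?E i) (link_adj ?E) i"
  have sz: "real (tree_size s) < \<alpha>" if "s \<in> shape_class T" for s
    using shape_class_invariants(2)[OF that] assms by simp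
  have one: "(\<Sum>s\<in>shape_class T. real (card (isos s (cluster ?E i) (link_adj ?E) i)) / real (orderings s)) = of_bool (?iso i)" for i
  proof (cases "?iso i")
    case True
    then show ?thesis using sum_isos_shape_class[OF True] by simp
  next
    case False
    have "isos s (cluster ?E i) (link_adj ?E) i = {}" if "s \<in> shape_class T" for s
    proof (rule ccontr)
      assume "isos s (cluster ?E i) (link_adj ?E) i \<noteq> {}"
      then have a: "rooted_iso (tree_verts s) (tree_adj s) [] (cluster ?E i) (link_adj ?E) i"
        by (simp add: rooted_iso_iff_isos)
      have b: "rooted_iso (tree_verts T) (tree_adj T) [] (tree_verts s) (tree_adj s) []"
        by (rule rooted_iso_sym) (use that in simp)
      show False using rooted_iso_trans[OF b a] False by simp
    qed
    then show ?thesis using False by simp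
  qed
  have "(\<Sum>s\<in>shape_class T. tree_count \<alpha> s N e t / real (orderings s)) =
     (\<Sum>s\<in>shape_class T. \<Sum>i\<in>?S. real (card (isos s (cluster ?E i) (link_adj ?E) i)) / real (orderings s))"
    by (rule sum.cong) (simp_all only: tree_count_eq[OF sz] sum_divide_distrib)
  also have "\<dots> = (\<Sum>i\<in>?S. \<Sum>s\<in>shape_class T. real (card (isos s (cluster ?E i) (link_adj ?E) i)) / real (orderings s))"
    by (rule sum.swap)
  also have "\<dots> = (\<Sum>i\<in>?S. of_bool (?iso i))" by (simp only: one)
  also have "\<dots> = real (card {i\<in>?S. ?iso i})" by (simp add: of_bool_def sum.If_cases Int_def)
  finally show ?thesis by (simp add: conj_assoc)
qed

lemma tree_count_bounds: "0 \<le> tree_count \<alpha> s N e t" "tree_count \<alpha> s N e t \<le> real (card (embeddings s N))"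
proof -
  show "0 \<le> tree_count \<alpha> s N e t" unfolding tree_count_def by (rule sum_nonneg) simp
  have "tree_count \<alpha> s N e t \<le> (\<Sum>f\<in>embeddings s N. 1)" unfolding tree_count_def by (rule sum_mono) simp
  then show "tree_count \<alpha> s N e t \<le> real (card (embeddings s N))" by simp
qed

lemma measurable_tree_count [measurable]: "(\<lambda>e. tree_count \<alpha> s N e t) \<in> borel_measurable (particle_clocks N)"
  unfolding tree_count_def
  by (rule borel_measurable_of_count_space[where g = "\<lambda>E. \<Sum>f\<in>embeddings s N. of_bool (touching (f ` tree_verts s) E = tree_edges s f)"])
    (rule measurable_lk_clocks, auto)

text \<open>\<open>iso_mean\<close> depends on the set and its links only through their
  cardinalities, so every embedding contributes the same amount.\<close>

lemma tree_count_mean: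
  fixes \<psi> :: "real \<Rightarrow> real"
  assumes N: "0 < N" and t: "0 \<le> t" and \<alpha>: "real (tree_size s) < \<alpha>"
    and \<psi> [measurable]: "\<psi> \<in> borel_measurable borel" and \<psi>01: "\<And>w. 0 \<le> \<psi> w \<and> \<psi> w \<le> 1"
  shows "(\<integral>e. tree_count \<alpha> s N e t * \<psi> (gelled (1 / real N) \<alpha> {..<N} t e) \<partial>particle_clocks N) =
    real (card (embeddings s N)) * iso_mean (1 / real N) \<alpha> t N (tree_size s) (tree_size s - 1) \<psi>"
proof -
  let ?C = "particle_clocks N" and ?W = "gelled (1 / real N) \<alpha> {..<N} t"
  interpret C: prob_space ?C by (rule prob_space_clocks) (use N in simp)
  have [measurable]: "?W \<in> borel_measurable ?C" by (rule measurable_gelled) auto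
  let ?g = "\<lambda>f e. of_bool (touching (f ` tree_verts s) (sol_graph \<alpha> N e t) = tree_edges s f) * \<psi> (?W e)"
  have int: "integrable ?C (?g f)" for f
  proof (rule C.integrable_const_bound[where B = 1])
    have [measurable]: "Measurable.pred ?C (\<lambda>e. touching (f ` tree_verts s) (sol_graph \<alpha> N e t) = tree_edges s f)"
      by (rule pred_touching) auto
    show "?g f \<in> borel_measurable ?C" by measurable
  qed (use \<psi>01 in auto)
  have "(\<integral>e. tree_count \<alpha> s N e t * \<psi> (?W e) \<partial>?C) = (\<Sum>f\<in>embeddings s N. \<integral>e. ?g f e \<partial>?C)"
    unfolding tree_count_def sum_distrib_right by (rule Bochner_Integration.integral_sum) (rule int)
  also have "\<dots> = (\<Sum>f\<in>embeddings s N. iso_mean (1 / real N) \<alpha> t N (tree_size s) (tree_size s - 1) \<psi>)"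
  proof (rule sum.cong[OF refl])
    fix f assume f: "f \<in> embeddings s N"
    then have inj: "inj_on f (tree_verts s)" and sub: "f ` tree_verts s \<subseteq> {..<N}" by (auto simp: embeddings_def)
    show "(\<integral>e. ?g f e \<partial>?C) = iso_mean (1 / real N) \<alpha> t N (tree_size s) (tree_size s - 1) \<psi>"
      by (rule gel_mean_touching[OF sub _ \<alpha> tree_edges_subset card_tree_edges[OF inj] _ t \<psi>, where C = 1])
        (use card_image[OF inj] N \<psi>01 in \<open>auto simp: card_tree_verts\<close>)
  qed
  finally show ?thesis by simp
qed

lemma card_embeddings_limit: "(\<lambda>N. real (card (embeddings s N)) / real N ^ tree_size s) \<longlonglongrightarrow> 1"
proof -
  have c: "card (embeddings s N) = (\<Prod>j\<in>{0..<tree_size s}. N - j)" for N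
    unfolding embeddings_def
    using card_inj_on_subset_funcset[of "tree_verts s" "{..<N}" "tree_verts s"] by (simp add: card_tree_verts)
  have "(\<lambda>N. \<Prod>j\<in>{0..<tree_size s}. real (N - j) / real N) \<longlonglongrightarrow> (\<Prod>j\<in>{0..<tree_size s}. 1)"
  proof (rule tendsto_prod)
    fix j
    have "(\<lambda>N. (real N - real j) / real N) \<longlonglongrightarrow> 1" by real_asymp
    moreover have "eventually (\<lambda>N. (real N - real j) / real N = real (N - j) / real N) sequentially"
      using eventually_ge_at_top[of j] by eventually_elim (simp add: of_nat_diff)
    ultimately show "(\<lambda>N. real (N - j) / real N) \<longlonglongrightarrow> 1" by (rule Lim_transform_eventually)
  qed
  then show ?thesis by (simp add: c prod_dividef)
qed

text \<open>About \<open>N ^ m\<close> embeddings, each isolated with probability of order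
  \<open>1 / N ^ (m - 1)\<close>, give a number of order \<open>N\<close>; dividing by
  \<open>N\<close> leaves a density per particle. The weight \<open>\<psi>\<close> restricts the
  count to events expressed through the gelled time.\<close>

lemma tree_count_limit:
  fixes \<alpha> :: "nat \<Rightarrow> real" and \<psi> :: "nat \<Rightarrow> real \<Rightarrow> real"
  assumes \<alpha>: "filterlim \<alpha> at_top sequentially" and t: "0 \<le> t"
    and \<psi>: "\<And>N. \<psi> N \<in> borel_measurable borel" and \<psi>01: "\<And>N w. 0 \<le> \<psi> N w \<and> \<psi> N w \<le> 1"
  shows "(\<lambda>N. (\<integral>e. tree_count (\<alpha> N) s N e t * \<psi> N (gelled (1 / real N) (\<alpha> N) {..<N} t e) \<partial>particle_clocks N) / real N -
      t ^ (tree_size s - 1) * gel_mean (1 / real N) (\<alpha> N) t N (\<lambda>w. exp (- real (tree_size s) * (t - min w t)) * \<psi> N w)) \<longlonglongrightarrow> 0"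
proof -
  let ?m = "tree_size s"
  define I where "I N = real N ^ (?m - 1) * iso_mean (1 / real N) (\<alpha> N) t N ?m (?m - 1) (\<psi> N)" for N
  define G where "G N = gel_mean (1 / real N) (\<alpha> N) t N (\<lambda>w. exp (- real ?m * (t - min w t)) * \<psi> N w)" for N
  define r where "r N = real (card (embeddings s N)) / real N ^ ?m" for N
  have lim: "(\<lambda>N. I N - t ^ (?m - 1) * G N) \<longlonglongrightarrow> 0"
    unfolding I_def G_def by (rule iso_mean_limit[OF \<alpha> t \<psi> \<psi>01 tree_rate_limit])
  have G01: "0 \<le> G N \<and> G N \<le> 1" if "0 < N" for N
  proof -
    have "exp (- real ?m * (t - min w t)) * \<psi> N w \<le> 1 * 1" for w
      using \<psi>01[of N w] by (intro mult_mono) auto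
    moreover have "(\<lambda>w. exp (- real ?m * (t - min w t)) * \<psi> N w) \<in> borel_measurable borel" using \<psi>[of N] by measurable
    ultimately show ?thesis
      unfolding G_def using that t \<psi>01[of N] by (auto intro!: gel_mean_bounds)
  qed
  have ev: "eventually (\<lambda>N. real ?m < \<alpha> N \<and> 0 < N) sequentially"
    using filterlim_at_top_dense[THEN iffD1, OF \<alpha>, rule_format, of "real ?m"] eventually_gt_at_top[of 0]
    by eventually_elim auto
  have "(\<lambda>N. r N * (I N - t ^ (?m - 1) * G N) + (r N - 1) * (t ^ (?m - 1) * G N)) \<longlonglongrightarrow> 1 * 0 + 0"
  proof (intro tendsto_add tendsto_mult lim)
    show r1: "r \<longlonglongrightarrow> 1" unfolding r_def by (rule card_embeddings_limit)
    have "(\<lambda>N. r N - 1) \<longlonglongrightarrow> 0" using tendsto_diff[OF r1 tendsto_const[of 1]] by simp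
    then show "(\<lambda>N. (r N - 1) * (t ^ (?m - 1) * G N)) \<longlonglongrightarrow> 0"
    proof (rule lim_null_mult_right_bounded[where B = "t ^ (?m - 1)"])
      show "eventually (\<lambda>N. norm (t ^ (?m - 1) * G N) \<le> t ^ (?m - 1)) sequentially"
        using ev by eventually_elim (use G01 t in \<open>auto simp: abs_mult mult_left_le\<close>)
    qed
  qed
  then have "(\<lambda>N. r N * I N - t ^ (?m - 1) * G N) \<longlonglongrightarrow> 0" by (simp add: algebra_simps)
  moreover have "eventually (\<lambda>N. r N * I N - t ^ (?m - 1) * G N =
     (\<integral>e. tree_count (\<alpha> N) s N e t * \<psi> N (gelled (1 / real N) (\<alpha> N) {..<N} t e) \<partial>particle_clocks N) / real N - t ^ (?m - 1) * G N) sequentially"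
    using ev
  proof eventually_elim
    case (elim N)
    have "real N ^ ?m = real N ^ (?m - 1) * real N" using tree_size_pos[of s] by (metis One_nat_def Suc_pred power_Suc2)
    then have "r N * I N = real (card (embeddings s N)) * iso_mean (1 / real N) (\<alpha> N) t N ?m (?m - 1) (\<psi> N) / real N"
      unfolding r_def I_def using elim by (simp add: field_simps)
    then show ?case using tree_count_mean[of N t s "\<alpha> N" "\<psi> N"] elim t \<psi> \<psi>01 by simp
  qed
  ultimately have "(\<lambda>N. (\<integral>e. tree_count (\<alpha> N) s N e t * \<psi> N (gelled (1 / real N) (\<alpha> N) {..<N} t e) \<partial>particle_clocks N) / real N - t ^ (?m - 1) * G N) \<longlonglongrightarrow> 0"
    by (rule Lim_transform_eventually)
  then show ?thesis by (simp only: G_def)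
qed

subsection \<open>Lower bound on the time integral of the mass in solution\<close>

lemma gel_mean_mono:
  assumes "0 < \<rho>" "0 \<le> t" "h \<in> borel_measurable borel" "h' \<in> borel_measurable borel"
    and "\<And>w. 0 \<le> w \<Longrightarrow> w \<le> \<rho> * real K * t \<Longrightarrow> \<bar>h w\<bar> \<le> C" "\<And>w. 0 \<le> w \<Longrightarrow> w \<le> \<rho> * real K * t \<Longrightarrow> \<bar>h' w\<bar> \<le> C'"
    and "\<And>w. 0 \<le> w \<Longrightarrow> w \<le> \<rho> * real K * t \<Longrightarrow> h w \<le> h' w"
  shows "gel_mean \<rho> \<alpha> t K h \<le> gel_mean \<rho> \<alpha> t K h'"
  unfolding gel_mean_def
  by (rule integral_mono[OF integrable_gelled[OF assms(1-3,5)] integrable_gelled[OF assms(1,2,4,6)]])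
    (use assms gelled_bounds[of "{..<K}" \<rho> t \<alpha>] in auto)

text \<open>On the event \<open>X(t) \<le> c\<close> with \<open>c = 1 + ln t - d\<close>, trees of
  size \<open>m\<close> have weight at least \<open>t ^ (m - 1) * exp (- m * c) = x ^ m / t\<close>,
  where \<open>x = t * exp (- c) = exp (d - 1)\<close> exceeds \<open>1/e\<close>. Finitely many
  trees then have arbitrarily large total weight, although their mass is at most 1, so the event is
  unlikely.\<close>

lemma time_in_sol_lower:
  fixes \<alpha> :: "nat \<Rightarrow> real"
  assumes \<alpha>: "filterlim \<alpha> at_top sequentially" and t: "0 < t" and d: "0 < d"
  shows "(\<lambda>N. gel_mean (1 / real N) (\<alpha> N) t N (\<lambda>w. of_bool (t - w \<le> 1 + ln t - d))) \<longlonglongrightarrow> 0"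
proof -
  define c where "c = 1 + ln t - d"
  define \<psi> where "\<psi> w = (of_bool (t - w \<le> c) :: real)" for w
  define x where "x = t * exp (- c)"
  define P where "P N = gel_mean (1 / real N) (\<alpha> N) t N \<psi>" for N
  have [measurable]: "\<psi> \<in> borel_measurable borel" unfolding \<psi>_def[abs_def] by measurable
  have \<psi>01: "0 \<le> \<psi> w \<and> \<psi> w \<le> 1" for w by (simp add: \<psi>_def)
  have "x = exp (- 1 + d)"
    unfolding x_def c_def using t by (simp add: exp_diff exp_add exp_minus field_simps)
  then have x: "exp (- 1) < x" using d by simp
  have P0: "0 \<le> P N" if "0 < N" for N
    unfolding P_def using that t \<psi>01 by (intro gel_mean_bounds(1)) auto
  have small: "eventually (\<lambda>N. norm (P N) < \<epsilon>) sequentially" if \<epsilon>: "0 < \<epsilon>" for \<epsilon>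
  proof -
    \<comment> \<open>The mass on the event is at most 1, and the limit errors of the finitely many
      trees eventually add up to less than 1; a total weight above \<open>3 / \<epsilon>\<close>
      then forces a probability below \<open>\<epsilon>\<close>.\<close>
    obtain F where F: "finite F" "t * (3 / \<epsilon>) < (\<Sum>s\<in>F. x ^ tree_size s / real (orderings s))"
      using tree_sum_unbounded[OF x] by blast
    define D where "D s N = (\<integral>e. tree_count (\<alpha> N) s N e t * \<psi> (gelled (1 / real N) (\<alpha> N) {..<N} t e) \<partial>particle_clocks N) / real N -
      t ^ (tree_size s - 1) * gel_mean (1 / real N) (\<alpha> N) t N (\<lambda>w. exp (- real (tree_size s) * (t - min w t)) * \<psi> w)" for s N
    have "D s \<longlonglongrightarrow> 0" for s
      unfolding D_def by (rule tree_count_limit[OF \<alpha>]) (use t \<psi>01 in auto)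
    then have "(\<lambda>N. \<Sum>s\<in>F. D s N / real (orderings s)) \<longlonglongrightarrow> (\<Sum>s\<in>F. 0 / real (orderings s))"
      by (intro tendsto_sum tendsto_divide tendsto_const) auto
    then have "(\<lambda>N. \<Sum>s\<in>F. D s N / real (orderings s)) \<longlonglongrightarrow> 0" by simp
    from tendstoD[OF this zero_less_one]
    have "eventually (\<lambda>N. norm (\<Sum>s\<in>F. D s N / real (orderings s)) < 1) sequentially"
      by (simp add: dist_norm)
    moreover have "eventually (\<lambda>N. Max (insert 0 (tree_size ` F)) < \<alpha> N) sequentially"
      using \<alpha> by (simp add: filterlim_at_top_dense)
    ultimately show ?thesis using eventually_gt_at_top[of 0]
    proof eventually_elim
      case (elim N)
      let ?W = "gelled (1 / real N) (\<alpha> N) {..<N} t" and ?C = "particle_clocks N"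
      interpret C: prob_space ?C by (rule prob_space_clocks) (use elim in simp)
      have [measurable]: "?W \<in> borel_measurable ?C" by (rule measurable_gelled) auto
      have sz: "real (tree_size s) < \<alpha> N" if "s \<in> F" for s
      proof -
        have "tree_size s \<le> Max (insert 0 (tree_size ` F))" using F(1) that by (intro Max_ge) auto
        then show ?thesis using elim(2) by linarith
      qed
      have int: "integrable ?C (\<lambda>e. tree_count (\<alpha> N) s N e t * \<psi> (?W e))" for s
      proof (rule C.integrable_const_bound[where B = "real (card (embeddings s N))"])
        have "\<bar>tree_count (\<alpha> N) s N e t * \<psi> (?W e)\<bar> \<le> real (card (embeddings s N)) * 1" for e
          unfolding abs_mult using tree_count_bounds[of "\<alpha> N" s N e t] \<psi>01[of "?W e"] by (intro mult_mono) auto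
        then show "AE e in ?C. norm (tree_count (\<alpha> N) s N e t * \<psi> (?W e)) \<le> real (card (embeddings s N))" by simp
      qed measurable
      have "(\<Sum>s\<in>F. (\<integral>e. tree_count (\<alpha> N) s N e t * \<psi> (?W e) \<partial>?C) / real N / real (orderings s)) =
         (\<integral>e. (\<Sum>s\<in>F. tree_count (\<alpha> N) s N e t / real (orderings s)) * \<psi> (?W e) \<partial>?C) / real N"
      proof -
        have "(\<integral>e. (\<Sum>s\<in>F. tree_count (\<alpha> N) s N e t / real (orderings s)) * \<psi> (?W e) \<partial>?C) =
          (\<integral>e. (\<Sum>s\<in>F. tree_count (\<alpha> N) s N e t * \<psi> (?W e) / real (orderings s)) \<partial>?C)"
          by (simp add: sum_distrib_right)
        also have "\<dots> = (\<Sum>s\<in>F. \<integral>e. tree_count (\<alpha> N) s N e t * \<psi> (?W e) / real (orderings s) \<partial>?C)"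
          by (rule Bochner_Integration.integral_sum) (use int in auto)
        finally show ?thesis by (simp add: sum_divide_distrib mult.commute)
      qed
      also have "\<dots> \<le> (\<integral>e. real N \<partial>?C) / real N"
      proof (intro divide_right_mono integral_mono)
        show "integrable ?C (\<lambda>e. (\<Sum>s\<in>F. tree_count (\<alpha> N) s N e t / real (orderings s)) * \<psi> (?W e))"
          unfolding sum_distrib_right times_divide_eq_left
          by (intro Bochner_Integration.integrable_sum integrable_divide int)
        fix e
        have "0 \<le> (\<Sum>s\<in>F. tree_count (\<alpha> N) s N e t / real (orderings s))"
          by (intro sum_nonneg divide_nonneg_nonneg tree_count_bounds) auto
        then have "(\<Sum>s\<in>F. tree_count (\<alpha> N) s N e t / real (orderings s)) * \<psi> (?W e) \<le> real N * 1"
          using tree_count_sum_le[OF F(1) sz, of N e t] \<psi>01[of "?W e"] by (intro mult_mono) auto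
        then show "(\<Sum>s\<in>F. tree_count (\<alpha> N) s N e t / real (orderings s)) * \<psi> (?W e) \<le> real N" by simp
      qed auto
      also have "\<dots> = 1" using elim by (simp add: C.prob_space)
      finally have up: "(\<Sum>s\<in>F. (\<integral>e. tree_count (\<alpha> N) s N e t * \<psi> (?W e) \<partial>?C) / real N / real (orderings s)) \<le> 1" .
      have low: "x ^ tree_size s / t * P N \<le>
        t ^ (tree_size s - 1) * gel_mean (1 / real N) (\<alpha> N) t N (\<lambda>w. exp (- real (tree_size s) * (t - min w t)) * \<psi> w)" for s
      proof -
        let ?m = "tree_size s"
        have "x ^ ?m = t ^ (?m - 1) * t * exp (- real ?m * c)"
          unfolding x_def power_mult_distrib exp_of_nat_mult[symmetric]
          using tree_size_pos[of s] by (cases ?m) (auto simp: algebra_simps)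
        then have "x ^ ?m / t * P N = t ^ (?m - 1) * gel_mean (1 / real N) (\<alpha> N) t N (\<lambda>w. exp (- real ?m * c) * \<psi> w)"
          using t by (simp add: P_def gel_mean_cmult)
        also have "\<dots> \<le> t ^ (?m - 1) * gel_mean (1 / real N) (\<alpha> N) t N (\<lambda>w. exp (- real ?m * (t - min w t)) * \<psi> w)"
        proof (intro mult_left_mono gel_mean_mono)
          fix w assume w: "0 \<le> w" "w \<le> 1 / real N * real N * t"
          then have "w \<le> t" using elim by simp
          have "exp (- real ?m * (t - min w t)) * \<psi> w \<le> 1 * 1" using \<psi>01[of w] by (intro mult_mono) auto
          then show "\<bar>exp (- real ?m * (t - min w t)) * \<psi> w\<bar> \<le> 1" using \<psi>01[of w] by simp
          show "\<bar>exp (- real ?m * c) * \<psi> w\<bar> \<le> exp (- real ?m * c)" by (simp add: \<psi>_def)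
          show "exp (- real ?m * c) * \<psi> w \<le> exp (- real ?m * (t - min w t)) * \<psi> w"
            using \<open>w \<le> t\<close> by (auto simp: \<psi>_def mult_left_mono)
        qed (use elim t in auto)
        finally show ?thesis .
      qed
      have "(3 / \<epsilon>) * P N \<le> (\<Sum>s\<in>F. x ^ tree_size s / real (orderings s)) / t * P N"
        using F(2) t P0[of N] elim by (intro mult_right_mono) (auto simp: field_simps)
      also have "\<dots> = (\<Sum>s\<in>F. x ^ tree_size s / t * P N / real (orderings s))"
        unfolding sum_divide_distrib sum_distrib_right by (rule sum.cong) (simp_all add: mult_ac)
      also have "\<dots> \<le> (\<Sum>s\<in>F. t ^ (tree_size s - 1) * gel_mean (1 / real N) (\<alpha> N) t N (\<lambda>w. exp (- real (tree_size s) * (t - min w t)) * \<psi> w) / real (orderings s))"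
        by (intro sum_mono divide_right_mono low) auto
      also have "\<dots> = (\<Sum>s\<in>F. (\<integral>e. tree_count (\<alpha> N) s N e t * \<psi> (?W e) \<partial>?C) / real N / real (orderings s)) - (\<Sum>s\<in>F. D s N / real (orderings s))"
        unfolding sum_subtractf[symmetric] diff_divide_distrib[symmetric] by (simp add: D_def)
      also have "\<dots> \<le> 1 + 1" using up elim(1) by simp
      finally have "3 * P N \<le> 2 * \<epsilon>" using \<epsilon> by (simp add: field_simps)
      then show ?case using P0[of N] elim \<epsilon> by simp
    qed
  qed
  have "P \<longlonglongrightarrow> 0"
    unfolding tendsto_iff dist_norm using small by simp
  then show ?thesis unfolding P_def \<psi>_def[abs_def] c_def .
qed

subsection \<open>Small clusters\<close>

definition connected_on :: "nat set \<Rightarrow> (nat \<times> nat) set \<Rightarrow> bool" where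
  "connected_on A H \<longleftrightarrow> (\<forall>x\<in>A. A \<subseteq> cluster H x)"

definition components :: "nat \<Rightarrow> nat \<Rightarrow> nat \<Rightarrow> (nat set \<times> (nat \<times> nat) set) set" where
  "components N m k = {(A, H). A \<subseteq> {..<N} \<and> card A = m \<and> H \<subseteq> prs A \<and> connected_on A H \<and> card H = k}"

text \<open>A vertex set is grown from \<open>x\<close>: as long as it is not all of
  \<open>A\<close>, connectedness supplies a link leaving it, and that link has not been counted
  before.\<close>

lemma connected_on_card:
  assumes A: "finite A" and H: "H \<subseteq> prs A" and c: "connected_on A H"
  shows "card A \<le> card H + 1"
proof (cases "A = {}")
  case False
  then obtain x where x: "x \<in> A" by blast
  have finH: "finite H" by (rule finite_subset[OF H finite_prs[OF A]])
  have "\<exists>U\<subseteq>A. x \<in> U \<and> card U = Suc k \<and> k \<le> card {p\<in>H. fst p \<in> U \<and> snd p \<in> U}" if "Suc k \<le> card A" for k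
    using that
  proof (induction k)
    case 0
    show ?case by (rule exI[of _ "{x}"]) (use x in auto)
  next
    case (Suc k)
    then obtain U where U: "U \<subseteq> A" "x \<in> U" "card U = Suc k" "k \<le> card {p\<in>H. fst p \<in> U \<and> snd p \<in> U}" by auto
    have "\<exists>y\<in>U. \<exists>z. z \<notin> U \<and> link_adj H y z"
    proof (rule ccontr)
      assume "\<not> (\<exists>y\<in>U. \<exists>z. z \<notin> U \<and> link_adj H y z)"
      then have "cluster H x \<subseteq> U" using U(2) by (intro cluster_closed) auto
      then have "A \<subseteq> U" using c x by (auto simp: connected_on_def)
      then show False using U Suc.prems by auto
    qed
    then obtain y z where yz: "y \<in> U" "z \<notin> U" "link_adj H y z" by blast
    then have zA: "z \<in> A" using H by (auto simp: link_adj_def prs_def)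
    let ?in = "\<lambda>U. {p\<in>H. fst p \<in> U \<and> snd p \<in> U}"
    have fU: "finite U" by (rule finite_subset[OF U(1) A])
    obtain p where p: "p \<in> H" "p = (y, z) \<or> p = (z, y)" using yz(3) by (auto simp: link_adj_def)
    have "insert p (?in U) \<subseteq> ?in (insert z U)" using p yz by auto
    then have "card (insert p (?in U)) \<le> card (?in (insert z U))" using finH by (intro card_mono) auto
    moreover have "p \<notin> ?in U" using p yz by auto
    ultimately have "Suc k \<le> card (?in (insert z U))" using U(4) finH by simp
    moreover have "card (insert z U) = Suc (Suc k)" using yz fU U(3) by simp
    moreover have "insert z U \<subseteq> A" "x \<in> insert z U" using zA U by auto
    ultimately show ?case by blast
  qed
  note grow = this
  have "0 < card A" using x A by (auto simp: card_gt_0_iff)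
  then have "Suc (card A - 1) \<le> card A" by simp
  from grow[OF this] obtain U where "card A - 1 \<le> card {p\<in>H. fst p \<in> U \<and> snd p \<in> U}" by blast
  also have "\<dots> \<le> card H" using finH by (intro card_mono) auto
  finally show ?thesis by simp
qed simp

lemma components_empty: "k < m - 1 \<Longrightarrow> components N m k = {}"
proof -
  assume k: "k < m - 1"
  have "m \<le> k + 1" if "(A, H) \<in> components N m k" for A H
  proof -
    have A: "A \<subseteq> {..<N}" "H \<subseteq> prs A" "connected_on A H" "card A = m" "card H = k"
      using that by (simp_all add: components_def)
    have "finite A" by (rule finite_subset[OF A(1)]) simp
    from connected_on_card[OF this A(2,3)] show ?thesis using A by simp
  qed
  note le = this
  have no: "(A, H) \<notin> components N m k" for A H
  proof
    assume "(A, H) \<in> components N m k"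
    from le[OF this] show False using k by simp
  qed
  show ?thesis
  proof (rule equals0I)
    fix x assume "x \<in> components N m k"
    then show False using no[of "fst x" "snd x"] by simp
  qed
qed

text \<open>A crude count, at most \<open>N ^ m\<close> vertex sets and all sets of pairs inside; it
  has the right order in \<open>N\<close> for fixed \<open>m\<close>.\<close>

lemma components_finite_card:
  "finite (components N m k)" "real (card (components N m k)) \<le> real N ^ m * 2 ^ (m choose 2)"
proof -
  let ?As = "{A. A \<subseteq> {..<N} \<and> card A = m}"
  have sub: "components N m k \<subseteq> Sigma ?As (\<lambda>A. Pow (prs A))" by (auto simp: components_def)
  have fA: "finite A" if "A \<in> ?As" for A using that finite_subset[of A "{..<N}"] by auto
  have fin: "finite (Sigma ?As (\<lambda>A. Pow (prs A)))" using fA by (intro finite_SigmaI) auto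
  show "finite (components N m k)" by (rule finite_subset[OF sub fin])
  have "card (Sigma ?As (\<lambda>A. Pow (prs A))) = (\<Sum>A\<in>?As. card (Pow (prs A)))"
    using fA by (subst card_SigmaI) auto
  also have "\<dots> = (\<Sum>A\<in>?As. 2 ^ (m choose 2))"
  proof (rule sum.cong[OF refl])
    fix A assume A: "A \<in> ?As"
    show "card (Pow (prs A)) = 2 ^ (m choose 2)"
      using card_Pow[OF finite_prs[OF fA[OF A]]] card_prs[OF fA[OF A]] A by simp
  qed
  also have "\<dots> = (N choose m) * 2 ^ (m choose 2)" using n_subsets[of "{..<N}" m] by simp
  finally have "card (components N m k) \<le> (N choose m) * 2 ^ (m choose 2)"
    using card_mono[OF fin sub] by simp
  moreover have "N choose m \<le> N ^ m"
    by (cases "m \<le> N") (simp_all add: binomial_le_pow binomial_eq_0)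
  then have "(N choose m) * 2 ^ (m choose 2) \<le> N ^ m * 2 ^ (m choose 2)" by (rule mult_le_mono1)
  ultimately have "card (components N m k) \<le> N ^ m * 2 ^ (m choose 2)" by (rule le_trans)
  then have "real (card (components N m k)) \<le> real (N ^ m * 2 ^ (m choose 2))" by (simp only: of_nat_le_iff)
  then show "real (card (components N m k)) \<le> real N ^ m * 2 ^ (m choose 2)" by simp
qed

text \<open>The equation for \<open>touching\<close> keeps the exploration inside \<open>A\<close>,
  and connectedness of \<open>H\<close> makes it reach all of \<open>A\<close>.\<close>

lemma cluster_of_component:
  assumes "H \<subseteq> prs A" "connected_on A H" "touching A E = H" "v \<in> A"
  shows "cluster E v = A"
proof
  show "cluster E v \<subseteq> A"
  proof (rule cluster_closed)
    fix y z assume y: "y \<in> A" and l: "link_adj E y z"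
    then have "(y, z) \<in> touching A E \<or> (z, y) \<in> touching A E" by (auto simp: link_adj_def touching_def)
    then have "(y, z) \<in> prs A \<or> (z, y) \<in> prs A" using assms by auto
    then show "z \<in> A" by (auto simp: prs_def)
  qed (rule assms(4))
  have "H \<subseteq> E" using assms(3) by (auto simp: touching_def)
  then show "A \<subseteq> cluster E v" using assms(2,4) cluster_mono[of H E v] by (auto simp: connected_on_def)
qed

lemma component_of_cluster:
  assumes E: "E \<subseteq> prs V"
  shows "touching (cluster E v) E \<subseteq> prs (cluster E v)"
    and "connected_on (cluster E v) (touching (cluster E v) E)"
proof -
  define A where "A = cluster E v"
  have "touching A E \<subseteq> prs A"
  proof
    fix p assume p: "p \<in> touching A E"
    obtain a b where ab: "p = (a, b)" by (cases p)
    have pE: "(a, b) \<in> E" and c: "a \<in> A \<or> b \<in> A" using p ab by (auto simp: touching_def)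
    have l: "link_adj E a b" "link_adj E b a" using pE by (auto simp: link_adj_def)
    have "a \<in> A" "b \<in> A" using c l cluster_step unfolding A_def by blast+
    then show "p \<in> prs A" using pE E ab by (auto simp: prs_def)
  qed
  then show "touching (cluster E v) E \<subseteq> prs (cluster E v)" by (simp only: A_def)
  have "connected_on A (touching A E)"
    unfolding connected_on_def
  proof
    fix x assume x: "x \<in> A"
    then have cx: "cluster E x = A" unfolding A_def by (rule cluster_eqI)
    have "cluster (touching A E) x = cluster E x"
      by (rule cluster_restrict) (auto simp: cx touching_def)
    then show "A \<subseteq> cluster (touching A E) x" using cx by simp
  qed
  then show "connected_on (cluster E v) (touching (cluster E v) E)" by (simp only: A_def)
qed

text \<open>Each small cluster is \<open>(A, H)\<close> for exactly one component and is seen by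
  each of its \<open>m\<close> members; double counting of these incidences gives the factor
  \<open>m\<close>. The range \<open>k \<le> m * m\<close> is chosen to contain every possible
  number of links.\<close>

lemma small_frac_components:
  assumes N: "0 < N" and M: "real M \<le> \<alpha>"
  shows "real N * small_frac \<alpha> (real M) N e t = (\<Sum>m\<in>{1..<M}. \<Sum>k\<le>m * m. \<Sum>(A, H)\<in>components N m k.
    real m * of_bool (touching A (sol_graph \<alpha> N e t) = H))"
proof -
  let ?E = "sol_graph \<alpha> N e t"
  have E: "?E \<subseteq> prs {..<N}" by (rule graph_subset)
  then have EN: "?E \<subseteq> {..<N} \<times> {..<N}" using prs_subset by blast
  have finE: "finite ?E" by simp
  have inner: "(\<Sum>m\<in>{1..<M}. \<Sum>k\<le>m * m. \<Sum>(A, H)\<in>components N m k. of_bool (v \<in> A \<and> touching A ?E = H)) =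
     (of_bool (card (cluster ?E v) < M) :: real)" if v: "v < N" for v
  proof -
    let ?A = "cluster ?E v"
    let ?H = "touching ?A ?E"
    have A: "?A \<subseteq> {..<N}" by (rule cluster_subset[OF EN]) (use v in simp)
    have c1: "1 \<le> card ?A" using card_cluster_pos[OF finE, of v] by simp
    have "card ?H \<le> card (prs ?A)" using component_of_cluster(1)[OF E, of v] finE by (intro card_mono) auto
    also have "\<dots> \<le> card (?A \<times> ?A)" using finE by (intro card_mono prs_subset) auto
    finally have cH: "card ?H \<le> card ?A * card ?A" by (simp add: card_cartesian_product)
    have mem: "(?A, ?H) \<in> components N m k \<longleftrightarrow> m = card ?A \<and> k = card ?H" for m k
      using A component_of_cluster[OF E, of v] by (auto simp: components_def)
    have "(\<Sum>(A, H)\<in>components N m k. of_bool (v \<in> A \<and> touching A ?E = H)) =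
       (of_bool (m = card ?A \<and> k = card ?H) :: real)" for m k
    proof -
      have "v \<in> A \<and> touching A ?E = H \<longleftrightarrow> (A, H) = (?A, ?H)" if "(A, H) \<in> components N m k" for A H
        using cluster_of_component[of H A ?E v] that by (auto simp: components_def)
      then have "(case x of (A, H) \<Rightarrow> of_bool (v \<in> A \<and> touching A ?E = H)) = (if x = (?A, ?H) then 1 else 0 :: real)"
        if "x \<in> components N m k" for x
        using that by (cases x) (simp only: prod.case of_bool_def)
      then have "(\<Sum>(A, H)\<in>components N m k. of_bool (v \<in> A \<and> touching A ?E = H)) =
        (\<Sum>x\<in>components N m k. (if x = (?A, ?H) then 1 else 0 :: real))"
        by (rule sum.cong[OF refl])
      also have "\<dots> = of_bool ((?A, ?H) \<in> components N m k)"
        using components_finite_card(1) by (simp add: of_bool_def)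
      finally show ?thesis using mem by simp
    qed
    then have "(\<Sum>m\<in>{1..<M}. \<Sum>k\<le>m * m. \<Sum>(A, H)\<in>components N m k. of_bool (v \<in> A \<and> touching A ?E = H)) =
       (\<Sum>m\<in>{1..<M}. \<Sum>k\<le>m * m. of_bool (m = card ?A \<and> k = card ?H) :: real)" by simp
    also have "\<dots> = (\<Sum>m\<in>{1..<M}. if m = card ?A then (\<Sum>k\<le>m * m. if k = card ?H then 1 else 0) else 0)"
      by (rule sum.cong) (auto simp: of_bool_def intro!: sum.cong)
    also have "\<dots> = of_bool (card ?A < M)"
      using c1 cH by (simp add: of_bool_def)
    finally show ?thesis .
  qed
  have sol: "in_sol \<alpha> ?E v" if "card (cluster ?E v) < M" for v
  proof -
    have "real (card (cluster ?E v)) < real M" using that by simp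
    then show ?thesis using M by (simp add: in_sol_def)
  qed
  have "real N * small_frac \<alpha> (real M) N e t = real (card {v\<in>{..<N}. in_sol \<alpha> ?E v \<and> real (card (cluster ?E v)) < real M})"
    using N by (simp add: small_frac_def)
  also have "{v\<in>{..<N}. in_sol \<alpha> ?E v \<and> real (card (cluster ?E v)) < real M} = {v\<in>{..<N}. card (cluster ?E v) < M}"
    using sol by auto
  also have "real (card {v\<in>{..<N}. card (cluster ?E v) < M}) = (\<Sum>v<N. of_bool (card (cluster ?E v) < M))"
    by (simp add: of_bool_def sum.If_cases Int_def)
  also have "\<dots> = (\<Sum>v<N. \<Sum>m\<in>{1..<M}. \<Sum>k\<le>m * m. \<Sum>(A, H)\<in>components N m k. of_bool (v \<in> A \<and> touching A ?E = H))"
    by (rule sum.cong) (use inner in auto)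
  also have "\<dots> = (\<Sum>m\<in>{1..<M}. \<Sum>k\<le>m * m. \<Sum>(A, H)\<in>components N m k. \<Sum>v<N. of_bool (v \<in> A \<and> touching A ?E = H))"
    unfolding sum.swap[of _ _ "{..<N}"] by (simp add: split_beta sum.swap[of _ _ "{..<N}"])
  also have "\<dots> = (\<Sum>m\<in>{1..<M}. \<Sum>k\<le>m * m. \<Sum>(A, H)\<in>components N m k. real m * of_bool (touching A ?E = H))"
  proof (intro sum.cong refl, clarify)
    fix m k A H assume AH: "(A, H) \<in> components N m k"
    then have A: "A \<subseteq> {..<N}" "card A = m" by (simp_all add: components_def)
    have "(\<Sum>v<N. of_bool (v \<in> A \<and> touching A ?E = H)) = (\<Sum>v<N. of_bool (v \<in> A)) * (of_bool (touching A ?E = H) :: real)"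
      by (cases "touching A ?E = H") simp_all
    also have "(\<Sum>v<N. of_bool (v \<in> A)) = real (card A)"
      using A(1) by (simp add: of_bool_def sum.If_cases Int_absorb1)
    finally show "(\<Sum>v<N. of_bool (v \<in> A \<and> touching A ?E = H)) = real m * of_bool (touching A ?E = H)"
      using A(2) by simp
  qed
  finally show ?thesis .
qed

text \<open>The number of components with a marked particle, relative to \<open>N ^ m\<close>. All
  dependence on time is kept in \<open>rescaled_mean\<close>, so that masses at two different times
  can be compared term by term.\<close>

definition comp_weight :: "nat \<Rightarrow> nat \<Rightarrow> nat \<Rightarrow> real" where
  "comp_weight N m k = real m * real (card (components N m k)) / real N ^ m"

lemma comp_weight_bounds: "0 \<le> comp_weight N m k" "0 < N \<Longrightarrow> comp_weight N m k \<le> real m * 2 ^ (m choose 2)"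
proof -
  assume N: "0 < N"
  have "real m * real (card (components N m k)) \<le> real m * (real N ^ m * 2 ^ (m choose 2))"
    by (intro mult_left_mono components_finite_card(2)) simp
  then have "comp_weight N m k \<le> real m * (real N ^ m * 2 ^ (m choose 2)) / real N ^ m"
    unfolding comp_weight_def by (rule divide_right_mono) simp
  then show "comp_weight N m k \<le> real m * 2 ^ (m choose 2)" using N by simp
qed (simp add: comp_weight_def)

definition rescaled_mean :: "(nat \<Rightarrow> real) \<Rightarrow> real \<Rightarrow> nat \<Rightarrow> nat \<Rightarrow> nat \<Rightarrow> real" where
  "rescaled_mean \<alpha> t N m k = real N ^ (m - 1) * iso_mean (1 / real N) (\<alpha> N) t N m k (\<lambda>_. 1)"

lemma small_frac_mean:
  assumes N: "0 < N" and M: "real M \<le> \<alpha> N" and t: "0 \<le> t"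
  shows "(\<integral>e. small_frac (\<alpha> N) (real M) N e t \<partial>particle_clocks N) =
    (\<Sum>m\<in>{1..<M}. \<Sum>k\<le>m * m. comp_weight N m k * rescaled_mean \<alpha> t N m k)"
proof -
  let ?C = "particle_clocks N"
  interpret C: prob_space ?C by (rule prob_space_clocks) (use N in simp)
  have int: "integrable ?C (\<lambda>e. real m * of_bool (touching A (sol_graph (\<alpha> N) N e t) = H))" for m A H
  proof (rule C.integrable_const_bound[where B = "real m"])
    have [measurable]: "Measurable.pred ?C (\<lambda>e. touching A (sol_graph (\<alpha> N) N e t) = H)"
      by (rule pred_touching) auto
    show "(\<lambda>e. real m * of_bool (touching A (sol_graph (\<alpha> N) N e t) = H)) \<in> borel_measurable ?C" by measurable
  qed auto
  have one: "(\<integral>e. real m * of_bool (touching A (sol_graph (\<alpha> N) N e t) = H) \<partial>?C) =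
      real m * iso_mean (1 / real N) (\<alpha> N) t N m k (\<lambda>_. 1)" if "(A, H) \<in> components N m k" "m < M" for A H m k
  proof -
    have *: "A \<subseteq> {..<N}" "card A = m" "H \<subseteq> prs A" "card H = k" using that by (simp_all add: components_def)
    have "real m < \<alpha> N" using that M by linarith
    from gel_mean_touching[OF *(1,2) this *(3,4) _ t, of "1 / real N" "\<lambda>_. 1" 1] N show ?thesis by simp
  qed
  have "real N * (\<integral>e. small_frac (\<alpha> N) (real M) N e t \<partial>?C) = (\<integral>e. real N * small_frac (\<alpha> N) (real M) N e t \<partial>?C)" by simp
  also have "\<dots> = (\<integral>e. (\<Sum>m\<in>{1..<M}. \<Sum>k\<le>m * m. \<Sum>(A, H)\<in>components N m k.
    real m * of_bool (touching A (sol_graph (\<alpha> N) N e t) = H)) \<partial>?C)"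
    unfolding small_frac_components[OF N M] ..
  also have "\<dots> = (\<Sum>m\<in>{1..<M}. \<Sum>k\<le>m * m. \<Sum>(A, H)\<in>components N m k.
    \<integral>e. real m * of_bool (touching A (sol_graph (\<alpha> N) N e t) = H) \<partial>?C)"
  proof -
    define f where "f m x e = real m * of_bool (touching (fst x) (sol_graph (\<alpha> N) N e t) = snd x)" for m x e
    have "integrable ?C (f m x)" for m x unfolding f_def using int by simp
    then have "(\<integral>e. (\<Sum>m\<in>{1..<M}. \<Sum>k\<le>m * m. \<Sum>x\<in>components N m k. f m x e) \<partial>?C) =
       (\<Sum>m\<in>{1..<M}. \<Sum>k\<le>m * m. \<Sum>x\<in>components N m k. \<integral>e. f m x e \<partial>?C)"
      by (simp add: Bochner_Integration.integral_sum Bochner_Integration.integrable_sum)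
    then show ?thesis unfolding f_def split_beta .
  qed
  also have "\<dots> = (\<Sum>m\<in>{1..<M}. \<Sum>k\<le>m * m. \<Sum>(A, H)\<in>components N m k. real m * iso_mean (1 / real N) (\<alpha> N) t N m k (\<lambda>_. 1))"
    by (intro sum.cong refl, clarify) (rule one, auto)
  also have "\<dots> = (\<Sum>m\<in>{1..<M}. \<Sum>k\<le>m * m. real N * (comp_weight N m k * rescaled_mean \<alpha> t N m k))"
  proof (intro sum.cong refl)
    fix m k assume "m \<in> {1..<M}"
    then have "real N ^ m = real N ^ (m - 1) * real N" by (metis One_nat_def Suc_pred' atLeastLessThan_iff less_eq_Suc_le power_Suc2)
    then show "(\<Sum>(A, H)\<in>components N m k. real m * iso_mean (1 / real N) (\<alpha> N) t N m k (\<lambda>_. 1)) =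
        real N * (comp_weight N m k * rescaled_mean \<alpha> t N m k)"
      unfolding comp_weight_def rescaled_mean_def using N by (simp add: split_beta)
  qed
  finally show ?thesis using N by (simp add: sum_distrib_left[symmetric])
qed

lemma bounded_weight_limit:
  assumes "f \<longlonglongrightarrow> 0" shows "(\<lambda>N. comp_weight N m k * f N) \<longlonglongrightarrow> 0"
proof (rule lim_null_mult_left_bounded[OF _ assms])
  show "eventually (\<lambda>N. norm (comp_weight N m k) \<le> real m * 2 ^ (m choose 2)) sequentially"
    using eventually_gt_at_top[of 0] by eventually_elim (use comp_weight_bounds in simp)
qed

text \<open>Shapes with fewer than \<open>m - 1\<close> links are not connected, and those with more
  vanish by \<open>excess_rate_limit\<close>; the tree shapes remain, with unevaluated
  weights.\<close>

lemma small_frac_mean_limit: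
  assumes \<alpha>: "filterlim \<alpha> at_top sequentially" and t: "0 \<le> t"
  shows "(\<lambda>N. (\<integral>e. small_frac (\<alpha> N) (real M) N e t \<partial>particle_clocks N) -
    (\<Sum>m\<in>{1..<M}. comp_weight N m (m - 1) * (t ^ (m - 1) * gel_mean (1 / real N) (\<alpha> N) t N (\<lambda>w. exp (- real m * (t - min w t)))))) \<longlonglongrightarrow> 0"
proof -
  define y where "y m N = gel_mean (1 / real N) (\<alpha> N) t N (\<lambda>w. exp (- real m * (t - min w t)))" for m N
  have lim: "(\<lambda>N. rescaled_mean \<alpha> t N m k - c * y m N) \<longlonglongrightarrow> 0"
    if "(\<lambda>N. real N ^ (m - 1) * (1 - exp (- (1 / real N) * t)) ^ k) \<longlonglongrightarrow> c" for m k c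
    using iso_mean_limit[OF \<alpha> t _ _ that, of "\<lambda>_ _. 1"] by (simp add: rescaled_mean_def y_def)
  have "(\<lambda>N. \<Sum>m\<in>{1..<M}. comp_weight N m (m - 1) * (rescaled_mean \<alpha> t N m (m - 1) - t ^ (m - 1) * y m N) +
      (\<Sum>k\<in>{..m * m} - {m - 1}. comp_weight N m k * rescaled_mean \<alpha> t N m k)) \<longlonglongrightarrow> (\<Sum>m\<in>{1..<M}. 0 + (\<Sum>k\<in>{..m * m} - {m - 1}. 0))"
  proof (intro tendsto_sum tendsto_add)
    fix m assume m: "m \<in> {1..<M}"
    show "(\<lambda>N. comp_weight N m (m - 1) * (rescaled_mean \<alpha> t N m (m - 1) - t ^ (m - 1) * y m N)) \<longlonglongrightarrow> 0"
      by (intro bounded_weight_limit lim tree_rate_limit)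
    fix k assume k: "k \<in> {..m * m} - {m - 1}"
    show "(\<lambda>N. comp_weight N m k * rescaled_mean \<alpha> t N m k) \<longlonglongrightarrow> 0"
    proof (cases "k < m - 1")
      case True
      then show ?thesis by (simp add: comp_weight_def components_empty)
    next
      case False
      then have "m \<le> k" using k m by auto
      then have "(\<lambda>N. rescaled_mean \<alpha> t N m k - 0 * y m N) \<longlonglongrightarrow> 0"
        using m by (intro lim excess_rate_limit) auto
      then show ?thesis by (intro bounded_weight_limit) simp
    qed
  qed
  then have "(\<lambda>N. \<Sum>m\<in>{1..<M}. comp_weight N m (m - 1) * (rescaled_mean \<alpha> t N m (m - 1) - t ^ (m - 1) * y m N) +
      (\<Sum>k\<in>{..m * m} - {m - 1}. comp_weight N m k * rescaled_mean \<alpha> t N m k)) \<longlonglongrightarrow> 0" by simp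
  moreover have "eventually (\<lambda>N. (\<Sum>m\<in>{1..<M}. comp_weight N m (m - 1) * (rescaled_mean \<alpha> t N m (m - 1) - t ^ (m - 1) * y m N) +
      (\<Sum>k\<in>{..m * m} - {m - 1}. comp_weight N m k * rescaled_mean \<alpha> t N m k)) =
     (\<integral>e. small_frac (\<alpha> N) (real M) N e t \<partial>particle_clocks N) - (\<Sum>m\<in>{1..<M}. comp_weight N m (m - 1) * (t ^ (m - 1) * y m N))) sequentially"
    using eventually_gt_at_top[of 0] filterlim_at_top[THEN iffD1, OF \<alpha>, rule_format, of "real M"]
  proof eventually_elim
    case (elim N)
    have "(\<Sum>k\<le>m * m. comp_weight N m k * rescaled_mean \<alpha> t N m k) = comp_weight N m (m - 1) * rescaled_mean \<alpha> t N m (m - 1) +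
        (\<Sum>k\<in>{..m * m} - {m - 1}. comp_weight N m k * rescaled_mean \<alpha> t N m k)" for m
    proof (rule sum.remove)
      have "m - 1 \<le> m * m" by (cases m) auto
      then show "m - 1 \<in> {..m * m}" by simp
    qed simp
    then show ?case using small_frac_mean[of N M \<alpha> t] elim t
      by (simp add: sum_subtractf[symmetric] algebra_simps)
  qed
  ultimately show ?thesis unfolding y_def by (rule Lim_transform_eventually)
qed

subsection \<open>Upper bound on the mass of small clusters\<close>

lemma gel_mean_const: "0 < \<rho> \<Longrightarrow> gel_mean \<rho> \<alpha> t K (\<lambda>_. c) = c"
proof -
  assume "0 < \<rho>"
  then interpret prob_space "clocks \<rho> (prs {..<K})" by (rule prob_space_clocks)
  show ?thesis by (simp add: gel_mean_def prob_space)
qed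

lemma gel_mean_add:
  assumes "0 < \<rho>" "0 \<le> t" "h \<in> borel_measurable borel" "h' \<in> borel_measurable borel"
    and "\<And>w. 0 \<le> w \<Longrightarrow> w \<le> \<rho> * real K * t \<Longrightarrow> \<bar>h w\<bar> \<le> C" "\<And>w. 0 \<le> w \<Longrightarrow> w \<le> \<rho> * real K * t \<Longrightarrow> \<bar>h' w\<bar> \<le> C'"
  shows "gel_mean \<rho> \<alpha> t K (\<lambda>w. h w + h' w) = gel_mean \<rho> \<alpha> t K h + gel_mean \<rho> \<alpha> t K h'"
  unfolding gel_mean_def
  by (rule Bochner_Integration.integral_add[OF integrable_gelled[OF assms(1-3,5)] integrable_gelled[OF assms(1,2,4,6)]])

lemma integral_frac_bounds:
  assumes "0 < N"
  shows "0 \<le> (\<integral>e. small_frac \<alpha> M N e t \<partial>particle_clocks N)" "(\<integral>e. small_frac \<alpha> M N e t \<partial>particle_clocks N) \<le> 1"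
    and "0 \<le> (\<integral>e. mid_frac \<alpha> M N e t \<partial>particle_clocks N)" "(\<integral>e. mid_frac \<alpha> M N e t \<partial>particle_clocks N) \<le> 1"
    and "0 \<le> (\<integral>e. sol_frac \<alpha> N e t \<partial>particle_clocks N)" "(\<integral>e. sol_frac \<alpha> N e t \<partial>particle_clocks N) \<le> 1"
    and "integrable (particle_clocks N) (\<lambda>e. small_frac \<alpha> M N e t)" "integrable (particle_clocks N) (\<lambda>e. mid_frac \<alpha> M N e t)"
    and "integrable (particle_clocks N) (\<lambda>e. sol_frac \<alpha> N e t)"
proof -
  interpret C: prob_space "particle_clocks N" by (rule prob_space_clocks) (use assms in simp)
  note [measurable] = measurable_fracs(1-3)
  show i: "integrable (particle_clocks N) (\<lambda>e. small_frac \<alpha> M N e t)" "integrable (particle_clocks N) (\<lambda>e. mid_frac \<alpha> M N e t)"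
    "integrable (particle_clocks N) (\<lambda>e. sol_frac \<alpha> N e t)"
    by (rule C.integrable_const_bound[where B = 1]; simp)+
  show "(\<integral>e. small_frac \<alpha> M N e t \<partial>particle_clocks N) \<le> 1" by (rule C.integral_le_const[OF i(1)]) simp
  show "(\<integral>e. mid_frac \<alpha> M N e t \<partial>particle_clocks N) \<le> 1" by (rule C.integral_le_const[OF i(2)]) simp
  show "(\<integral>e. sol_frac \<alpha> N e t \<partial>particle_clocks N) \<le> 1" by (rule C.integral_le_const[OF i(3)]) simp
qed simp_all

text \<open>At time \<open>1\<close> the mean mass of small clusters is at most \<open>1\<close>; this calibrates the sum over
  component shapes, so that no enumeration of trees is needed to bound it at later times.\<close>
lemma small_frac_upper:
  fixes \<alpha> :: "nat \<Rightarrow> real"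
  assumes \<alpha>: "filterlim \<alpha> at_top sequentially" and t: "1 \<le> t" and \<eta>: "0 < \<eta>"
  shows "eventually (\<lambda>N. (\<integral>e. small_frac (\<alpha> N) (real M) N e t \<partial>particle_clocks N) \<le> 1 / t + \<eta>) sequentially"
proof -
  define F where "F s N = (\<integral>e. small_frac (\<alpha> N) (real M) N e s \<partial>particle_clocks N)" for s N
  define y where "y s m N = gel_mean (1 / real N) (\<alpha> N) s N (\<lambda>w. exp (- real m * (s - min w s)))" for s m N
  define u where "u m N = comp_weight N m (m - 1)" for m N
  \<comment> \<open>Ensures \<open>exp (real M * d) \<le> 1 + \<eta> / 2\<close>; adding 1 to
    \<open>M\<close> avoids a division by zero.\<close>
  define d where "d = ln (1 + \<eta> / 2) / (real M + 1)"
  define P where "P N = gel_mean (1 / real N) (\<alpha> N) t N (\<lambda>w. of_bool (t - w \<le> 1 + ln t - d))" for N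
  define r where "r s N = F s N - (\<Sum>m\<in>{1..<M}. u m N * (s ^ (m - 1) * y s m N))" for s N
  have d0: "0 < d" unfolding d_def using \<eta> by (intro divide_pos_pos ln_gt_zero) auto
  have eMd: "exp (real M * d) \<le> 1 + \<eta> / 2"
  proof -
    have "real M * d \<le> (real M + 1) * d" using d0 by (intro mult_right_mono) auto
    also have "\<dots> = ln (1 + \<eta> / 2)" by (simp add: d_def)
    finally have "exp (real M * d) \<le> exp (ln (1 + \<eta> / 2))" by (rule exp_le_cancel_iff[THEN iffD2])
    then show ?thesis using \<eta> by simp
  qed
  have r: "r s \<longlonglongrightarrow> 0" if "0 \<le> s" for s
    unfolding r_def F_def u_def y_def by (rule small_frac_mean_limit[OF \<alpha> that])
  have P: "P \<longlonglongrightarrow> 0" unfolding P_def using time_in_sol_lower[OF \<alpha> _ d0] t by simp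
  have P0: "0 \<le> P N" if "0 < N" for N
    unfolding P_def using that t by (intro gel_mean_bounds(1)) auto
  \<comment> \<open>At time 1 the time integral is at most 1. This bounds the means from below, and
    hence the sum of the component weights times \<open>exp (- m)\<close> from above.\<close>
  have y1: "exp (- real m) \<le> y 1 m N" if "0 < N" for m N
  proof -
    have "gel_mean (1 / real N) (\<alpha> N) 1 N (\<lambda>_. exp (- real m)) \<le> y 1 m N"
      unfolding y_def by (rule gel_mean_mono[where C = 1 and C' = 1]) (use that in \<open>auto intro: mult_left_le\<close>)
    then show ?thesis using that by (simp add: gel_mean_const)
  qed
  \<comment> \<open>At time \<open>t\<close> the time integral exceeds \<open>1 + ln t - d\<close>
    outside an unlikely event, and \<open>exp (- m * (1 + ln t))\<close> is
    \<open>exp (- m) / t ^ m\<close>, the reference value of time 1 divided by \<open>t ^ m\<close>.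
    Together with the factor \<open>t ^ (m - 1)\<close> this produces the bound
    \<open>1 / t\<close>.\<close>
  have yt: "y t m N \<le> exp (- real m) * exp (real M * d) / t ^ m + P N" if "0 < N" "m < M" for m N
  proof -
    let ?c = "1 + ln t - d"
    have "y t m N \<le> gel_mean (1 / real N) (\<alpha> N) t N (\<lambda>w. exp (- real m * ?c) + of_bool (t - w \<le> ?c))"
      unfolding y_def
    proof (rule gel_mean_mono[where C = 1 and C' = "exp (- real m * ?c) + 1"])
      fix w assume w: "0 \<le> w" "w \<le> 1 / real N * real N * t"
      then have wt: "min w t = w" using that by simp
      show "\<bar>exp (- real m * (t - min w t))\<bar> \<le> 1" by simp
      show "exp (- real m * (t - min w t)) \<le> exp (- real m * ?c) + of_bool (t - w \<le> ?c)"
      proof (cases "t - w \<le> ?c")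
        case True
        have "exp (- real m * (t - min w t)) \<le> 1" by simp
        then show ?thesis using True exp_gt_zero[of "- real m * ?c"] by (simp add: add_increasing)
      next
        case False
        then have "real m * ?c \<le> real m * (t - w)" by (intro mult_left_mono) auto
        then show ?thesis using False wt by simp
      qed
      show "\<bar>exp (- real m * ?c) + of_bool (t - w \<le> ?c)\<bar> \<le> exp (- real m * ?c) + 1"
        by (simp add: abs_of_nonneg)
    qed (use that t in auto)
    also have "\<dots> = gel_mean (1 / real N) (\<alpha> N) t N (\<lambda>w. exp (- real m * ?c)) + P N"
      unfolding P_def by (rule gel_mean_add[where C = "exp (- real m * ?c)" and C' = 1]) (use that t in auto)
    also have "gel_mean (1 / real N) (\<alpha> N) t N (\<lambda>w. exp (- real m * ?c)) = exp (- real m * ?c)"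
      using that by (simp add: gel_mean_const)
    also have "exp (- real m * ?c) = exp (- real m) * exp (real m * d) / t ^ m"
    proof -
      have "t ^ m = exp (real m * ln t)" using t by (simp add: exp_of_nat_mult)
      then show ?thesis by (simp add: exp_diff[symmetric] exp_add[symmetric] algebra_simps)
    qed
    also have "\<dots> \<le> exp (- real m) * exp (real M * d) / t ^ m"
      using that t d0 by (intro divide_right_mono mult_left_mono) auto
    finally show ?thesis by simp
  qed
  have u0: "0 \<le> u m N" for m N unfolding u_def by (rule comp_weight_bounds)
  have uP: "(\<lambda>N. \<Sum>m\<in>{1..<M}. u m N * (t ^ (m - 1) * P N)) \<longlonglongrightarrow> (\<Sum>m\<in>{1..<M}. 0)"
    unfolding u_def by (intro tendsto_sum bounded_weight_limit tendsto_mult_right_zero P)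
  have "(\<lambda>N. exp (real M * d) / t * (1 + \<bar>r 1 N\<bar>) + ((\<Sum>m\<in>{1..<M}. u m N * (t ^ (m - 1) * P N)) + r t N))
      \<longlonglongrightarrow> exp (real M * d) / t * (1 + \<bar>0\<bar>) + ((\<Sum>m\<in>{1..<M}. 0) + 0)"
    by (intro tendsto_intros uP r) (use t in auto)
  moreover have "exp (real M * d) / t * (1 + \<bar>0\<bar>) + ((\<Sum>m\<in>{1..<M}. 0) + 0) < 1 / t + \<eta>"
  proof -
    have "exp (real M * d) / t \<le> (1 + \<eta> / 2) / t" using eMd t by (intro divide_right_mono) auto
    also have "\<dots> \<le> 1 / t + \<eta> / 2" using t \<eta> by (simp add: field_simps)
    finally show ?thesis using \<eta> by simp
  qed
  ultimately have "eventually (\<lambda>N. exp (real M * d) / t * (1 + \<bar>r 1 N\<bar>) + ((\<Sum>m\<in>{1..<M}. u m N * (t ^ (m - 1) * P N)) + r t N) < 1 / t + \<eta>) sequentially"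
    by (rule order_tendstoD(2))
  then have "eventually (\<lambda>N. F t N \<le> 1 / t + \<eta>) sequentially"
    using eventually_gt_at_top[of 0]
  proof eventually_elim
    case (elim N)
    have "(\<Sum>m\<in>{1..<M}. u m N * exp (- real m)) \<le> (\<Sum>m\<in>{1..<M}. u m N * (1 ^ (m - 1) * y 1 m N))"
      using y1 elim u0 by (intro sum_mono mult_left_mono) auto
    also have "\<dots> = F 1 N - r 1 N" by (simp add: r_def)
    also have "\<dots> \<le> 1 + \<bar>r 1 N\<bar>" using integral_frac_bounds(2)[OF elim(2), of "\<alpha> N" "real M" 1] unfolding F_def by linarith
    finally have one: "(\<Sum>m\<in>{1..<M}. u m N * exp (- real m)) \<le> 1 + \<bar>r 1 N\<bar>" .
    have "(\<Sum>m\<in>{1..<M}. u m N * (t ^ (m - 1) * y t m N)) \<le>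
       (\<Sum>m\<in>{1..<M}. exp (real M * d) / t * (u m N * exp (- real m)) + u m N * (t ^ (m - 1) * P N))"
    proof (rule sum_mono)
      fix m assume m: "m \<in> {1..<M}"
      have tm: "t ^ m = t ^ (m - 1) * t" using m by (cases m) auto
      have "t ^ (m - 1) * y t m N \<le> t ^ (m - 1) * (exp (- real m) * exp (real M * d) / t ^ m + P N)"
        using yt[of N m] elim m t by (intro mult_left_mono) auto
      also have "\<dots> = exp (real M * d) / t * exp (- real m) + t ^ (m - 1) * P N"
        unfolding tm using t by (simp add: field_simps)
      finally have "u m N * (t ^ (m - 1) * y t m N) \<le> u m N * (exp (real M * d) / t * exp (- real m) + t ^ (m - 1) * P N)"
        using u0 by (intro mult_left_mono) auto
      then show "u m N * (t ^ (m - 1) * y t m N) \<le> exp (real M * d) / t * (u m N * exp (- real m)) + u m N * (t ^ (m - 1) * P N)"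
        by (simp add: algebra_simps)
    qed
    also have "\<dots> = exp (real M * d) / t * (\<Sum>m\<in>{1..<M}. u m N * exp (- real m)) + (\<Sum>m\<in>{1..<M}. u m N * (t ^ (m - 1) * P N))"
      by (simp add: sum.distrib sum_distrib_left)
    also have "\<dots> \<le> exp (real M * d) / t * (1 + \<bar>r 1 N\<bar>) + (\<Sum>m\<in>{1..<M}. u m N * (t ^ (m - 1) * P N))"
      using one t by (intro add_right_mono mult_left_mono) auto
    finally have "F t N \<le> exp (real M * d) / t * (1 + \<bar>r 1 N\<bar>) + ((\<Sum>m\<in>{1..<M}. u m N * (t ^ (m - 1) * P N)) + r t N)"
      unfolding r_def[of t N] by linarith
    then show ?case using elim(1) by linarith
  qed
  then show ?thesis by (simp only: F_def)
qed

subsection \<open>Concentration of the time integral\<close>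

text \<open>The random time integral \<open>X(t)\<close>; \<open>sol_time_eq_gelled\<close>
  identifies it as the complement of the gelled time.\<close>

definition sol_time :: "real \<Rightarrow> nat \<Rightarrow> (nat \<times> nat \<Rightarrow> real) \<Rightarrow> real \<Rightarrow> real" where
  "sol_time \<alpha> N e t = (\<integral>s. indicator {0..<t} s * sol_frac \<alpha> N e s \<partial>lborel)"

lemma integrable_sol_frac: "integrable lborel (\<lambda>s. indicator {a..<b} s * sol_frac \<alpha> N e s)"
proof (cases "a \<le> b")
  case True
  note [measurable] = measurable_fracs(7)[of \<alpha> N e]
  show ?thesis
    by (rule Bochner_Integration.integrable_bound[where f = "indicator {a..<b} :: real \<Rightarrow> real"])
      (use True in \<open>auto simp: indicator_def\<close>)
qed simp

lemma sol_time_eq_gelled: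
  assumes "0 < N" "0 \<le> t"
  shows "sol_time \<alpha> N e t = t - gelled (1 / real N) \<alpha> {..<N} t e"
proof -
  have P: "finite (prs {..<N})" by simp
  have int: "integrable lborel (\<lambda>s. indicat_real {0..<t} s * of_bool (in_sol \<alpha> (sol_graph \<alpha> N e s) v))" for v
    by (rule Bochner_Integration.integrable_bound[where f = "indicator {0..<t} :: real \<Rightarrow> real"])
      (use assms pred_in_sol_time[OF P] in \<open>auto simp: indicator_def\<close>)
  have "(\<Sum>v<N. life \<alpha> (prs {..<N}) t e v) = (\<integral>s. (\<Sum>v<N. indicat_real {0..<t} s * of_bool (in_sol \<alpha> (sol_graph \<alpha> N e s) v)) \<partial>lborel)"
    unfolding life_integral[OF P] by (rule Bochner_Integration.integral_sum[symmetric]) (rule int)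
  also have "\<dots> = (\<integral>s. real N * (indicator {0..<t} s * sol_frac \<alpha> N e s) \<partial>lborel)"
  proof (rule Bochner_Integration.integral_cong[OF refl])
    fix s
    have "(\<Sum>v<N. of_bool (in_sol \<alpha> (sol_graph \<alpha> N e s) v)) = real N * sol_frac \<alpha> N e s"
      using assms by (simp add: sol_frac_def of_bool_def sum.If_cases Int_def)
    then show "(\<Sum>v<N. indicat_real {0..<t} s * of_bool (in_sol \<alpha> (sol_graph \<alpha> N e s) v)) = real N * (indicator {0..<t} s * sol_frac \<alpha> N e s)"
      by (simp add: sum_distrib_left[symmetric])
  qed
  finally have "(\<Sum>v<N. life \<alpha> (prs {..<N}) t e v) = real N * sol_time \<alpha> N e t"
    by (simp add: sol_time_def)
  then show ?thesis using assms by (simp add: gelled_def sum_subtractf field_simps)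
qed

lemma sol_frac_antimono: "s \<le> t \<Longrightarrow> sol_frac \<alpha> N e t \<le> sol_frac \<alpha> N e s"
proof -
  assume st: "s \<le> t"
  have "in_sol \<alpha> (sol_graph \<alpha> N e s) v" if "in_sol \<alpha> (sol_graph \<alpha> N e t) v" for v
    by (rule in_sol_lk_antimono[OF _ st that]) simp
  then have "card {v\<in>{..<N}. in_sol \<alpha> (sol_graph \<alpha> N e t) v} \<le> card {v\<in>{..<N}. in_sol \<alpha> (sol_graph \<alpha> N e s) v}"
    by (intro card_mono) auto
  then show ?thesis unfolding sol_frac_def by (intro divide_right_mono) auto
qed

text \<open>Monotonicity of the mass in solution encloses the integral between the values at the end
  points. It makes \<open>X\<close> Lipschitz, and later recovers the mass from increments of
  \<open>X\<close>.\<close>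

lemma sol_time_diff:
  assumes "0 \<le> s" "s \<le> t"
  shows "(t - s) * sol_frac \<alpha> N e t \<le> sol_time \<alpha> N e t - sol_time \<alpha> N e s"
    and "sol_time \<alpha> N e t - sol_time \<alpha> N e s \<le> (t - s) * sol_frac \<alpha> N e s"
proof -
  let ?f = "sol_frac \<alpha> N e"
  have int: "integrable lborel (\<lambda>x. indicator {a..<b} x * c)" for a b c :: real
    by (cases "a \<le> b") (auto intro!: integrable_real_mult_indicator)
  have val: "(\<integral>x. indicator {s..<t} x * c \<partial>lborel) = (t - s) * c" for c
    using assms by simp
  have "sol_time \<alpha> N e t = (\<integral>x. indicator {0..<s} x * ?f x + indicator {s..<t} x * ?f x \<partial>lborel)"
    unfolding sol_time_def using assms
    by (intro Bochner_Integration.integral_cong) (auto simp: indicator_def)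
  also have "\<dots> = sol_time \<alpha> N e s + (\<integral>x. indicator {s..<t} x * ?f x \<partial>lborel)"
    unfolding sol_time_def by (rule Bochner_Integration.integral_add[OF integrable_sol_frac integrable_sol_frac])
  finally have d: "sol_time \<alpha> N e t - sol_time \<alpha> N e s = (\<integral>x. indicator {s..<t} x * ?f x \<partial>lborel)" by simp
  show "(t - s) * ?f t \<le> sol_time \<alpha> N e t - sol_time \<alpha> N e s"
    unfolding d val[symmetric]
    by (rule integral_mono[OF int integrable_sol_frac]) (auto simp: indicator_def sol_frac_antimono)
  show "sol_time \<alpha> N e t - sol_time \<alpha> N e s \<le> (t - s) * ?f s"
    unfolding d val[symmetric]
    by (rule integral_mono[OF integrable_sol_frac int]) (auto simp: indicator_def sol_frac_antimono)
qed

lemma sol_time_0 [simp]: "sol_time \<alpha> N e 0 = 0" by (simp add: sol_time_def)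

lemma sol_time_lipschitz:
  assumes "0 \<le> s" "s \<le> t"
  shows "sol_time \<alpha> N e s \<le> sol_time \<alpha> N e t" "sol_time \<alpha> N e t \<le> sol_time \<alpha> N e s + (t - s)"
proof -
  have "0 \<le> (t - s) * sol_frac \<alpha> N e t" using assms by simp
  from order_trans[OF this sol_time_diff(1)[OF assms, of \<alpha> N e]]
  show "sol_time \<alpha> N e s \<le> sol_time \<alpha> N e t" by simp
  have "(t - s) * sol_frac \<alpha> N e s \<le> (t - s) * 1" using assms by (intro mult_left_mono) auto
  from order_trans[OF sol_time_diff(2)[OF assms, of \<alpha> N e] this]
  show "sol_time \<alpha> N e t \<le> sol_time \<alpha> N e s + (t - s)" by simp
qed

lemma sol_time_bounds:
  assumes "0 \<le> t" shows "0 \<le> sol_time \<alpha> N e t" "sol_time \<alpha> N e t \<le> t"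
  using sol_time_lipschitz[OF order_refl assms, of \<alpha> N e] by simp_all

lemma measurable_sol_time:
  assumes "0 < N" "0 \<le> t" shows "(\<lambda>e. sol_time \<alpha> N e t) \<in> borel_measurable (particle_clocks N)"
proof -
  have [measurable]: "gelled (1 / real N) \<alpha> {..<N} t \<in> borel_measurable (particle_clocks N)"
    by (rule measurable_gelled) auto
  show ?thesis unfolding sol_time_eq_gelled[OF assms] by measurable
qed

lemma integrable_sol_time:
  assumes "0 < N" "0 \<le> t" shows "integrable (particle_clocks N) (\<lambda>e. sol_time \<alpha> N e t)"
proof -
  interpret C: prob_space "particle_clocks N" by (rule prob_space_clocks) (use assms in simp)
  show ?thesis
    by (rule C.integrable_const_bound[where B = t]) (use sol_time_bounds[OF assms(2)] measurable_sol_time[OF assms] in auto)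
qed

lemma mean_sol_time:
  assumes N: "0 < N" and t: "0 \<le> t"
  shows "(\<integral>e. sol_time \<alpha> N e t \<partial>particle_clocks N) =
    (\<integral>s. indicator {0..<t} s * (\<integral>e. sol_frac \<alpha> N e s \<partial>particle_clocks N) \<partial>lborel)"
    and "integrable lborel (\<lambda>s. indicator {0..<t} s * (\<integral>e. sol_frac \<alpha> N e s \<partial>particle_clocks N))"
proof -
  let ?C = "particle_clocks N"
  interpret C: prob_space ?C by (rule prob_space_clocks) (use N in simp)
  interpret P: pair_sigma_finite lborel ?C by unfold_locales
  note [measurable] = measurable_fracs(6)[of \<alpha> N]
  let ?f = "\<lambda>(s, e). indicator {0..<t} s * sol_frac \<alpha> N e s"
  have fm: "?f \<in> borel_measurable (lborel \<Otimes>\<^sub>M ?C)" unfolding split_beta' by measurable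
  have [measurable]: "(\<lambda>s. \<integral>e. sol_frac \<alpha> N e s \<partial>?C) \<in> borel_measurable lborel"
    by (rule C.borel_measurable_lebesgue_integral) (simp add: split_beta')
  show int1: "integrable lborel (\<lambda>s. indicator {0..<t} s * (\<integral>e. sol_frac \<alpha> N e s \<partial>?C))"
    by (rule Bochner_Integration.integrable_bound[where f = "indicator {0..<t} :: real \<Rightarrow> real"])
      (use t integral_frac_bounds(5,6)[OF N] in \<open>auto simp: indicator_def\<close>)
  have "integrable (lborel \<Otimes>\<^sub>M ?C) ?f"
  proof (rule P.Fubini_integrable[OF fm])
    have "(\<lambda>s. \<integral>e. norm (?f (s, e)) \<partial>?C) = (\<lambda>s. indicator {0..<t} s * (\<integral>e. sol_frac \<alpha> N e s \<partial>?C))"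
      by (auto simp: fun_eq_iff indicator_def)
    then show "integrable lborel (\<lambda>s. \<integral>e. norm (?f (s, e)) \<partial>?C)" using int1 by simp
    show "AE s in lborel. integrable ?C (\<lambda>e. ?f (s, e))" using integral_frac_bounds(9)[OF N] by simp
  qed
  from P.Fubini_integral[OF this] show "(\<integral>e. sol_time \<alpha> N e t \<partial>?C) =
    (\<integral>s. indicator {0..<t} s * (\<integral>e. sol_frac \<alpha> N e s \<partial>?C) \<partial>lborel)"
    unfolding sol_time_def by simp
qed

section \<open>Limit of the time integral and of the mass in solution\<close>

text \<open>The integral of \<open>n_t\<close> from 0 to \<open>t\<close>.\<close>

definition limit_time :: "real \<Rightarrow> real" where
  "limit_time t = (if t \<le> 1 then t else 1 + ln t)"

lemma limit_time_nonneg: "0 \<le> t \<Longrightarrow> 0 \<le> limit_time t" by (simp add: limit_time_def)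

text \<open>The mass in solution splits into small and intermediate clusters. Small ones contribute
  at most 1 before time 1 and at most \<open>1 / s + o(1)\<close> afterwards, which integrates to
  \<open>1 + ln t\<close>; \<open>mid_mass_time\<close> controls the intermediate ones.\<close>

lemma mean_sol_time_upper:
  fixes \<alpha> :: "nat \<Rightarrow> real"
  assumes \<alpha>: "filterlim \<alpha> at_top sequentially" and \<alpha>N: "(\<lambda>N. \<alpha> N / real N) \<longlonglongrightarrow> 0"
    and t: "0 \<le> t" and \<eta>: "0 < \<eta>"
  shows "eventually (\<lambda>N. (\<integral>e. sol_time (\<alpha> N) N e t \<partial>particle_clocks N) \<le> limit_time t + \<eta>) sequentially"
proof (cases "t \<le> 1")
  case True
  show ?thesis using eventually_gt_at_top[of 0]
  proof eventually_elim
    case (elim N)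
    interpret C: prob_space "particle_clocks N" by (rule prob_space_clocks) (use elim in simp)
    have "(\<integral>e. sol_time (\<alpha> N) N e t \<partial>particle_clocks N) \<le> t"
      by (rule C.integral_le_const[OF integrable_sol_time]) (use elim t sol_time_bounds[OF t] in auto)
    then show ?case using True \<eta> by (simp add: limit_time_def)
  qed
next
  case False
  \<comment> \<open>Four errors of at most \<open>\<eta> / 4\<close> each:
    \<open>t * \<epsilon>\<close> by this choice, \<open>2 / (M * \<epsilon>)\<close> by the choice
    of \<open>M\<close>, the other two for large \<open>N\<close>.\<close>
  define \<epsilon> where "\<epsilon> = \<eta> / (4 * t)"
  have \<epsilon>: "0 < \<epsilon>" using False \<eta> by (simp add: \<epsilon>_def)
  define M where "M = nat \<lceil>8 / (\<eta> * \<epsilon>)\<rceil> + 1"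
  have M0: "0 < real M" by (simp add: M_def)
  have "8 / (\<eta> * \<epsilon>) \<le> real M" unfolding M_def by linarith
  then have M8: "2 / real M / \<epsilon> \<le> \<eta> / 4" using M0 \<eta> \<epsilon> by (simp add: field_simps)
  define F where "F N s = (\<integral>e. small_frac (\<alpha> N) (real M) N e s \<partial>particle_clocks N)" for N s
  define R where "R N s = (\<integral>e. mid_frac (\<alpha> N) (real M) N e s \<partial>particle_clocks N)" for N s
  \<comment> \<open>\<open>small_frac_upper\<close> holds for each \<open>s\<close> separately,
    without uniformity; the excess over \<open>1 / s\<close> is therefore integrated by dominated
    convergence.\<close>
  define g where "g N s = indicator {1..t} s * max 0 (F N s - 1 / s)" for N s
  have Fm [measurable]: "F N \<in> borel_measurable lborel" for N
  proof (cases "0 < N")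
    case True
    interpret C: prob_space "particle_clocks N" by (rule prob_space_clocks) (use True in simp)
    show ?thesis unfolding F_def[abs_def]
      by (rule C.borel_measurable_lebesgue_integral) (use measurable_fracs(5) in \<open>simp add: split_beta'\<close>)
  qed (simp add: F_def[abs_def] small_frac_def)
  have Rm [measurable]: "R N \<in> borel_measurable lborel" for N
  proof (cases "0 < N")
    case True
    interpret C: prob_space "particle_clocks N" by (rule prob_space_clocks) (use True in simp)
    show ?thesis unfolding R_def[abs_def]
      by (rule C.borel_measurable_lebesgue_integral) (use measurable_fracs(4) in \<open>simp add: split_beta'\<close>)
  qed (simp add: R_def[abs_def] mid_frac_def)
  have F01: "0 \<le> F N s \<and> F N s \<le> 1" for N s
    using integral_frac_bounds(1,2)[of N "\<alpha> N" "real M" s] by (cases "0 < N") (auto simp: F_def small_frac_def)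
  have g_bound: "\<bar>g N s\<bar> \<le> indicator {1..t} s" for N s
  proof -
    have "F N s - 1 / s \<le> 1" if "1 \<le> s"
    proof -
      have "0 \<le> 1 / s" using that by simp
      then show ?thesis using F01[of N s] by linarith
    qed
    then show ?thesis using F01[of N s] by (auto simp: g_def indicator_def max_def)
  qed
  have "(\<lambda>N. \<integral>s. g N s \<partial>lborel) \<longlonglongrightarrow> integral\<^sup>L lborel (\<lambda>_::real. 0)"
  proof (rule integral_dominated_convergence[where w = "indicator {1..t}"])
    show "integrable lborel (indicator {1..t} :: real \<Rightarrow> real)"
      by (rule integrable_real_indicator) (use False in simp_all)
    show "AE s in lborel. (\<lambda>N. g N s) \<longlonglongrightarrow> 0"
    proof (rule AE_I2)
      fix s :: real
      show "(\<lambda>N. g N s) \<longlonglongrightarrow> 0"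
      proof (cases "s \<in> {1..t}")
        case True
        show ?thesis
        proof (rule tendstoI)
          fix e :: real assume e: "0 < e"
          have "eventually (\<lambda>N. F N s \<le> 1 / s + e / 2) sequentially"
            unfolding F_def by (rule small_frac_upper[OF \<alpha>]) (use True e in auto)
          then show "eventually (\<lambda>N. dist (g N s) 0 < e) sequentially"
            by eventually_elim (use True e in \<open>auto simp: g_def\<close>)
        qed
      qed (simp add: g_def)
    qed
    show "AE s in lborel. norm (g N s) \<le> indicator {1..t} s" for N using g_bound by simp
  qed (simp_all add: g_def[abs_def])
  then have "(\<lambda>N. \<integral>s. g N s \<partial>lborel) \<longlonglongrightarrow> 0" by simp
  then have ev1: "eventually (\<lambda>N. (\<integral>s. g N s \<partial>lborel) < \<eta> / 4) sequentially"
    by (rule order_tendstoD(2)) (use \<eta> in simp)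
  have "(\<lambda>N. t * (\<alpha> N / real N) / \<epsilon>) \<longlonglongrightarrow> t * 0 / \<epsilon>" by (intro tendsto_intros \<alpha>N) (use \<epsilon> in simp)
  then have ev2: "eventually (\<lambda>N. t * (\<alpha> N / real N) / \<epsilon> < \<eta> / 4) sequentially"
    by (rule order_tendstoD(2)) (use \<eta> in simp)
  have ev3: "eventually (\<lambda>N. 0 \<le> \<alpha> N) sequentially" using \<alpha> by (simp add: filterlim_at_top)
  have log: "has_bochner_integral lborel (\<lambda>s. (1 / s) * indicator {1..t} s) (ln t - ln 1)"
    by (rule has_bochner_integral_FTC_Icc_real) (use False in \<open>auto intro!: derivative_eq_intros\<close>)
  show ?thesis using ev1 ev2 ev3 eventually_gt_at_top[of 0]
  proof eventually_elim
    case (elim N)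
    let ?C = "particle_clocks N"
    have R01: "0 \<le> R N s \<and> R N s \<le> 1" for s
      using integral_frac_bounds(3,4)[OF elim(4), of "\<alpha> N" "real M" s] by (simp add: R_def)
    have split: "(\<integral>e. sol_frac (\<alpha> N) N e s \<partial>?C) = F N s + R N s" for s
      unfolding F_def R_def sol_frac_split[of "\<alpha> N" N _ s "real M"]
      by (rule Bochner_Integration.integral_add[OF integral_frac_bounds(7)[OF elim(4)] integral_frac_bounds(8)[OF elim(4)]])
    have intR: "integrable lborel (\<lambda>s. indicator {0..<t} s * R N s)"
      by (rule Bochner_Integration.integrable_bound[where f = "indicator {0..<t} :: real \<Rightarrow> real"])
        (use False R01 in \<open>auto simp: indicator_def\<close>)
    have intg: "integrable lborel (g N)"
      by (rule Bochner_Integration.integrable_bound[where f = "indicator {1..t} :: real \<Rightarrow> real"])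
        (use False g_bound in \<open>auto simp: g_def[abs_def]\<close>)
    have int1: "integrable lborel (indicator {0..<1} :: real \<Rightarrow> real)" by simp
    have "(\<integral>e. sol_time (\<alpha> N) N e t \<partial>?C) = (\<integral>s. indicator {0..<t} s * (F N s + R N s) \<partial>lborel)"
      using mean_sol_time(1)[OF elim(4) t] split by simp
    also have "\<dots> \<le> (\<integral>s. indicator {0..<1} s + (1 / s) * indicator {1..t} s + g N s + indicator {0..<t} s * R N s \<partial>lborel)"
    proof (rule integral_mono)
      show "integrable lborel (\<lambda>s. indicator {0..<t} s * (F N s + R N s))"
        using mean_sol_time(2)[OF elim(4) t, of "\<alpha> N"] split by simp
      show "integrable lborel (\<lambda>s. indicator {0..<1} s + (1 / s) * indicator {1..t} s + g N s + indicator {0..<t} s * R N s)"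
        by (intro Bochner_Integration.integrable_add int1 intg intR integrable.intros[OF log])
      fix s :: real
      show "indicator {0..<t} s * (F N s + R N s) \<le> indicator {0..<1} s + (1 / s) * indicator {1..t} s + g N s + indicator {0..<t} s * R N s"
        using F01[of N s] R01[of s] by (auto simp: g_def indicator_def)
    qed
    also have "\<dots> = 1 + ln t + (\<integral>s. g N s \<partial>lborel) + (\<integral>s. indicator {0..<t} s * R N s \<partial>lborel)"
    proof -
      have "(\<integral>s. indicator {0..<1} s + (1 / s) * indicator {1..t} s + g N s + indicator {0..<t} s * R N s \<partial>lborel) =
        (\<integral>s. indicator {0..<1::real} s \<partial>lborel) + (\<integral>s. (1 / s) * indicator {1..t} s \<partial>lborel) + (\<integral>s. g N s \<partial>lborel) + (\<integral>s. indicator {0..<t} s * R N s \<partial>lborel)"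
        by (simp only: Bochner_Integration.integral_add Bochner_Integration.integrable_add int1 intg intR integrable.intros[OF log])
      then show ?thesis using has_bochner_integral_integral_eq[OF log] by simp
    qed
    also have "(\<integral>s. indicator {0..<t} s * R N s \<partial>lborel) \<le> t * \<epsilon> + (t * (\<alpha> N / real N) + 2 / real M) / \<epsilon>"
      unfolding R_def by (rule mid_mass_time) (use elim t M0 \<epsilon> in auto)
    finally have "(\<integral>e. sol_time (\<alpha> N) N e t \<partial>?C) \<le> 1 + ln t + (\<integral>s. g N s \<partial>lborel) + (t * \<epsilon> + (t * (\<alpha> N / real N) / \<epsilon> + 2 / real M / \<epsilon>))"
      by (simp add: add_divide_distrib)
    moreover have "t * \<epsilon> = \<eta> / 4" using False by (simp add: \<epsilon>_def)
    moreover have "limit_time t = 1 + ln t" using False by (simp add: limit_time_def)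
    ultimately show ?case using elim(1,2) M8 by linarith
  qed
qed

text \<open>A variable with mean at most \<open>l + o(1)\<close> that lies above
  \<open>l - d\<close> with high probability is close to \<open>l\<close> in L1: the absolute
  deviation is the deviation plus twice its negative part, and the latter is at most
  \<open>d\<close> outside an unlikely event.\<close>

lemma sol_time_L1:
  fixes \<alpha> :: "nat \<Rightarrow> real"
  assumes \<alpha>: "filterlim \<alpha> at_top sequentially" and \<alpha>N: "(\<lambda>N. \<alpha> N / real N) \<longlonglongrightarrow> 0" and t: "0 \<le> t"
  shows "(\<lambda>N. \<integral>e. \<bar>sol_time (\<alpha> N) N e t - limit_time t\<bar> \<partial>particle_clocks N) \<longlonglongrightarrow> 0"
proof (rule tendstoI)
  fix \<epsilon> :: real assume \<epsilon>: "0 < \<epsilon>"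
  define d where "d = \<epsilon> / 8"
  define l where "l = limit_time t"
  \<comment> \<open>For \<open>t < 1\<close> the lower bound is imported from time 1:
    \<open>X\<close> grows at most at unit speed, so \<open>X(1) > 1 - d\<close> implies
    \<open>X(t) > t - d\<close>.\<close>
  define \<tau> where "\<tau> = max 1 t"
  define P where "P N = gel_mean (1 / real N) (\<alpha> N) \<tau> N (\<lambda>w. of_bool (\<tau> - w \<le> 1 + ln \<tau> - d))" for N
  have l0: "0 \<le> l" unfolding l_def using t by (rule limit_time_nonneg)
  have d0: "0 < d" using \<epsilon> by (simp add: d_def)
  have \<tau>1: "1 \<le> \<tau>" "t \<le> \<tau>" by (auto simp: \<tau>_def)
  have "P \<longlonglongrightarrow> 0" unfolding P_def by (rule time_in_sol_lower[OF \<alpha> _ d0]) (use \<tau>1 in simp)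
  then have "(\<lambda>N. 2 * l * P N) \<longlonglongrightarrow> 2 * l * 0" by (intro tendsto_intros)
  then have "eventually (\<lambda>N. 2 * l * P N < \<epsilon> / 4) sequentially"
    by (rule order_tendstoD(2)) (use \<epsilon> in simp)
  moreover have "eventually (\<lambda>N. (\<integral>e. sol_time (\<alpha> N) N e t \<partial>particle_clocks N) \<le> limit_time t + \<epsilon> / 4) sequentially"
    by (rule mean_sol_time_upper[OF \<alpha> \<alpha>N t]) (use \<epsilon> in simp)
  ultimately show "eventually (\<lambda>N. dist (\<integral>e. \<bar>sol_time (\<alpha> N) N e t - limit_time t\<bar> \<partial>particle_clocks N) 0 < \<epsilon>) sequentially"
    using eventually_gt_at_top[of 0]
  proof eventually_elim
    case (elim N)
    let ?C = "particle_clocks N" and ?X = "\<lambda>e s. sol_time (\<alpha> N) N e s"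
    let ?low = "\<lambda>e. of_bool (?X e \<tau> \<le> 1 + ln \<tau> - d) :: real"
    interpret C: prob_space ?C by (rule prob_space_clocks) (use elim in simp)
    have \<tau>0: "0 \<le> \<tau>" using \<tau>1 by simp
    note [measurable] = measurable_sol_time[OF elim(3) \<tau>0, of "\<alpha> N"] measurable_sol_time[OF elim(3) t, of "\<alpha> N"]
    note iX = integrable_sol_time[OF elim(3) t, of "\<alpha> N"]
    have iL: "integrable ?C ?low"
      by (rule C.integrable_const_bound[where B = 1]) auto
    have PL: "P N = (\<integral>e. ?low e \<partial>?C)"
      unfolding P_def gel_mean_def using sol_time_eq_gelled[OF elim(3) \<tau>0, of "\<alpha> N"] by simp
    \<comment> \<open>A deviation below \<open>- d\<close> implies the unlikely event; the term
      \<open>2 * l\<close> then suffices because \<open>X(t) \<ge> 0\<close>.\<close>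
    have "\<bar>?X e t - l\<bar> \<le> (?X e t - l) + 2 * d + 2 * l * ?low e" for e
    proof (cases "l - d \<le> ?X e t")
      case True
      have "0 \<le> 2 * l * ?low e" using l0 by simp
      then show ?thesis using True d0 by (cases "l \<le> ?X e t") auto
    next
      case False
      have "?X e \<tau> \<le> 1 + ln \<tau> - d"
      proof (cases "t \<le> 1")
        case True
        then have "\<tau> = 1" "l = t" by (auto simp: \<tau>_def l_def limit_time_def)
        then show ?thesis using sol_time_lipschitz(2)[of t 1 "\<alpha> N" N e] True t False by simp
      next
        case f: False
        then have "\<tau> = t" "l = 1 + ln t" by (auto simp: \<tau>_def l_def limit_time_def)
        then show ?thesis using False by simp
      qed
      then have "?low e = 1" by simp
      then show ?thesis using False sol_time_bounds(1)[OF t, of "\<alpha> N" N e] d0 by simp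
    qed
    then have "(\<integral>e. \<bar>?X e t - l\<bar> \<partial>?C) \<le> (\<integral>e. (?X e t - l) + 2 * d + 2 * l * ?low e \<partial>?C)"
      using iX iL by (intro integral_mono) auto
    also have "\<dots> = ((\<integral>e. ?X e t \<partial>?C) - l) + 2 * d + 2 * l * P N"
      using iX iL by (simp add: PL C.prob_space)
    also have "\<dots> < \<epsilon>" using elim(1,2) \<epsilon> by (simp add: l_def d_def)
    finally show ?case by (simp add: l_def)
  qed
qed

text \<open>The two branches of \<open>limit_time\<close> meet at time 1 with the same slope 1, so
  the right derivative there is computed from the logarithmic branch.\<close>

lemma limit_time_derivative:
  assumes "0 \<le> t"
  shows "((\<lambda>d. (limit_time (t + d) - limit_time t) / d) \<longlongrightarrow> n_t t) (at_right 0)"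
    and "1 < t \<Longrightarrow> ((\<lambda>d. (limit_time t - limit_time (t - d)) / d) \<longlongrightarrow> n_t t) (at_right 0)"
proof -
  have ln_lim: "((\<lambda>d. (ln (t + d) - ln t) / d) \<longlongrightarrow> 1 / t) (at_right 0)" if "0 < t" for t :: real
  proof -
    have "(ln has_real_derivative 1 / t) (at t)" using that by (auto intro!: derivative_eq_intros)
    then have "((\<lambda>h. (ln (t + h) - ln t) / h) \<longlongrightarrow> 1 / t) (at 0)" by (simp add: DERIV_def)
    then show ?thesis by (rule filterlim_mono) (auto simp: at_within_le_at intro: at_le)
  qed
  show "((\<lambda>d. (limit_time (t + d) - limit_time t) / d) \<longlongrightarrow> n_t t) (at_right 0)"
  proof (cases "t < 1")
    case True
    have "eventually (\<lambda>d. 1 = (limit_time (t + d) - limit_time t) / d) (at_right 0)"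
      using eventually_at_right_less[of "0::real"] eventually_at_right_field[of _ 0, THEN iffD2, of "\<lambda>d. d < 1 - t"]
        eventually_at_right[of 0 "1 - t" "\<lambda>d. d < 1 - t"] True
      by (auto simp: eventually_at_right_field limit_time_def intro!: exI[of _ "1 - t"])
    then show ?thesis using True by (intro Lim_transform_eventually[OF tendsto_const]) (auto simp: n_t_def)
  next
    case False
    have "eventually (\<lambda>d. (ln (t + d) - ln t) / d = (limit_time (t + d) - limit_time t) / d) (at_right 0)"
      by (rule eventually_mono[OF eventually_at_right_less[of "0::real"]]) (use False in \<open>auto simp: limit_time_def\<close>)
    moreover have "((\<lambda>d. (ln (t + d) - ln t) / d) \<longlongrightarrow> n_t t) (at_right 0)"
      using ln_lim[of t] False by (auto simp: n_t_def)
    ultimately show ?thesis by (rule Lim_transform_eventually[rotated])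
  qed
  assume t1: "1 < t"
  have "((\<lambda>d. (ln t - ln (t - d)) / d) \<longlongrightarrow> inverse t) (at_right 0)"
    using t1 by real_asymp
  then have a: "((\<lambda>d. (ln t - ln (t - d)) / d) \<longlongrightarrow> 1 / t) (at_right 0)" by (simp add: inverse_eq_divide)
  have b: "eventually (\<lambda>d. (ln t - ln (t - d)) / d = (limit_time t - limit_time (t - d)) / d) (at_right 0)"
    using t1 by (auto simp: eventually_at_right_field limit_time_def intro!: exI[of _ "t - 1"])
  have "n_t t = 1 / t" using t1 by (simp add: n_t_def)
  then show "((\<lambda>d. (limit_time t - limit_time (t - d)) / d) \<longlongrightarrow> n_t t) (at_right 0)"
    using Lim_transform_eventually[OF a b] by simp
qed

text \<open>The mass in solution is the derivative of the time integral and is monotone, so that it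
  inherits convergence from difference quotients.\<close>
lemma sol_frac_L1:
  fixes \<alpha> :: "nat \<Rightarrow> real"
  assumes \<alpha>: "filterlim \<alpha> at_top sequentially" and \<alpha>N: "(\<lambda>N. \<alpha> N / real N) \<longlonglongrightarrow> 0" and t: "0 \<le> t"
  shows "(\<lambda>N. \<integral>e. \<bar>sol_frac (\<alpha> N) N e t - n_t t\<bar> \<partial>particle_clocks N) \<longlonglongrightarrow> 0"
proof (rule tendstoI)
  fix \<epsilon> :: real assume \<epsilon>: "0 < \<epsilon>"
  let ?up = "\<lambda>d. \<bar>(limit_time (t + d) - limit_time t) / d - n_t t\<bar>"
  let ?dn = "\<lambda>d. if 1 < t then \<bar>(limit_time t - limit_time (t - d)) / d - n_t t\<bar> else 0"
  have "(?up \<longlongrightarrow> \<bar>n_t t - n_t t\<bar>) (at_right 0)"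
    by (intro tendsto_intros limit_time_derivative(1)[OF t])
  then have e1: "eventually (\<lambda>d. ?up d < \<epsilon> / 4) (at_right 0)"
    by (rule order_tendstoD(2)) (use \<epsilon> in simp)
  have "(?dn \<longlongrightarrow> 0) (at_right 0)"
  proof (cases "1 < t")
    case True
    have "((\<lambda>d. \<bar>(limit_time t - limit_time (t - d)) / d - n_t t\<bar>) \<longlongrightarrow> \<bar>n_t t - n_t t\<bar>) (at_right 0)"
      by (intro tendsto_intros limit_time_derivative(2)[OF t True])
    then show ?thesis using True by simp
  qed simp
  then have e2: "eventually (\<lambda>d. ?dn d < \<epsilon> / 4) (at_right 0)"
    by (rule order_tendstoD(2)) (use \<epsilon> in simp)
  have e3: "eventually (\<lambda>d::real. d < 1) (at_right 0)"
    by (auto simp: eventually_at_right_field intro!: exI[of _ 1])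
  obtain d where d: "0 < d" "d < 1" "?up d < \<epsilon> / 4" "?dn d < \<epsilon> / 4"
  proof -
    have "eventually (\<lambda>d. 0 < d \<and> d < 1 \<and> ?up d < \<epsilon> / 4 \<and> ?dn d < \<epsilon> / 4) (at_right 0)"
      using e1 e2 e3 eventually_at_right_less[of "0::real"] by eventually_elim auto
    then show ?thesis using that eventually_happens'[OF trivial_limit_at_right_real] by blast
  qed
  define D where "D s N = (\<integral>e. \<bar>sol_time (\<alpha> N) N e s - limit_time s\<bar> \<partial>particle_clocks N)" for s N
  \<comment> \<open>A step to the left is taken only beyond time 1; up to time 1 the bound
    \<open>n(t) \<le> 1 = n_t t\<close> takes the place of the left difference quotient.\<close>
  define t' where "t' = (if 1 < t then t - d else t)"
  have t'0: "0 \<le> t'" using t d by (auto simp: t'_def)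
  have lim: "(\<lambda>N. (D (t + d) N + 2 * D t N + D t' N) / d) \<longlonglongrightarrow> (0 + 2 * 0 + 0) / d"
    unfolding D_def using d t t'0 by (intro tendsto_intros sol_time_L1[OF \<alpha> \<alpha>N]) auto
  have "eventually (\<lambda>N. (D (t + d) N + 2 * D t N + D t' N) / d < \<epsilon> / 4) sequentially"
    using order_tendstoD(2)[OF lim, of "\<epsilon> / 4"] \<epsilon> by simp
  then show "eventually (\<lambda>N. dist (\<integral>e. \<bar>sol_frac (\<alpha> N) N e t - n_t t\<bar> \<partial>particle_clocks N) 0 < \<epsilon>) sequentially"
    using eventually_gt_at_top[of 0]
  proof eventually_elim
    case (elim N)
    let ?C = "particle_clocks N" and ?X = "\<lambda>s e. sol_time (\<alpha> N) N e s" and ?n = "\<lambda>e. sol_frac (\<alpha> N) N e t"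
    interpret C: prob_space ?C by (rule prob_space_clocks) (use elim in simp)
    have td: "0 \<le> t + d" using t d by simp
    have iX: "integrable ?C (\<lambda>e. \<bar>?X s e - limit_time s\<bar>)" if "0 \<le> s" for s
      by (intro integrable_abs Bochner_Integration.integrable_diff integrable_sol_time) (use elim that in auto)
    have gen_lo: "l1 - l0 - (a + 2 * b + c) \<le> n"
      if "x1 - x0 \<le> n" "a = \<bar>x1 - l1\<bar>" "b = \<bar>x0 - l0\<bar>" "0 \<le> c" for x1 x0 n a b c l1 l0 :: real
      using that by linarith
    have gen_up: "n \<le> l0 - l1 + (a + 2 * b + c)"
      if "n \<le> x0 - x1" "c = \<bar>x1 - l1\<bar>" "b = \<bar>x0 - l0\<bar>" "0 \<le> a" for x1 x0 n a b c l1 l0 :: real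
      using that by linarith
    have ptw: "\<bar>?n e - n_t t\<bar> \<le> \<epsilon> / 2 + (\<bar>?X (t + d) e - limit_time (t + d)\<bar> + 2 * \<bar>?X t e - limit_time t\<bar> + \<bar>?X t' e - limit_time t'\<bar>) / d" (is "_ \<le> \<epsilon> / 2 + ?Q / d") for e
    proof -
      have Q0: "0 \<le> ?Q / d" using d by simp
      have "?X (t + d) e - ?X t e \<le> d * ?n e" using sol_time_diff(2)[of t "t + d" "\<alpha> N" N e] t d by simp
      from gen_lo[OF this refl refl abs_ge_zero]
      have "(limit_time (t + d) - limit_time t) - ?Q \<le> d * ?n e" .
      then have "((limit_time (t + d) - limit_time t) - ?Q) / d \<le> ?n e"
        by (simp only: pos_divide_le_eq[OF d(1)] mult.commute[of _ d])
      then have "(limit_time (t + d) - limit_time t) / d - ?Q / d \<le> ?n e" by (simp only: diff_divide_distrib)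
      then have lo: "n_t t - ?n e \<le> \<epsilon> / 4 + ?Q / d" using d(3) by linarith
      have up: "?n e - n_t t \<le> \<epsilon> / 4 + ?Q / d"
      proof (cases "1 < t")
        case True
        then have t': "t' = t - d" by (simp add: t'_def)
        have "d * ?n e \<le> ?X t e - ?X t' e" using sol_time_diff(1)[of t' t "\<alpha> N" N e] t'0 d t' by simp
        from gen_up[OF this refl refl abs_ge_zero]
        have "d * ?n e \<le> (limit_time t - limit_time (t - d)) + ?Q" unfolding t' .
        then have "?n e \<le> ((limit_time t - limit_time (t - d)) + ?Q) / d"
          by (simp only: pos_le_divide_eq[OF d(1)] mult.commute[of _ d])
        then have "?n e \<le> (limit_time t - limit_time (t - d)) / d + ?Q / d" by (simp only: add_divide_distrib)
        moreover have "\<bar>(limit_time t - limit_time (t - d)) / d - n_t t\<bar> < \<epsilon> / 4"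
          using d(4) True by (simp only: if_True)
        moreover have "n - m \<le> \<epsilon> / 4 + q" if "n \<le> a + q" "\<bar>a - m\<bar> < \<epsilon> / 4" for n m a q :: real
          using that by linarith
        ultimately show ?thesis by blast
      next
        case False
        then have "?n e \<le> n_t t" by (simp add: n_t_def)
        then show ?thesis using Q0 \<epsilon> by linarith
      qed
      show ?thesis using lo up \<epsilon> by (simp add: abs_le_iff)
    qed
    have "(\<integral>e. \<bar>?n e - n_t t\<bar> \<partial>?C) \<le> (\<integral>e. \<epsilon> / 2 + (\<bar>?X (t + d) e - limit_time (t + d)\<bar> + 2 * \<bar>?X t e - limit_time t\<bar> + \<bar>?X t' e - limit_time t'\<bar>) / d \<partial>?C)"
      by (rule integral_mono[OF _ _ ptw]) (use iX[OF td] iX[OF t] iX[OF t'0] integral_frac_bounds(9)[OF elim(2)] in auto)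
    also have "\<dots> = \<epsilon> / 2 + (D (t + d) N + 2 * D t N + D t' N) / d"
      using iX[OF td] iX[OF t] iX[OF t'0] by (simp add: D_def C.prob_space)
    also have "\<dots> < \<epsilon>" using elim(1) \<epsilon> by linarith
    finally show ?case by simp
  qed
qed

subsection \<open>The typical cluster\<close>

lemma created_eq_sol_graph:
  assumes "inj_on e (prs {..<N})" "\<And>p. p \<in> prs {..<N} \<Longrightarrow> e p \<noteq> t"
  shows "created N \<alpha> e t = sol_graph \<alpha> N e t"
proof -
  have "{p \<in> prs {..<N}. e p \<le> t} = {p \<in> prs {..<N}. e p < t}"
    using assms(2) by (auto simp: order_less_le)
  then show ?thesis using created_eq_links[of e N \<alpha> t] assms(1) by (simp add: pairs_eq_prs lk_def)
qed

lemma rooted_iso_cong: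
  assumes "\<And>x y. x \<in> V \<Longrightarrow> y \<in> V \<Longrightarrow> A x y \<longleftrightarrow> B x y"
  shows "rooted_iso V A r V' A' r' \<longleftrightarrow> rooted_iso V B r V' A' r'"
  unfolding rooted_iso_def using assms by (metis (no_types, lifting))

text \<open>A clock that rang between two particles still in solution at time \<open>t\<close> rang
  while both were in solution, so its link was created. Hence the edges of \<open>C(t)\<close> are
  the created links between particles in solution, and its components are clusters. Distinct clocks,
  none equal to \<open>t\<close>, reconcile the sorted list and the condition
  \<open>e p \<le> t\<close> with the strict inequalities in \<open>lk\<close>.\<close>

lemma typ_frac_eq:
  assumes N: "0 < N" and e: "inj_on e (prs {..<N})" "\<And>p. p \<in> prs {..<N} \<Longrightarrow> e p \<noteq> t"
    and \<alpha>: "real (tree_size T) < \<alpha>"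
  shows "typ_frac N \<alpha> t T e = (\<Sum>s\<in>shape_class T. tree_count \<alpha> s N e t / real (orderings s)) / real N / sol_frac \<alpha> N e t"
proof -
  let ?E = "sol_graph \<alpha> N e t"
  let ?S = "{i\<in>{..<N}. in_sol \<alpha> ?E i}"
  have P: "finite (prs {..<N})" by simp
  have EN: "?E \<subseteq> {..<N} \<times> {..<N}" using graph_subset[of \<alpha> N e t] prs_subset by blast
  have S: "in_solution N \<alpha> e t = ?S"
  proof -
    have "created N \<alpha> e t = ?E" by (rule created_eq_sol_graph[OF e])
    then show ?thesis by (simp add: in_solution_def in_sol_def)
  qed
  have edge: "(x, y) \<in> pairs N \<and> e (x, y) \<le> t \<longleftrightarrow> (x, y) \<in> ?E" if "x \<in> ?S" "y \<in> ?S" for x y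
  proof
    assume p: "(x, y) \<in> pairs N \<and> e (x, y) \<le> t"
    then have p': "(x, y) \<in> prs {..<N}" "e (x, y) < t" using e(2)[of "(x, y)"] by (auto simp: pairs_eq_prs order_less_le)
    have "in_sol \<alpha> (lk \<alpha> (prs {..<N}) e (e (x, y))) z" if "z \<in> ?S" for z
      by (rule in_sol_lk_antimono[OF P, of _ t]) (use that p' in auto)
    then show "(x, y) \<in> ?E" using lk_iff[of "prs {..<N}" "(x, y)" e t \<alpha>] P p' that by simp
  next
    assume "(x, y) \<in> ?E"
    then show "(x, y) \<in> pairs N \<and> e (x, y) \<le> t" using lk_subset[OF P, of \<alpha> e t] by (auto simp: pairs_eq_prs)
  qed
  have adj: "sol_adj N \<alpha> e t x y \<longleftrightarrow> x \<in> ?S \<and> y \<in> ?S \<and> link_adj ?E x y" for x y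
    unfolding sol_adj_def S link_adj_def using edge[of x y] edge[of y x] by blast
  have clS: "cluster ?E i \<subseteq> ?S" if "i \<in> ?S" for i
  proof
    fix y assume y: "y \<in> cluster ?E i"
    have "i \<in> {..<N}" using that by simp
    then have "y \<in> {..<N}" using cluster_subset[OF EN] y by blast
    moreover have "in_sol \<alpha> ?E y" using in_sol_cluster[OF y, of \<alpha>] that by simp
    ultimately show "y \<in> ?S" by simp
  qed
  have comp: "sol_comp N \<alpha> e t i = cluster ?E i" if i: "i \<in> ?S" for i
  proof
    have "{(a, b). sol_adj N \<alpha> e t a b} \<subseteq> {(a, b). link_adj ?E a b}" using adj by auto
    from rtrancl_mono[OF this] show "sol_comp N \<alpha> e t i \<subseteq> cluster ?E i"
      unfolding sol_comp_def cluster_def by blast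
    have "cluster ?E i \<subseteq> sol_comp N \<alpha> e t i \<inter> cluster ?E i"
    proof (rule cluster_closed)
      show "i \<in> sol_comp N \<alpha> e t i \<inter> cluster ?E i" by (simp add: sol_comp_def)
      fix y z assume y: "y \<in> sol_comp N \<alpha> e t i \<inter> cluster ?E i" and l: "link_adj ?E y z"
      have z: "z \<in> cluster ?E i" using cluster_step y l by blast
      then have "sol_adj N \<alpha> e t y z" using adj clS[OF i] y l by blast
      then show "z \<in> sol_comp N \<alpha> e t i \<inter> cluster ?E i"
        using y z unfolding sol_comp_def by (auto intro: rtrancl_into_rtrancl)
    qed
    then show "cluster ?E i \<subseteq> sol_comp N \<alpha> e t i" by blast
  qed
  have iso: "rooted_iso (sol_comp N \<alpha> e t i) (sol_adj N \<alpha> e t) i (tree_verts T) (tree_adj T) [] \<longleftrightarrow>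
      rooted_iso (tree_verts T) (tree_adj T) [] (cluster ?E i) (link_adj ?E) i" if i: "i \<in> ?S" for i
  proof -
    have "sol_adj N \<alpha> e t x y \<longleftrightarrow> link_adj ?E x y" if "x \<in> cluster ?E i" "y \<in> cluster ?E i" for x y
      using adj clS[OF i] that by blast
    then have "rooted_iso (cluster ?E i) (sol_adj N \<alpha> e t) i (tree_verts T) (tree_adj T) [] \<longleftrightarrow>
       rooted_iso (cluster ?E i) (link_adj ?E) i (tree_verts T) (tree_adj T) []" by (rule rooted_iso_cong)
    also have "\<dots> \<longleftrightarrow> rooted_iso (tree_verts T) (tree_adj T) [] (cluster ?E i) (link_adj ?E) i"
      by (rule iffI; erule rooted_iso_sym)
    finally show ?thesis unfolding comp[OF i] .
  qed
  have "{i \<in> ?S. rooted_iso (sol_comp N \<alpha> e t i) (sol_adj N \<alpha> e t) i (tree_verts T) (tree_adj T) []} =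
     {i\<in>{..<N}. in_sol \<alpha> ?E i \<and> rooted_iso (tree_verts T) (tree_adj T) [] (cluster ?E i) (link_adj ?E) i}"
    using iso by blast
  then have "typ_frac N \<alpha> t T e = (if ?S = {} then 0 else
      (\<Sum>s\<in>shape_class T. tree_count \<alpha> s N e t / real (orderings s)) / real (card ?S))"
    unfolding typ_frac_def Let_def S tree_count_shape_class[OF \<alpha>] by simp
  \<comment> \<open>If no particle is in solution, \<open>sol_frac\<close> is 0 and division by 0
    returns 0, the value that \<open>typ_frac\<close> prescribes.\<close>
  also have "\<dots> = (\<Sum>s\<in>shape_class T. tree_count \<alpha> s N e t / real (orderings s)) / real N / sol_frac \<alpha> N e t"
    using N by (auto simp: sol_frac_def)
  finally show ?thesis .
qed

section \<open>Measurability of the conditional probability\<close>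

lemma insort_key_cong:
  "(\<And>y. y \<in> set ys \<Longrightarrow> f x \<le> f y \<longleftrightarrow> g x \<le> g y) \<Longrightarrow> insort_key f x ys = insort_key g x ys"
  by (induction ys) auto

lemma sort_key_cong:
  "(\<And>x y. x \<in> set xs \<Longrightarrow> y \<in> set xs \<Longrightarrow> f x \<le> f y \<longleftrightarrow> g x \<le> g y) \<Longrightarrow> sort_key f xs = sort_key g xs"
proof (induction xs)
  case (Cons a xs)
  then have "sort_key f xs = sort_key g xs" by simp
  moreover have "insort_key f a (sort_key g xs) = insort_key g a (sort_key g xs)"
    by (rule insort_key_cong) (use Cons.prems in simp)
  ultimately show ?case by simp
qed simp

text \<open>\<open>sort_key\<close> resolves ties by the position in the list, so it depends on the
  clocks only through \<open>\<le>\<close>. The formulation with \<open>\<le>\<close> covers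
  configurations with ties, where \<open>typ_frac\<close> is not expressed through
  \<open>lk\<close>.\<close>

lemma typ_frac_cong:
  assumes "\<And>p q. p \<in> pairs N \<Longrightarrow> q \<in> pairs N \<Longrightarrow> e p \<le> e q \<longleftrightarrow> e' p \<le> e' q"
    and "\<And>p. p \<in> pairs N \<Longrightarrow> e p \<le> t \<longleftrightarrow> e' p \<le> t"
  shows "typ_frac N \<alpha> t T e = typ_frac N \<alpha> t T e'"
proof -
  have "sort_key e (pairs_list N) = sort_key e' (pairs_list N)"
    by (rule sort_key_cong) (use assms(1) in simp)
  then have c: "created N \<alpha> e t = created N \<alpha> e' t"
    unfolding created_def using assms(2) by (auto intro!: arg_cong[where f = "foldl (add_link \<alpha>) {}"] filter_cong)
  then have "in_solution N \<alpha> e t = in_solution N \<alpha> e' t" by (simp add: in_solution_def)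
  moreover from this have "sol_adj N \<alpha> e t = sol_adj N \<alpha> e' t"
    unfolding sol_adj_def fun_eq_iff using assms(2) by blast
  moreover from this have "sol_comp N \<alpha> e t = sol_comp N \<alpha> e' t"
    by (simp add: sol_comp_def fun_eq_iff)
  ultimately show ?thesis by (simp add: typ_frac_def Let_def)
qed

text \<open>As for \<open>measurable_lk\<close>, the value is a function of finite data: here the
  relation \<open>\<le>\<close> among the clocks and the set of clocks up to
  \<open>t\<close>.\<close>

lemma measurable_typ_frac: "(\<lambda>e. typ_frac N \<alpha> t T e) \<in> borel_measurable (particle_clocks N)"
proof -
  let ?P = "prs {..<N}"
  define ord where "ord e = {pq\<in>?P \<times> ?P. e (fst pq) \<le> e (snd pq)}" for e :: "nat \<times> nat \<Rightarrow> real"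
  define thr where "thr e = {p\<in>?P. e p \<le> t}" for e :: "nat \<times> nat \<Rightarrow> real"
  define G where "G R Q = typ_frac N \<alpha> t T (SOME e. ord e = R \<and> thr e = Q)" for R Q
  have eq: "typ_frac N \<alpha> t T e = G (ord e) (thr e)" for e
  proof -
    let ?e = "SOME e'. ord e' = ord e \<and> thr e' = thr e"
    have e: "ord ?e = ord e \<and> thr ?e = thr e"
      by (rule someI[of "\<lambda>e'. ord e' = ord e \<and> thr e' = thr e" e]) simp
    have o: "(p, q) \<in> ord e \<longleftrightarrow> e p \<le> e q" if "p \<in> ?P" "q \<in> ?P" for p q e using that by (simp add: ord_def)
    have h: "p \<in> thr e \<longleftrightarrow> e p \<le> t" if "p \<in> ?P" for p e using that by (simp add: thr_def)
    show ?thesis unfolding G_def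
    proof (rule typ_frac_cong)
      fix p q assume "p \<in> pairs N" "q \<in> pairs N"
      then show "e p \<le> e q \<longleftrightarrow> ?e p \<le> ?e q" using o[of p q e] o[of p q ?e] e by (simp add: pairs_eq_prs)
    next
      fix p assume "p \<in> pairs N"
      then show "e p \<le> t \<longleftrightarrow> ?e p \<le> t" using h[of p e] h[of p ?e] e by (simp add: pairs_eq_prs)
    qed
  qed
  have g: "ord \<in> measurable (particle_clocks N) (count_space (Pow (?P \<times> ?P)))"
    unfolding ord_def[abs_def]
  proof (rule measurable_subset_pred)
    fix pq assume "pq \<in> ?P \<times> ?P"
    then have [measurable]: "(\<lambda>e. e (fst pq)) \<in> borel_measurable (particle_clocks N)" "(\<lambda>e. e (snd pq)) \<in> borel_measurable (particle_clocks N)"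
      by (auto intro: measurable_clock)
    show "Measurable.pred (particle_clocks N) (\<lambda>e. e (fst pq) \<le> e (snd pq))"
      unfolding pred_def by (rule borel_measurable_le) fact+
  qed simp
  have h: "thr \<in> measurable (particle_clocks N) (count_space (Pow ?P))"
    unfolding thr_def[abs_def] by (rule measurable_subset_pred) simp_all
  have "(\<lambda>e. G (ord e) (thr e)) \<in> borel_measurable (particle_clocks N)"
  proof (rule measurable_compose_countable'[OF _ g])
    fix R show "(\<lambda>e. G R (thr e)) \<in> borel_measurable (particle_clocks N)"
      by (rule measurable_compose[OF h]) simp
  qed (simp add: countable_finite)
  then show ?thesis unfolding eq .
qed

lemma AE_clock_neq:
  assumes "0 < \<rho>" "finite P" shows "AE e in clocks \<rho> P. \<forall>p\<in>P. e p \<noteq> t"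
proof -
  have "AE e in clocks \<rho> P. e p \<noteq> t" if p: "p \<in> P" for p
    unfolding clocks_def
    by (rule AE_PiM_component[OF _ p]) (use assms expo_AE(2) prob_space_exponential_density in auto)
  then show ?thesis using assms(2) by (simp add: AE_finite_all)
qed

text \<open>The function \<open>exp (- m * x)\<close> is Lipschitz with constant \<open>m\<close>
  for \<open>x \<ge> 0\<close>, so convergence of the time integral in L1 carries over to its
  Laplace transform.\<close>

lemma exp_mean_limit:
  fixes \<alpha> :: "nat \<Rightarrow> real"
  assumes \<alpha>: "filterlim \<alpha> at_top sequentially" and \<alpha>N: "(\<lambda>N. \<alpha> N / real N) \<longlonglongrightarrow> 0" and t: "0 \<le> t"
  shows "(\<lambda>N. gel_mean (1 / real N) (\<alpha> N) t N (\<lambda>w. exp (- real m * (t - min w t)))) \<longlonglongrightarrow> exp (- real m * limit_time t)"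
proof -
  let ?l = "limit_time t"
  have lip: "\<bar>exp (- real m * x) - exp (- real m * y)\<bar> \<le> real m * \<bar>x - y\<bar>" if "0 \<le> x" "0 \<le> y" for x y
  proof -
    have *: "\<bar>exp (- real m * x) - exp (- real m * y)\<bar> \<le> real m * \<bar>x - y\<bar>" if "0 \<le> x" "x \<le> y" for x y
    proof -
      have "exp (- real m * x) - exp (- real m * y) = exp (- real m * x) * (1 - exp (- (real m * (y - x))))"
        by (simp add: right_diff_distrib mult_exp_exp algebra_simps)
      also have "\<dots> \<le> 1 * (real m * (y - x))"
        using exp_ge_add_one_self[of "- (real m * (y - x))"] that by (intro mult_mono) auto
      finally have "exp (- real m * x) - exp (- real m * y) \<le> real m * (y - x)" by simp
      moreover have "exp (- real m * y) \<le> exp (- real m * x)" using that by (simp add: mult_left_mono)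
      ultimately show ?thesis using that by (simp add: abs_if)
    qed
    show ?thesis
    proof (cases "x \<le> y")
      case True
      then show ?thesis using *[of x y] that by simp
    next
      case False
      then show ?thesis using *[of y x] that by (simp add: abs_minus_commute)
    qed
  qed
  have "(\<lambda>N. real m * (\<integral>e. \<bar>sol_time (\<alpha> N) N e t - ?l\<bar> \<partial>particle_clocks N)) \<longlonglongrightarrow> real m * 0"
    by (intro tendsto_intros sol_time_L1[OF \<alpha> \<alpha>N t])
  then have lim: "(\<lambda>N. real m * (\<integral>e. \<bar>sol_time (\<alpha> N) N e t - ?l\<bar> \<partial>particle_clocks N)) \<longlonglongrightarrow> 0" by simp
  have "(\<lambda>N. gel_mean (1 / real N) (\<alpha> N) t N (\<lambda>w. exp (- real m * (t - min w t))) - exp (- real m * ?l)) \<longlonglongrightarrow> 0"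
  proof (rule Lim_null_comparison[OF _ lim])
    show "eventually (\<lambda>N. norm (gel_mean (1 / real N) (\<alpha> N) t N (\<lambda>w. exp (- real m * (t - min w t))) - exp (- real m * ?l))
      \<le> real m * (\<integral>e. \<bar>sol_time (\<alpha> N) N e t - ?l\<bar> \<partial>particle_clocks N)) sequentially"
      using eventually_gt_at_top[of 0]
    proof eventually_elim
      case (elim N)
      let ?C = "particle_clocks N" and ?X = "\<lambda>e. sol_time (\<alpha> N) N e t"
      interpret C: prob_space ?C by (rule prob_space_clocks) (use elim in simp)
      note [measurable] = measurable_sol_time[OF elim t, of "\<alpha> N"]
      note X0 = sol_time_bounds[OF t, of "\<alpha> N" N]
      have iE: "integrable ?C (\<lambda>e. exp (- real m * ?X e))"
        by (rule C.integrable_const_bound[where B = 1]) (use X0 in auto)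
      have iX: "integrable ?C (\<lambda>e. \<bar>?X e - ?l\<bar>)"
        by (intro integrable_abs Bochner_Integration.integrable_diff integrable_sol_time) (use elim t in auto)
      have "gel_mean (1 / real N) (\<alpha> N) t N (\<lambda>w. exp (- real m * (t - min w t))) = (\<integral>e. exp (- real m * ?X e) \<partial>?C)"
        unfolding gel_mean_def
      proof (rule Bochner_Integration.integral_cong[OF refl])
        fix e
        have "gelled (1 / real N) (\<alpha> N) {..<N} t e = t - ?X e" using sol_time_eq_gelled[OF elim t, of "\<alpha> N" e] by simp
        then show "exp (- real m * (t - min (gelled (1 / real N) (\<alpha> N) {..<N} t e) t)) = exp (- real m * ?X e)"
          using X0[of e] by simp
      qed
      then have "gel_mean (1 / real N) (\<alpha> N) t N (\<lambda>w. exp (- real m * (t - min w t))) - exp (- real m * ?l) =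
        (\<integral>e. exp (- real m * ?X e) - exp (- real m * ?l) \<partial>?C)"
        using iE by (simp add: C.prob_space)
      also have "norm \<dots> \<le> (\<integral>e. norm (exp (- real m * ?X e) - exp (- real m * ?l)) \<partial>?C)"
        by (rule integral_norm_bound)
      also have "\<dots> \<le> (\<integral>e. real m * \<bar>?X e - ?l\<bar> \<partial>?C)"
        by (rule integral_mono) (use iE iX lip X0 limit_time_nonneg[OF t] in auto)
      finally show ?case by simp
    qed
  qed
  then show ?thesis by (simp add: LIM_zero_iff)
qed

text \<open>Division by \<open>n_t t\<close> passes from a density per particle to one per particle
  in solution. For \<open>t > 1\<close> the factor \<open>exp (- m * limit_time t)\<close> is
  \<open>exp (- m) / t ^ m\<close> and all powers of \<open>t\<close> cancel, leaving the critical
  weight \<open>exp (- m)\<close>; for \<open>t \<le> 1\<close> both sides agree since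
  \<open>limit_time t = t\<close> and \<open>n_t t = 1\<close>.\<close>

lemma limit_weight_eq:
  assumes t: "0 \<le> t" and m: "0 < m"
  shows "t ^ (m - 1) * exp (- real m * limit_time t) / n_t t = (t * n_t t) ^ (m - 1) * exp (- (t * n_t t) * real m)"
proof (cases "t \<le> 1")
  case True
  then show ?thesis by (simp add: limit_time_def n_t_def mult.commute)
next
  case False
  have "exp (real m * ln t) = t ^ m" using False by (simp add: exp_of_nat_mult)
  moreover have "exp (- real m * (1 + ln t)) = exp (- real m - real m * ln t)" by (simp add: ring_distribs)
  ultimately have "exp (- real m * (1 + ln t)) = exp (- real m) / t ^ m" by (simp only: exp_diff)
  moreover have "t ^ m = t ^ (m - 1) * t" using m by (cases m) auto
  ultimately show ?thesis using False by (simp add: limit_time_def n_t_def)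
qed

text \<open>The conditional probability is a ratio \<open>c / n\<close>, with \<open>c\<close> the
  fraction of particles in solution whose cluster has shape \<open>T\<close> and \<open>n\<close>
  the fraction in solution. As \<open>c / n\<close> lies in \<open>[0, 1]\<close>, replacing the
  random denominator by \<open>n_t t\<close> costs at most the distance of \<open>n\<close> from
  \<open>n_t t\<close> divided by \<open>n_t t\<close>, which vanishes in mean; and the mean of
  \<open>c\<close> is a finite sum of tree densities.\<close>

theorem theorem1p3:
  fixes \<alpha> :: "nat \<Rightarrow> real" and \<gamma> t :: real and T :: ptree
  assumes alpha_inf: "filterlim \<alpha> at_top sequentially"
    and alpha_small: "(\<lambda>N. \<alpha> N / real N) \<longlonglongrightarrow> 0"
    and gamma: "\<gamma> > 1/3"
    and alpha_big: "filterlim (\<lambda>N. \<alpha> N / (real N powr (2/3) * ln (real N) powr \<gamma>)) at_top sequentially"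
    and t: "t \<ge> 0"
  shows "(\<lambda>N. typ_prob N (\<alpha> N) t T) \<longlonglongrightarrow> gw_poisson_law (t * n_t t) T"
proof -
  let ?m = "\<lambda>s. tree_size s"
  define c where "c N e = (\<Sum>s\<in>shape_class T. tree_count (\<alpha> N) s N e t / real (orderings s)) / real N" for N e
  have n0: "0 < n_t t" using t by (simp add: n_t_def)
  have ev: "eventually (\<lambda>N. 0 < N \<and> real (tree_size T) < \<alpha> N) sequentially"
    using filterlim_at_top_dense[THEN iffD1, OF alpha_inf, rule_format, of "real (tree_size T)"] eventually_gt_at_top[of 0]
    by eventually_elim auto
  have tc_int: "integrable (particle_clocks N) (\<lambda>e. tree_count (\<alpha> N) s N e t)" if "0 < N" for N s
  proof -
    interpret C: prob_space "particle_clocks N" by (rule prob_space_clocks) (use that in simp)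
    show ?thesis
      by (rule C.integrable_const_bound[where B = "real (card (embeddings s N))"]) (use tree_count_bounds in auto)
  qed
  have "(\<lambda>N. (\<integral>e. tree_count (\<alpha> N) s N e t \<partial>particle_clocks N) / real N) \<longlonglongrightarrow> t ^ (?m s - 1) * exp (- real (?m s) * limit_time t)" for s
  proof -
    have "(\<lambda>N. ((\<integral>e. tree_count (\<alpha> N) s N e t \<partial>particle_clocks N) / real N -
        t ^ (?m s - 1) * gel_mean (1 / real N) (\<alpha> N) t N (\<lambda>w. exp (- real (?m s) * (t - min w t)))) +
        t ^ (?m s - 1) * gel_mean (1 / real N) (\<alpha> N) t N (\<lambda>w. exp (- real (?m s) * (t - min w t)))) \<longlonglongrightarrow>
        0 + t ^ (?m s - 1) * exp (- real (?m s) * limit_time t)"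
      using tree_count_limit[OF alpha_inf t, of "\<lambda>_ _. 1" s]
      by (intro tendsto_add tendsto_mult tendsto_const exp_mean_limit[OF alpha_inf alpha_small t]) simp_all
    then show ?thesis by simp
  qed
  then have "(\<lambda>N. (\<Sum>s\<in>shape_class T. (\<integral>e. tree_count (\<alpha> N) s N e t \<partial>particle_clocks N) / real N / real (orderings s)) / n_t t)
     \<longlonglongrightarrow> (\<Sum>s\<in>shape_class T. t ^ (?m s - 1) * exp (- real (?m s) * limit_time t) / real (orderings s)) / n_t t"
    by (intro tendsto_sum tendsto_divide tendsto_const) (use n0 in auto)
  also have "(\<Sum>s\<in>shape_class T. t ^ (?m s - 1) * exp (- real (?m s) * limit_time t) / real (orderings s)) / n_t t = gw_poisson_law (t * n_t t) T"
    unfolding gw_poisson_law_def gw_plane_prob_poisson sum_divide_distrib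
  proof (rule sum.cong[OF refl])
    fix s
    show "t ^ (?m s - 1) * exp (- real (?m s) * limit_time t) / real (orderings s) / n_t t =
      (t * n_t t) ^ (?m s - 1) * exp (- (t * n_t t) * real (?m s)) / real (orderings s)"
      unfolding limit_weight_eq[OF t tree_size_pos, symmetric] by (simp add: mult.commute)
  qed
  finally have mean: "(\<lambda>N. (\<Sum>s\<in>shape_class T. (\<integral>e. tree_count (\<alpha> N) s N e t \<partial>particle_clocks N) / real N / real (orderings s)) / n_t t)
     \<longlonglongrightarrow> gw_poisson_law (t * n_t t) T" .
  have "(\<lambda>N. (\<integral>e. \<bar>sol_frac (\<alpha> N) N e t - n_t t\<bar> \<partial>particle_clocks N) / n_t t) \<longlonglongrightarrow> 0 / n_t t"
    by (intro tendsto_divide sol_frac_L1[OF alpha_inf alpha_small t] tendsto_const) (use n0 in simp)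
  then have err: "(\<lambda>N. (\<integral>e. \<bar>sol_frac (\<alpha> N) N e t - n_t t\<bar> \<partial>particle_clocks N) / n_t t) \<longlonglongrightarrow> 0" by simp
  have "(\<lambda>N. typ_prob N (\<alpha> N) t T - (\<Sum>s\<in>shape_class T. (\<integral>e. tree_count (\<alpha> N) s N e t \<partial>particle_clocks N) / real N / real (orderings s)) / n_t t) \<longlonglongrightarrow> 0"
  proof (rule Lim_null_comparison[OF _ err])
    show "eventually (\<lambda>N. norm (typ_prob N (\<alpha> N) t T -
        (\<Sum>s\<in>shape_class T. (\<integral>e. tree_count (\<alpha> N) s N e t \<partial>particle_clocks N) / real N / real (orderings s)) / n_t t)
      \<le> (\<integral>e. \<bar>sol_frac (\<alpha> N) N e t - n_t t\<bar> \<partial>particle_clocks N) / n_t t) sequentially"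
      using ev
    proof eventually_elim
      case (elim N)
      let ?C = "particle_clocks N" and ?n = "\<lambda>e. sol_frac (\<alpha> N) N e t"
      have N: "0 < N" and \<rho>: "0 < 1 / real N" using elim by auto
      interpret C: prob_space ?C by (rule prob_space_clocks[OF \<rho>])
      note [measurable] = measurable_fracs(3)
      have cm [measurable]: "c N \<in> borel_measurable ?C" unfolding c_def[abs_def] by measurable
      have c_bounds: "0 \<le> c N e" "c N e \<le> ?n e" for e
      proof -
        show "0 \<le> c N e" unfolding c_def by (intro divide_nonneg_nonneg sum_nonneg tree_count_bounds) auto
        have "card {i\<in>{..<N}. in_sol (\<alpha> N) (sol_graph (\<alpha> N) N e t) i \<and> rooted_iso (tree_verts T) (tree_adj T) []
            (cluster (sol_graph (\<alpha> N) N e t) i) (link_adj (sol_graph (\<alpha> N) N e t)) i} \<le>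
           card {i\<in>{..<N}. in_sol (\<alpha> N) (sol_graph (\<alpha> N) N e t) i}" by (intro card_mono) auto
        then show "c N e \<le> ?n e"
          unfolding c_def sol_frac_def using tree_count_shape_class[of T "\<alpha> N" N e t] elim
          by (intro divide_right_mono) auto
      qed
      have ratio: "0 \<le> c N e / ?n e" "c N e / ?n e \<le> 1" for e
        using c_bounds[of e] by (auto simp: divide_le_eq_1)
      have i1: "integrable ?C (\<lambda>e. c N e / ?n e)"
      proof (rule C.integrable_const_bound[where B = 1])
        have "norm (c N e / ?n e) \<le> 1" for e
          unfolding real_norm_def abs_of_nonneg[OF ratio(1)] by (rule ratio(2))
        then show "AE e in ?C. norm (c N e / ?n e) \<le> 1" by blast
      qed measurable
      have i2: "integrable ?C (c N)"
        unfolding c_def[abs_def] by (intro integrable_divide Bochner_Integration.integrable_sum tc_int N)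
      have "typ_prob N (\<alpha> N) t T = (\<integral>e. typ_frac N (\<alpha> N) t T e \<partial>?C)"
        by (simp add: typ_prob_def clock_space_eq)
      also have "\<dots> = (\<integral>e. c N e / ?n e \<partial>?C)"
      proof -
        have ae: "AE e in ?C. typ_frac N (\<alpha> N) t T e = c N e / ?n e"
        proof -
          have "AE e in ?C. inj_on e (prs {..<N}) \<and> (\<forall>p\<in>prs {..<N}. e p \<noteq> t)"
            using AE_inj_clocks[OF \<rho>, of "prs {..<N}"] AE_clock_neq[OF \<rho>, of "prs {..<N}" t] by simp
          then show ?thesis
            by (rule eventually_mono) (use typ_frac_eq[OF N] elim in \<open>auto simp: c_def\<close>)
        qed
        have m2: "(\<lambda>e. c N e / ?n e) \<in> borel_measurable ?C" by measurable
        show ?thesis by (rule integral_cong_AE[OF measurable_typ_frac m2 ae])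
      qed
      finally have tp: "typ_prob N (\<alpha> N) t T = (\<integral>e. c N e / ?n e \<partial>?C)" .
      have "(\<integral>e. c N e \<partial>?C) = (\<Sum>s\<in>shape_class T. (\<integral>e. tree_count (\<alpha> N) s N e t \<partial>?C) / real N / real (orderings s))"
        unfolding c_def using tc_int[OF N] by (simp add: Bochner_Integration.integral_sum sum_divide_distrib mult.commute)
      then have "typ_prob N (\<alpha> N) t T - (\<Sum>s\<in>shape_class T. (\<integral>e. tree_count (\<alpha> N) s N e t \<partial>?C) / real N / real (orderings s)) / n_t t =
         (\<integral>e. c N e / ?n e - c N e / n_t t \<partial>?C)"
        using i1 i2 by (simp add: tp)
      also have "norm \<dots> \<le> (\<integral>e. norm (c N e / ?n e - c N e / n_t t) \<partial>?C)" by (rule integral_norm_bound)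
      also have "\<dots> \<le> (\<integral>e. \<bar>?n e - n_t t\<bar> / n_t t \<partial>?C)"
      proof (rule integral_mono)
        show "integrable ?C (\<lambda>e. norm (c N e / ?n e - c N e / n_t t))" using i1 i2 by simp
        show "integrable ?C (\<lambda>e. \<bar>?n e - n_t t\<bar> / n_t t)" using integral_frac_bounds(9)[OF N] by simp
        fix e
        \<comment> \<open>The identity also holds for \<open>n = 0\<close>, where
          \<open>c \<le> n\<close> forces \<open>c = 0\<close>.\<close>
        have eq: "c N e / ?n e - c N e / n_t t = (c N e / ?n e) * ((n_t t - ?n e) / n_t t)"
        proof (cases "?n e = 0")
          case True
          then have "c N e = 0" using c_bounds[of e] by simp
          then show ?thesis by simp
        next
          case False
          then show ?thesis using n0 by (simp add: field_simps)
        qed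
        have "\<bar>c N e / ?n e\<bar> = c N e / ?n e" by (rule abs_of_nonneg[OF ratio(1)])
        moreover have "\<bar>(n_t t - ?n e) / n_t t\<bar> = \<bar>?n e - n_t t\<bar> / n_t t"
          using n0 by (simp add: abs_minus_commute)
        ultimately have "norm (c N e / ?n e - c N e / n_t t) = (c N e / ?n e) * (\<bar>?n e - n_t t\<bar> / n_t t)"
          unfolding eq real_norm_def abs_mult by (simp only:)
        also have "\<dots> \<le> 1 * (\<bar>?n e - n_t t\<bar> / n_t t)" using ratio[of e] n0 by (intro mult_right_mono) auto
        finally show "norm (c N e / ?n e - c N e / n_t t) \<le> \<bar>?n e - n_t t\<bar> / n_t t" by simp
      qed
      also have "\<dots> = (\<integral>e. \<bar>?n e - n_t t\<bar> \<partial>?C) / n_t t" by simp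
      finally show ?case .
    qed
  qed
  from tendsto_add[OF this mean] show ?thesis by simp
qed

end
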